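(* Let $n,k$ be positive integers and $r\in\{0,\dots,n-1\}$. For all $1\le a,b,c,d\le n$ and $m,l\in\mathbb Z$, the operators $$[{}^L\mathcal J^a_{b,m},{}^L\mathcal J^c_{d,l}]-\delta^c_b\,{}^L\mathcal J^a_{d,m+l}+\delta^a_d\,{}^L\mathcal J^c_{b,m+l}-km\,\delta_{m+l,0}\left(\delta^a_d\delta^c_b-\frac1n\delta^a_b\delta^c_d\right)$$ on $\widetilde{\mathcal H}_{nL+r}(n,k)$ have order $O(L^{-1})$.
   Context: For $N\ge1$ let $\mathbb C[X,A]$ be the polynomial ring in the entries of an $N\times N$ matrix $X=(X^i_j)$ and an $n\times N$ matrix $A=(A^a_i)$, and $\mathcal H_N(n,k)=\{f: f(gXg^{-1},Ag^{-1})=\det(g)^{-k}f(X,A)\ \forall g\in GL_N(\mathbb C)\}$. For $N=nL+r$ ($0\le r<n$), $\widetilde{\mathcal H}_N(n,k)$ is the same space graded by (degree in $X$) $-\frac k2L(L-1)n-krL$; it is graded in degrees $\ge0$, and $\widetilde{\mathcal H}_N(n,k)_{\le e}$ is the sum of the components of degree $\le e$. $\|\cdot\|_L$ is the norm of the Hermitian inner product on $\widetilde{\mathcal H}_{nL+r}(n,k)$ restricted from the one on $\mathbb C[X,A]$ for which $\langle1,1\rangle=1$ and multiplication by each variable is adjoint to the corresponding partial derivative. Put $Y^i_j=\partial/\partial X^j_i$, $B^i_a=\partial/\partial A^a_i$, $\mathsf T_{m,0}(E^a_b)=A^aY^mB_b=\sum A^a_i(Y^m)^i_jB^j_b$, $\mathsf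 T_{0,m}(E^a_b)=A^aX^mB_b$, and $\mathsf T_{\cdot,\cdot}(E^a_b)_0=\mathsf T_{\cdot,\cdot}(E^a_b)-\frac{\delta^a_b}n\sum_c\mathsf T_{\cdot,\cdot}(E^c_c)$. On $\widetilde{\mathcal H}_N(n,k)$, $N=nL+r$, define $${}^L\mathcal J^a_{b,m}=\left(\frac n{(n+k)N}\right)^{|m|/2}\begin{cases}\mathsf T_{m,0}(E^a_b)_0,&m\ge0,\\ \mathsf T_{0,-m}(E^a_b)_0,&m<0.\end{cases}$$ A sequence of operators ${}^L\mathcal A\in\mathrm{End}(\widetilde{\mathcal H}_{nL+r}(n,k))$ is of order $O(L^{-h})$ if for every $e\in\mathbb N$ there is a constant $C_e>0$ such that $\|{}^L\mathcal A(v)\|_L\le C_eL^{-h}\|v\|_L$ for all $L\ge1$ and all $v\in\widetilde{\mathcal H}_{nL+r}(n,k)_{\le e}$. *)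

theory Defs
  imports
    "HOL-Analysis.Analysis"
    "HOL-Library.Poly_Mapping"
    "Jordan_Normal_Form.Determinant"
begin

section \<open>The polynomial rings $C[X,A]$\<close>

text \<open>
  All rings $C[X,A]$, for varying $N$ and $n$, are subrings of one polynomial ring in
  countably many variables: \<open>XVar i j\<close> is $X^i_j$ and \<open>AVar a i\<close> is $A^a_i$ (upper
  index first). All indices start at 0, so $1,\dots,N$ is rendered as \<open>{..<N}\<close>.
\<close>

datatype var = XVar nat nat | AVar nat nat

type_synonym cpoly = "(var \<Rightarrow>\<^sub>0 nat) \<Rightarrow>\<^sub>0 complex"

definition Const :: "complex \<Rightarrow> cpoly" where
  "Const c = Poly_Mapping.single 0 c"

definition Var :: "var \<Rightarrow> cpoly" where
  "Var v = Poly_Mapping.single (Poly_Mapping.single v 1) 1"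

definition poly_ring :: "var set \<Rightarrow> cpoly set" where
  "poly_ring V = {f. \<forall>\<alpha>\<in>Poly_Mapping.keys f. Poly_Mapping.keys \<alpha> \<subseteq> V}"

definition vars :: "nat \<Rightarrow> nat \<Rightarrow> var set" where
  "vars n N = {XVar i j | i j. i < N \<and> j < N} \<union> {AVar a i | a i. a < n \<and> i < N}"

definition pd :: "var \<Rightarrow> cpoly \<Rightarrow> cpoly" where
  "pd v f = (\<Sum>\<alpha>\<in>Poly_Mapping.keys f.
     Poly_Mapping.single (\<alpha> - Poly_Mapping.single v 1)
       (of_nat (Poly_Mapping.lookup \<alpha> v) * Poly_Mapping.lookup f \<alpha>))"

definition subst :: "(var \<Rightarrow> cpoly) \<Rightarrow> cpoly \<Rightarrow> cpoly" where
  "subst \<sigma> f = (\<Sum>\<alpha>\<in>Poly_Mapping.keys f.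
     Const (Poly_Mapping.lookup f \<alpha>) *
       (\<Prod>v\<in>Poly_Mapping.keys \<alpha>. \<sigma> v ^ Poly_Mapping.lookup \<alpha> v))"

definition Xmat :: "nat \<Rightarrow> cpoly mat" where
  "Xmat N = mat N N (\<lambda>(i, j). Var (XVar i j))"

definition Amat :: "nat \<Rightarrow> nat \<Rightarrow> cpoly mat" where
  "Amat n N = mat n N (\<lambda>(a, i). Var (AVar a i))"

section \<open>The graded spaces of covariants\<close>

text \<open>\<open>gl_act n N g h f\<close> is $f(gXh, Ah)$; it is used with $h = g^{-1}$.\<close>

definition gl_act :: "nat \<Rightarrow> nat \<Rightarrow> complex mat \<Rightarrow> complex mat \<Rightarrow> cpoly \<Rightarrow> cpoly" where
  "gl_act n N g h f = subst
     (\<lambda>v. case v of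
        XVar i j \<Rightarrow> (map_mat Const g * Xmat N * map_mat Const h) $$ (i, j)
      | AVar a i \<Rightarrow> (Amat n N * map_mat Const h) $$ (a, i)) f"

definition Hspace :: "nat \<Rightarrow> nat \<Rightarrow> nat \<Rightarrow> cpoly set" where
  "Hspace n k N = {f \<in> poly_ring (vars n N).
     \<forall>g \<in> carrier_mat N N. \<forall>h \<in> carrier_mat N N. inverts_mat g h \<and> inverts_mat h g \<longrightarrow>
       gl_act n N g h f = Const (inverse (det g) ^ k) * f}"

definition xdeg :: "(var \<Rightarrow>\<^sub>0 nat) \<Rightarrow> nat" where
  "xdeg \<alpha> = (\<Sum>v\<in>Poly_Mapping.keys \<alpha>.
     case v of XVar i j \<Rightarrow> Poly_Mapping.lookup \<alpha> v | AVar a i \<Rightarrow> 0)"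

definition Htilde :: "nat \<Rightarrow> nat \<Rightarrow> nat \<Rightarrow> nat \<Rightarrow> cpoly set" where
  "Htilde n k r L = Hspace n k (n * L + r)"

text \<open>
  The degree shift is $\frac k2 L(L-1)n + krL$; the division by 2 is exact. Degrees are
  integers, so that non-negativity of the grading is not built into the definition.
\<close>

definition Htilde_comp :: "nat \<Rightarrow> nat \<Rightarrow> nat \<Rightarrow> nat \<Rightarrow> int \<Rightarrow> cpoly set" where
  "Htilde_comp n k r L d = {f \<in> Htilde n k r L. \<forall>\<alpha>\<in>Poly_Mapping.keys f.
     int (xdeg \<alpha>) - int (k * n * (L * (L - 1) div 2) + k * r * L) = d}"

definition Htilde_le :: "nat \<Rightarrow> nat \<Rightarrow> nat \<Rightarrow> nat \<Rightarrow> nat \<Rightarrow> cpoly set" where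
  "Htilde_le n k r L e =
     {\<Sum>d\<in>D. v d | (D :: int set) v.
        finite D \<and> (\<forall>d\<in>D. d \<le> int e \<and> v d \<in> Htilde_comp n k r L d)}"

section \<open>The Hermitian inner product\<close>

definition is_fock_inner :: "var set \<Rightarrow> (cpoly \<Rightarrow> cpoly \<Rightarrow> complex) \<Rightarrow> bool" where
  "is_fock_inner V ip \<longleftrightarrow>
     (\<forall>f\<in>poly_ring V. \<forall>g\<in>poly_ring V. \<forall>h\<in>poly_ring V. ip (f + g) h = ip f h + ip g h) \<and>
     (\<forall>c. \<forall>f\<in>poly_ring V. \<forall>g\<in>poly_ring V. ip (Const c * f) g = c * ip f g) \<and>
     (\<forall>f\<in>poly_ring V. \<forall>g\<in>poly_ring V. ip g f = cnj (ip f g)) \<and>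
     (\<forall>f\<in>poly_ring V. f \<noteq> 0 \<longrightarrow> 0 < Re (ip f f)) \<and>
     ip 1 1 = 1 \<and>
     (\<forall>v\<in>V. \<forall>f\<in>poly_ring V. \<forall>g\<in>poly_ring V. ip (Var v * f) g = ip f (pd v g))"

text \<open>
  The inner product is taken on the big ring; \<open>fock_inner_unique\<close> below shows that it exists
  and that on each $C[X,A]$ it is the only inner product with the required properties.
\<close>

definition fock_inner :: "cpoly \<Rightarrow> cpoly \<Rightarrow> complex" where
  "fock_inner = (THE ip. is_fock_inner UNIV ip)"

definition fock_norm :: "cpoly \<Rightarrow> real" where
  "fock_norm f = sqrt (Re (fock_inner f f))"

section \<open>The operators\<close>

text \<open>\<open>Ypow N m i j\<close> is $(Y^m)^i_j$ with $Y^i_j = \partial/\partial X^j_i$.\<close>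

fun Ypow :: "nat \<Rightarrow> nat \<Rightarrow> nat \<Rightarrow> nat \<Rightarrow> cpoly \<Rightarrow> cpoly" where
  "Ypow N 0 i j f = (if i = j then f else 0)"
| "Ypow N (Suc m) i j f = (\<Sum>l<N. pd (XVar l i) (Ypow N m l j f))"

text \<open>
  \<open>T_Y N m a b\<close> and \<open>T_X N m a b\<close> are $T_{m,0}(E^a_b)$ and $T_{0,m}(E^a_b)$; here
  $B^j_b = \partial/\partial A^b_j$.
\<close>

definition T_Y :: "nat \<Rightarrow> nat \<Rightarrow> nat \<Rightarrow> nat \<Rightarrow> cpoly \<Rightarrow> cpoly" where
  "T_Y N m a b f = (\<Sum>i<N. \<Sum>j<N. Var (AVar a i) * Ypow N m i j (pd (AVar b j) f))"

definition T_X :: "nat \<Rightarrow> nat \<Rightarrow> nat \<Rightarrow> nat \<Rightarrow> cpoly \<Rightarrow> cpoly" where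
  "T_X N m a b f =
     (\<Sum>i<N. \<Sum>j<N. Var (AVar a i) * (Xmat N ^\<^sub>m m) $$ (i, j) * pd (AVar b j) f)"

definition kdelta :: "'a \<Rightarrow> 'a \<Rightarrow> complex" where
  "kdelta x y = (if x = y then 1 else 0)"

definition traceless ::
  "nat \<Rightarrow> (nat \<Rightarrow> nat \<Rightarrow> cpoly \<Rightarrow> cpoly) \<Rightarrow> nat \<Rightarrow> nat \<Rightarrow> cpoly \<Rightarrow> cpoly" where
  "traceless n T a b f = T a b f - Const (kdelta a b / of_nat n) * (\<Sum>c<n. T c c f)"

definition Jop ::
  "nat \<Rightarrow> nat \<Rightarrow> nat \<Rightarrow> nat \<Rightarrow> nat \<Rightarrow> nat \<Rightarrow> int \<Rightarrow> cpoly \<Rightarrow> cpoly" where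
  "Jop n k r L a b m f =
     (let N = n * L + r in
      Const (complex_of_real
        ((real n / (real (n + k) * real N)) powr (real_of_int \<bar>m\<bar> / 2))) *
      (if m \<ge> 0 then traceless n (T_Y N (nat m)) a b f
       else traceless n (T_X N (nat (- m))) a b f))"

definition commutator :: "(cpoly \<Rightarrow> cpoly) \<Rightarrow> (cpoly \<Rightarrow> cpoly) \<Rightarrow> cpoly \<Rightarrow> cpoly" where
  "commutator S T f = S (T f) - T (S f)"

section \<open>Orders of sequences of operators\<close>

text \<open>
  Operators are functions on the big ring of which only the values on the given subspace
  matter; membership in \<open>End_space V\<close> says that they restrict to linear endomorphisms of it.
\<close>

definition End_space :: "cpoly set \<Rightarrow> (cpoly \<Rightarrow> cpoly) set" where
  "End_space V = {T. (\<forall>v\<in>V. T v \<in> V) \<and> (\<forall>u\<in>V. \<forall>v\<in>V. T (u + v) = T u + T v) \<and>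
     (\<forall>c. \<forall>v\<in>V. T (Const c * v) = Const c * T v)}"

definition has_order ::
  "nat \<Rightarrow> nat \<Rightarrow> nat \<Rightarrow> int \<Rightarrow> (nat \<Rightarrow> cpoly \<Rightarrow> cpoly) \<Rightarrow> bool" where
  "has_order n k r h \<A> \<longleftrightarrow>
     (\<forall>L\<ge>1. \<A> L \<in> End_space (Htilde n k r L)) \<and>
     (\<forall>e::nat. \<exists>C>0. \<forall>L\<ge>1. \<forall>v\<in>Htilde_le n k r L e.
        fock_norm (\<A> L v) \<le> C * real L powi (- h) * fock_norm v)"

section \<open>Existence and uniqueness of the inner product\<close>

definition mfact :: "(var \<Rightarrow>\<^sub>0 nat) \<Rightarrow> real" where
  "mfact \<alpha> = (\<Prod>v\<in>Poly_Mapping.keys \<alpha>. fact (Poly_Mapping.lookup \<alpha> v))"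

definition fock_formula :: "cpoly \<Rightarrow> cpoly \<Rightarrow> complex" where
  "fock_formula f g = (\<Sum>\<alpha>\<in>Poly_Mapping.keys f.
     Poly_Mapping.lookup f \<alpha> * cnj (Poly_Mapping.lookup g \<alpha>) * of_real (mfact \<alpha>))"

lemma mfact_pos: "mfact \<alpha> > 0"
  unfolding mfact_def by (intro prod_pos) auto

lemma mfact_0 [simp]: "mfact 0 = 1"
  by (simp add: mfact_def)

lemma mfact_superset:
  assumes "finite K" "Poly_Mapping.keys \<alpha> \<subseteq> K"
  shows "mfact \<alpha> = (\<Prod>v\<in>K. fact (Poly_Mapping.lookup \<alpha> v))"
  unfolding mfact_def using assms
  by (intro prod.mono_neutral_left) (auto simp: in_keys_iff)

lemma mfact_add_single:
  "mfact (\<alpha> + Poly_Mapping.single v 1) = real (Poly_Mapping.lookup \<alpha> v + 1) * mfact \<alpha>"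
proof -
  let ?K = "insert v (Poly_Mapping.keys \<alpha>)"
  have sub: "Poly_Mapping.keys (\<alpha> + Poly_Mapping.single v 1) \<subseteq> ?K"
    using keys_add[of \<alpha> "Poly_Mapping.single v 1"] by auto
  have rest: "(\<Prod>u\<in>?K - {v}. fact (Poly_Mapping.lookup (\<alpha> + Poly_Mapping.single v 1) u) :: real)
      = (\<Prod>u\<in>?K - {v}. fact (Poly_Mapping.lookup \<alpha> u))"
    by (intro prod.cong) (auto simp: lookup_add lookup_single)
  have "mfact (\<alpha> + Poly_Mapping.single v 1)
      = (\<Prod>u\<in>?K. fact (Poly_Mapping.lookup (\<alpha> + Poly_Mapping.single v 1) u))"
    by (rule mfact_superset[OF _ sub]) simp
  also have "\<dots> = fact (Poly_Mapping.lookup \<alpha> v + 1) *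
      (\<Prod>u\<in>?K - {v}. fact (Poly_Mapping.lookup \<alpha> u))"
    by (subst prod.remove[of _ v], simp, simp, subst rest) (simp add: lookup_add)
  also have "\<dots> = real (Poly_Mapping.lookup \<alpha> v + 1) * (\<Prod>u\<in>?K. fact (Poly_Mapping.lookup \<alpha> u))"
    by (subst prod.remove[of ?K v]) auto
  also have "(\<Prod>u\<in>?K. fact (Poly_Mapping.lookup \<alpha> u)) = mfact \<alpha>"
    by (rule mfact_superset[symmetric]) auto
  finally show ?thesis .
qed

lemma lookup_Const_mult:
  "Poly_Mapping.lookup (Const c * f) \<alpha> = c * Poly_Mapping.lookup f \<alpha>"
  unfolding Const_def mult_map_scale_conv_mult[symmetric]
  by (simp add: Poly_Mapping.map.rep_eq when_def)

lemma fock_formula_superset: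
  assumes "finite K" "Poly_Mapping.keys f \<subseteq> K"
  shows "fock_formula f g = (\<Sum>\<alpha>\<in>K.
     Poly_Mapping.lookup f \<alpha> * cnj (Poly_Mapping.lookup g \<alpha>) * of_real (mfact \<alpha>))"
  unfolding fock_formula_def using assms
  by (intro sum.mono_neutral_left) (auto simp: in_keys_iff)

lemma fock_formula_add: "fock_formula (f + g) h = fock_formula f h + fock_formula g h"
  using fock_formula_superset[of "Poly_Mapping.keys f \<union> Poly_Mapping.keys g" "f + g" h]
    fock_formula_superset[of "Poly_Mapping.keys f \<union> Poly_Mapping.keys g" f h]
    fock_formula_superset[of "Poly_Mapping.keys f \<union> Poly_Mapping.keys g" g h]
    keys_add[of f g]
  by (simp add: lookup_add algebra_simps sum.distrib)

lemma fock_formula_scale: "fock_formula (Const c * f) g = c * fock_formula f g"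
proof -
  have "Poly_Mapping.keys (Const c * f) \<subseteq> Poly_Mapping.keys f"
    by (auto simp: in_keys_iff lookup_Const_mult)
  then show ?thesis
    by (subst fock_formula_superset[of "Poly_Mapping.keys f"])
      (simp_all add: lookup_Const_mult fock_formula_def sum_distrib_left mult.assoc)
qed

lemma fock_formula_herm: "fock_formula g f = cnj (fock_formula f g)"
proof -
  let ?K = "Poly_Mapping.keys f \<union> Poly_Mapping.keys g"
  show ?thesis
    using fock_formula_superset[of ?K f g] fock_formula_superset[of ?K g f]
    by (simp add: mult.commute)
qed

lemma fock_formula_pos:
  assumes "f \<noteq> 0"
  shows "0 < Re (fock_formula f f)"
proof -
  have eq: "Re (Poly_Mapping.lookup f \<alpha> * cnj (Poly_Mapping.lookup f \<alpha>) * of_real (mfact \<alpha>))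
      = (cmod (Poly_Mapping.lookup f \<alpha>))\<^sup>2 * mfact \<alpha>" for \<alpha>
    unfolding complex_norm_square[symmetric] of_real_mult[symmetric] by simp
  have "0 < (\<Sum>\<alpha>\<in>Poly_Mapping.keys f. (cmod (Poly_Mapping.lookup f \<alpha>))\<^sup>2 * mfact \<alpha>)"
    using assms by (intro sum_pos) (auto simp: in_keys_iff mfact_pos)
  then show ?thesis
    unfolding fock_formula_def Re_sum eq .
qed

lemma poly_sum_monomials:
  fixes f :: cpoly
  shows "f = (\<Sum>\<alpha>\<in>Poly_Mapping.keys f. Poly_Mapping.single \<alpha> (Poly_Mapping.lookup f \<alpha>))"
  by (rule poly_mapping_eqI)
    (auto simp: lookup_sum lookup_single when_def in_keys_iff sum.delta'
      cong: if_cong)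

lemma lookup_pd:
  "Poly_Mapping.lookup (pd v f) \<alpha> =
     of_nat (Poly_Mapping.lookup \<alpha> v + 1) *
       Poly_Mapping.lookup f (\<alpha> + Poly_Mapping.single v 1)"
proof -
  let ?e = "Poly_Mapping.single v (1::nat)"
  let ?c = "of_nat (Poly_Mapping.lookup \<alpha> v + 1) * Poly_Mapping.lookup f (\<alpha> + ?e)"
  have "(of_nat (Poly_Mapping.lookup \<beta> v) * Poly_Mapping.lookup f \<beta> when \<beta> - ?e = \<alpha>)
      = (if \<beta> = \<alpha> + ?e then ?c else 0)" for \<beta>
  proof (cases "Poly_Mapping.lookup \<beta> v = 0")
    case True
    then have "\<beta> \<noteq> \<alpha> + ?e"
      by (auto simp: lookup_add)
    with True show ?thesis by simp
  next
    case False
    have "\<beta> - ?e + ?e = \<beta>"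
      using False by (intro poly_mapping_eqI) (auto simp: lookup_add lookup_minus lookup_single when_def)
    then have "\<beta> - ?e = \<alpha> \<longleftrightarrow> \<beta> = \<alpha> + ?e"
      by auto
    then show ?thesis
      by (simp add: lookup_add when_def)
  qed
  then have "Poly_Mapping.lookup (pd v f) \<alpha> =
      (\<Sum>\<beta>\<in>Poly_Mapping.keys f. if \<beta> = \<alpha> + ?e then ?c else 0)"
    unfolding pd_def lookup_sum lookup_single by simp
  then show ?thesis
    by (simp add: sum.delta' in_keys_iff)
qed

lemma lookup_Var_mult_add:
  "Poly_Mapping.lookup (Var v * f) (\<alpha> + Poly_Mapping.single v 1) = Poly_Mapping.lookup f \<alpha>"
  and keys_Var_mult:
  "Poly_Mapping.keys (Var v * f) \<subseteq> (\<lambda>\<alpha>. \<alpha> + Poly_Mapping.single v 1) ` Poly_Mapping.keys f"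
proof -
  let ?e = "Poly_Mapping.single v (1::nat)"
  have "Var v * f = (\<Sum>\<beta>\<in>Poly_Mapping.keys f.
      Poly_Mapping.single (\<beta> + ?e) (Poly_Mapping.lookup f \<beta>))"
    by (subst (1) poly_sum_monomials[of f])
      (simp add: Var_def sum_distrib_left mult_single add.commute)
  then have *: "Poly_Mapping.lookup (Var v * f) \<gamma> = (\<Sum>\<beta>\<in>Poly_Mapping.keys f.
      if \<beta> + ?e = \<gamma> then Poly_Mapping.lookup f \<beta> else 0)" for \<gamma>
    by (simp add: lookup_sum lookup_single when_def)
  show "Poly_Mapping.lookup (Var v * f) (\<alpha> + ?e) = Poly_Mapping.lookup f \<alpha>"
    unfolding * by (simp add: in_keys_iff)
  show "Poly_Mapping.keys (Var v * f) \<subseteq> (\<lambda>\<alpha>. \<alpha> + ?e) ` Poly_Mapping.keys f"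
  proof
    fix \<gamma> assume "\<gamma> \<in> Poly_Mapping.keys (Var v * f)"
    then have "(\<Sum>\<beta>\<in>Poly_Mapping.keys f.
        if \<beta> + ?e = \<gamma> then Poly_Mapping.lookup f \<beta> else 0) \<noteq> 0"
      by (simp add: in_keys_iff *)
    then obtain \<beta> where "\<beta> \<in> Poly_Mapping.keys f" "\<beta> + ?e = \<gamma>"
      by (rule sum.not_neutral_contains_not_neutral) (auto split: if_splits)
    then show "\<gamma> \<in> (\<lambda>\<alpha>. \<alpha> + ?e) ` Poly_Mapping.keys f" by blast
  qed
qed

lemma fock_formula_adjoint: "fock_formula (Var v * f) g = fock_formula f (pd v g)"
proof -
  let ?s = "\<lambda>\<alpha>. \<alpha> + Poly_Mapping.single v (1::nat)"
  have "fock_formula (Var v * f) g = (\<Sum>\<alpha>\<in>?s ` Poly_Mapping.keys f.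
     Poly_Mapping.lookup (Var v * f) \<alpha> * cnj (Poly_Mapping.lookup g \<alpha>) * of_real (mfact \<alpha>))"
    by (rule fock_formula_superset[OF _ keys_Var_mult]) simp
  also have "\<dots> = (\<Sum>\<alpha>\<in>Poly_Mapping.keys f.
     Poly_Mapping.lookup (Var v * f) (?s \<alpha>) * cnj (Poly_Mapping.lookup g (?s \<alpha>)) *
       of_real (mfact (?s \<alpha>)))"
    by (subst sum.reindex) (auto simp: inj_on_def)
  also have "\<dots> = fock_formula f (pd v g)"
    unfolding fock_formula_def lookup_Var_mult_add lookup_pd mfact_add_single
    by (intro sum.cong) (simp_all add: algebra_simps)
  finally show ?thesis .
qed

lemma poly_ring_monomial:
  assumes "Poly_Mapping.keys \<alpha> \<subseteq> V"
  shows "Poly_Mapping.single \<alpha> c \<in> poly_ring V"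
  using assms by (simp add: poly_ring_def)

lemma poly_ring_add: "f \<in> poly_ring V \<Longrightarrow> g \<in> poly_ring V \<Longrightarrow> f + g \<in> poly_ring V"
  using keys_add[of f g] unfolding poly_ring_def by blast

lemma poly_ring_sum:
  assumes "\<And>x. x \<in> S \<Longrightarrow> F x \<in> poly_ring V"
  shows "(\<Sum>x\<in>S. F x) \<in> poly_ring V"
proof (cases "finite S")
  case True
  then show ?thesis using assms
  proof (induction S rule: finite_induct)
    case empty
    show ?case by (simp add: poly_ring_def)
  next
    case (insert x S)
    then show ?case by (simp add: poly_ring_add)
  qed
qed (simp add: poly_ring_def)

lemma poly_ring_pd:
  assumes "f \<in> poly_ring V"
  shows "pd v f \<in> poly_ring V"
  unfolding pd_def
proof (intro poly_ring_sum poly_ring_monomial)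
  fix \<alpha> assume "\<alpha> \<in> Poly_Mapping.keys f"
  then have "Poly_Mapping.keys \<alpha> \<subseteq> V"
    using assms by (auto simp: poly_ring_def)
  then show "Poly_Mapping.keys (\<alpha> - Poly_Mapping.single v 1) \<subseteq> V"
    by (auto simp: in_keys_iff lookup_minus)
qed

lemma Const_poly_ring: "Const c \<in> poly_ring V"
  by (simp add: Const_def poly_ring_def)

lemma pd_Const: "pd v (Const c) = 0"
proof (rule poly_mapping_eqI)
  fix \<alpha> :: "var \<Rightarrow>\<^sub>0 nat"
  have "Poly_Mapping.lookup (\<alpha> + Poly_Mapping.single v 1) v \<noteq> Poly_Mapping.lookup 0 v"
    by (simp add: lookup_add)
  then have "0 \<noteq> \<alpha> + Poly_Mapping.single v 1"
    by metis
  then show "Poly_Mapping.lookup (pd v (Const c)) \<alpha> = Poly_Mapping.lookup 0 \<alpha>"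
    unfolding lookup_pd Const_def by (simp add: lookup_single)
qed

lemma is_fock_inner_formula: "is_fock_inner V fock_formula"
  unfolding is_fock_inner_def
  by (intro conjI ballI allI impI fock_formula_add fock_formula_scale fock_formula_herm
      fock_formula_pos fock_formula_adjoint) (simp_all add: fock_formula_def lookup_one)

lemma is_fock_innerD:
  assumes "is_fock_inner V ip"
  shows is_fock_inner_addD: "\<lbrakk>f \<in> poly_ring V; g \<in> poly_ring V; h \<in> poly_ring V\<rbrakk>
      \<Longrightarrow> ip (f + g) h = ip f h + ip g h"
    and is_fock_inner_scaleD: "\<lbrakk>f \<in> poly_ring V; g \<in> poly_ring V\<rbrakk>
      \<Longrightarrow> ip (Const c * f) g = c * ip f g"
    and is_fock_inner_hermD: "\<lbrakk>f \<in> poly_ring V; g \<in> poly_ring V\<rbrakk> \<Longrightarrow> ip g f = cnj (ip f g)"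
    and is_fock_inner_oneD: "ip 1 1 = 1"
    and is_fock_inner_adjD: "\<lbrakk>v \<in> V; f \<in> poly_ring V; g \<in> poly_ring V\<rbrakk>
      \<Longrightarrow> ip (Var v * f) g = ip f (pd v g)"
proof -
  note * = assms[unfolded is_fock_inner_def]
  note c2 = *[THEN conjunct2] and c3 = *[THEN conjunct2, THEN conjunct2]
  note c5 = c3[THEN conjunct2, THEN conjunct2]
  show "\<lbrakk>f \<in> poly_ring V; g \<in> poly_ring V; h \<in> poly_ring V\<rbrakk>
      \<Longrightarrow> ip (f + g) h = ip f h + ip g h"
    by (rule *[THEN conjunct1, rule_format])
  show "\<lbrakk>f \<in> poly_ring V; g \<in> poly_ring V\<rbrakk> \<Longrightarrow> ip (Const c * f) g = c * ip f g"
    by (rule c2[THEN conjunct1, rule_format])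
  show "\<lbrakk>f \<in> poly_ring V; g \<in> poly_ring V\<rbrakk> \<Longrightarrow> ip g f = cnj (ip f g)"
    by (rule c3[THEN conjunct1, rule_format])
  show "ip 1 1 = 1"
    by (rule c5[THEN conjunct1])
  show "\<lbrakk>v \<in> V; f \<in> poly_ring V; g \<in> poly_ring V\<rbrakk> \<Longrightarrow> ip (Var v * f) g = ip f (pd v g)"
    by (rule c5[THEN conjunct2, rule_format])
qed

lemma is_fock_inner_sum_left:
  assumes ip: "is_fock_inner V ip" and g: "g \<in> poly_ring V"
    and F: "\<And>x. x \<in> S \<Longrightarrow> F x \<in> poly_ring V"
  shows "ip (\<Sum>x\<in>S. F x) g = (\<Sum>x\<in>S. ip (F x) g)"
proof -
  note add = is_fock_inner_addD[OF ip _ _ g]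
  have "ip (0 + 0) g = ip 0 g + ip 0 g"
    by (rule add) (simp_all add: poly_ring_def)
  then have zero: "ip 0 g = 0" by simp
  show ?thesis
  proof (cases "finite S")
    case True
    then show ?thesis using F
    proof (induction S rule: finite_induct)
      case empty
      show ?case by (simp add: zero)
    next
      case (insert x S)
      then have "ip (F x + (\<Sum>x\<in>S. F x)) g = ip (F x) g + ip (\<Sum>x\<in>S. F x) g"
        by (intro add poly_ring_sum) auto
      with insert show ?case by simp
    qed
  qed (simp add: zero)
qed

lemma ex_key:
  fixes \<alpha> :: "'a \<Rightarrow>\<^sub>0 nat"
  assumes "\<alpha> \<noteq> 0"
  obtains v where "v \<in> Poly_Mapping.keys \<alpha>"
proof -
  have "\<exists>v. Poly_Mapping.lookup \<alpha> v \<noteq> 0"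
    using assms by (auto intro: poly_mapping_eqI)
  with that show thesis by (auto simp: in_keys_iff)
qed

lemma is_fock_inner_monomial:
  assumes ip: "is_fock_inner V ip"
    and "Poly_Mapping.keys \<alpha> \<subseteq> V" "g \<in> poly_ring V"
  shows "ip (Poly_Mapping.single \<alpha> c) g = fock_formula (Poly_Mapping.single \<alpha> c) g"
  using assms(2,3)
proof (induction "\<Sum>v\<in>Poly_Mapping.keys \<alpha>. Poly_Mapping.lookup \<alpha> v" arbitrary: \<alpha> g rule: less_induct)
  case less
  note fi = is_fock_inner_formula[of V]
  note scale = is_fock_inner_scaleD[OF ip] and herm = is_fock_inner_hermD[OF ip]
    and adj = is_fock_inner_adjD[OF ip] and one = is_fock_inner_oneD[OF ip]
  have step: "ip (Poly_Mapping.single \<alpha> c) g = ip (Poly_Mapping.single (\<alpha> - Poly_Mapping.single v 1) c) (pd v g)"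
    "v \<in> V" "Poly_Mapping.single \<alpha> c = Var v * Poly_Mapping.single (\<alpha> - Poly_Mapping.single v 1) c"
    "Poly_Mapping.keys (\<alpha> - Poly_Mapping.single v 1) \<subseteq> V"
    if v: "v \<in> Poly_Mapping.keys \<alpha>" and \<alpha>: "Poly_Mapping.keys \<alpha> \<subseteq> V" and g: "g \<in> poly_ring V" for v \<alpha> g c
  proof -
    have e: "\<alpha> = Poly_Mapping.single v 1 + (\<alpha> - Poly_Mapping.single v 1)"
      using v by (intro poly_mapping_eqI)
        (auto simp: lookup_add lookup_minus lookup_single when_def in_keys_iff)
    show 1: "Poly_Mapping.single \<alpha> c = Var v * Poly_Mapping.single (\<alpha> - Poly_Mapping.single v 1) c"
      by (subst (1) e) (simp add: Var_def mult_single)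
    show 2: "v \<in> V" using v \<alpha> by blast
    show 3: "Poly_Mapping.keys (\<alpha> - Poly_Mapping.single v 1) \<subseteq> V"
      using \<alpha> by (auto simp: in_keys_iff lookup_minus)
    show "ip (Poly_Mapping.single \<alpha> c) g = ip (Poly_Mapping.single (\<alpha> - Poly_Mapping.single v 1) c) (pd v g)"
      unfolding 1 by (intro adj 2 poly_ring_monomial 3 g)
  qed
  show ?case
  proof (cases "\<alpha> = 0")
    case False
    then obtain v where v: "v \<in> Poly_Mapping.keys \<alpha>"
      by (rule ex_key)
    let ?\<beta> = "\<alpha> - Poly_Mapping.single v 1"
    have "(\<Sum>u\<in>Poly_Mapping.keys ?\<beta>. Poly_Mapping.lookup ?\<beta> u)
        = (\<Sum>u\<in>Poly_Mapping.keys \<alpha>. Poly_Mapping.lookup ?\<beta> u)"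
      by (intro sum.mono_neutral_left) (auto simp: in_keys_iff lookup_minus)
    also have "\<dots> < (\<Sum>u\<in>Poly_Mapping.keys \<alpha>. Poly_Mapping.lookup \<alpha> u)"
      using v by (intro sum_strict_mono_ex1) (auto simp: lookup_minus in_keys_iff intro!: bexI[of _ v])
    finally have "ip (Poly_Mapping.single ?\<beta> c) (pd v g) = fock_formula (Poly_Mapping.single ?\<beta> c) (pd v g)"
      by (rule less.hyps) (use step(4)[OF v less.prems] less.prems in \<open>auto intro: poly_ring_pd\<close>)
    then have "ip (Poly_Mapping.single \<alpha> c) g
        = fock_formula (Var v * Poly_Mapping.single ?\<beta> c) g"
      unfolding step(1)[OF v less.prems] fock_formula_adjoint .
    then show ?thesis
      by (simp only: step(3)[OF v less.prems, symmetric])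
  next
    case True
    have mon: "ip (Poly_Mapping.single \<beta> d) 1 = fock_formula (Poly_Mapping.single \<beta> d) 1"
      if \<beta>: "Poly_Mapping.keys \<beta> \<subseteq> V" for \<beta> d
    proof (cases "\<beta> = 0")
      case True
      have "Poly_Mapping.single 0 d = Const d * 1" by (simp add: Const_def)
      with True show ?thesis
        using scale[of 1 1 d] one fock_formula_scale[of d 1 1] Const_poly_ring[of 1 V]
        by (simp add: Const_def fock_formula_def)
    next
      case False
      then obtain v where v: "v \<in> Poly_Mapping.keys \<beta>" by (rule ex_key)
      have o: "1 \<in> poly_ring V" using Const_poly_ring[of 1 V] by (simp add: Const_def)
      have pd1: "pd v 1 = 0" using pd_Const[of v 1] by (simp add: Const_def)
      have z: "(0::cpoly) \<in> poly_ring V" by (simp add: poly_ring_def)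
      let ?x = "Poly_Mapping.single (\<beta> - Poly_Mapping.single v 1) d"
      have x: "?x \<in> poly_ring V"
        by (rule poly_ring_monomial[OF step(4)[OF v \<beta> o]])
      have "ip 0 ?x = 0"
        using is_fock_inner_sum_left[OF ip x, of "{}"] by simp
      moreover have "ip ?x 0 = cnj (ip 0 ?x)"
        by (rule herm[OF z x])
      ultimately have "ip (Poly_Mapping.single \<beta> d) 1 = 0"
        unfolding step(1)[OF v \<beta> o] pd1 by (simp only: complex_cnj_zero)
      moreover have "fock_formula (Poly_Mapping.single \<beta> d) 1 = 0"
        using False by (auto simp: fock_formula_def lookup_one)
      ultimately show ?thesis by simp
    qed
    have o: "1 \<in> poly_ring V" using Const_poly_ring[of 1 V] by (simp add: Const_def)
    have gm: "Poly_Mapping.single \<beta> d \<in> poly_ring V" if "\<beta> \<in> Poly_Mapping.keys g" for \<beta> d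
      using that less.prems by (intro poly_ring_monomial) (auto simp: poly_ring_def)
    have "ip g 1 = (\<Sum>\<beta>\<in>Poly_Mapping.keys g. ip (Poly_Mapping.single \<beta> (Poly_Mapping.lookup g \<beta>)) 1)"
      by (subst (1) poly_sum_monomials[of g], rule is_fock_inner_sum_left[OF ip o]) (rule gm)
    also have "\<dots> = (\<Sum>\<beta>\<in>Poly_Mapping.keys g.
        fock_formula (Poly_Mapping.single \<beta> (Poly_Mapping.lookup g \<beta>)) 1)"
      using less.prems by (intro sum.cong mon) (auto simp: poly_ring_def)
    also have "\<dots> = fock_formula g 1"
      by (subst (3) poly_sum_monomials[of g], rule is_fock_inner_sum_left[OF fi o, symmetric]) (rule gm)
    finally have "ip g 1 = fock_formula g 1" .
    then have "ip 1 g = fock_formula 1 g"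
      using herm[OF less.prems(2) o] fock_formula_herm[of 1 g] by simp
    then have "ip (Const c * 1) g = fock_formula (Const c * 1) g"
      by (simp only: scale[OF o less.prems(2)] fock_formula_scale)
    then show ?thesis
      unfolding True by (simp add: Const_def)
  qed
qed

lemma is_fock_inner_imp_formula:
  assumes ip: "is_fock_inner V ip" and f: "f \<in> poly_ring V" and g: "g \<in> poly_ring V"
  shows "ip f g = fock_formula f g"
proof -
  have fm: "Poly_Mapping.keys \<beta> \<subseteq> V" if "\<beta> \<in> Poly_Mapping.keys f" for \<beta>
    using that f by (auto simp: poly_ring_def)
  have "ip f g = (\<Sum>\<beta>\<in>Poly_Mapping.keys f. ip (Poly_Mapping.single \<beta> (Poly_Mapping.lookup f \<beta>)) g)"
    by (subst (1) poly_sum_monomials[of f], rule is_fock_inner_sum_left[OF ip g])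
      (intro poly_ring_monomial fm)
  also have "\<dots> = (\<Sum>\<beta>\<in>Poly_Mapping.keys f.
      fock_formula (Poly_Mapping.single \<beta> (Poly_Mapping.lookup f \<beta>)) g)"
    by (intro sum.cong is_fock_inner_monomial[OF ip] fm g) auto
  also have "\<dots> = fock_formula f g"
    by (subst (3) poly_sum_monomials[of f],
        rule is_fock_inner_sum_left[OF is_fock_inner_formula g, symmetric])
      (intro poly_ring_monomial fm)
  finally show ?thesis .
qed

lemma fock_inner_eq: "fock_inner = fock_formula"
  unfolding fock_inner_def
proof (rule the_equality)
  show "is_fock_inner UNIV fock_formula" by (rule is_fock_inner_formula)
next
  fix ip assume ip: "is_fock_inner UNIV ip"
  show "ip = fock_formula"
    by (intro ext is_fock_inner_imp_formula[OF ip]) (simp_all add: poly_ring_def)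
qed

theorem fock_inner_unique:
  "is_fock_inner V fock_inner"
  "is_fock_inner V ip \<Longrightarrow> f \<in> poly_ring V \<Longrightarrow> g \<in> poly_ring V \<Longrightarrow> ip f g = fock_inner f g"
  unfolding fock_inner_eq by (rule is_fock_inner_formula) (rule is_fock_inner_imp_formula)

end

theory Submission
  imports Defs
begin

text \<open>
  Restricting covariants to the matrices $X$ whose first $n$ columns vanish, with $A = (1_n \mid 0)$, gives
  a map from covariants for $N$ to covariants for $N-n$. By the Krylov normal form of a generic pair
  $(X,A)$ it is injective in degrees below $L$, and it intertwines $A^aB_b$ and $A^aXYB_b$ up to
  scalar corrections. The powers of a Hermitian combination $S^\dagger S$ of the corrected operators $U$, $V$
  therefore satisfy one recurrence for all $L$, and a Hermitian operator satisfying a fixed recurrence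
  has a bounded norm; so $U$ and $V$ are bounded uniformly in $L$.

  Since covariants are annihilated by the moment map, $[A^aYB_b, A^cXB_d]$ can be expressed through $U$ and $V$:
  it is $(n+k)L$ times the expected value, up to bounded terms. This is the assertion for
  $(m,l) = (1,-1)$. As $X$ is adjoint to $Y$ and $Y$ lowers the degree, it also bounds the currents of degree
  $\pm1$. The others follow by induction: for equal signs the relations hold exactly, the current
  of degree $m+1$ is an average of brackets of those of degrees 1 and $m$, and the Jacobi identity
  carries over both the bounds and the relations.
\<close>

section \<open>Evaluation and differentiation of polynomials\<close>

text \<open>The restriction is not an isometry, so norms for different L cannot be compared through
  it. A polynomial relation between powers of an operator is purely algebraic, however, and
  injectivity carries it from L to L+1; self-adjointness, available for each L separately, then
  turns the coefficients of the relation into a norm bound. This requires operators that intertwine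
  exactly: A^aB_b grows by k delta^a_b in each step and A^aXYB_b by (2k+n) A^aB_b, so the
  corrections in \<open>U\<close> and \<open>V\<close> sum these increments and are linear and
  quadratic in L. In the bracket of degrees 1 and -1 all terms of order L^2 cancel. The terms of
  order L are (k+n)L times the gl_n relation with central part k delta^c_b delta^a_d, and -kL
  delta^a_b delta^c_d. The traceless projection kills the latter and creates the 1/n belonging to
  the former. The square n/((n+k)N) of the scaling is 1/((k+n)L) up to a relative error r/N, which
  is of order 1/L.\<close>

lemma Const_0 [simp]: "Const 0 = 0" and Const_1 [simp]: "Const 1 = 1"
  by (simp_all add: Const_def)

lemma Const_add: "Const (a + b) = Const a + Const b"
  by (simp add: Const_def single_add)

lemma Const_mult: "Const (a * b) = Const a * Const b"
  by (simp add: Const_def mult_single)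

lemma Const_uminus: "Const (- a) = - Const a"
  by (simp add: Const_def single_uminus)

lemma Const_diff: "Const (a - b) = Const a - Const b"
  by (simp add: Const_def single_diff)

lemma Const_of_nat: "Const (of_nat m) = of_nat m"
  by (induction m) (simp_all add: Const_add)

lemma poly_ring_UNIV: "f \<in> poly_ring UNIV"
  by (simp add: poly_ring_def)

section \<open>Exponents, total degree and induction on polynomials\<close>

definition tdeg :: "(var \<Rightarrow>\<^sub>0 nat) \<Rightarrow> nat" where
  "tdeg \<alpha> = (\<Sum>v\<in>Poly_Mapping.keys \<alpha>. Poly_Mapping.lookup \<alpha> v)"

lemma tdeg_superset:
  assumes "finite K" "Poly_Mapping.keys \<alpha> \<subseteq> K"
  shows "tdeg \<alpha> = (\<Sum>v\<in>K. Poly_Mapping.lookup \<alpha> v)"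
  unfolding tdeg_def using assms by (intro sum.mono_neutral_left) (auto simp: in_keys_iff)

lemma tdeg_add: "tdeg (\<alpha> + \<beta>) = tdeg \<alpha> + tdeg \<beta>"
proof -
  let ?K = "Poly_Mapping.keys \<alpha> \<union> Poly_Mapping.keys \<beta>"
  have "Poly_Mapping.keys (\<alpha> + \<beta>) \<subseteq> ?K" by (rule keys_add)
  then show ?thesis
    using tdeg_superset[of ?K "\<alpha> + \<beta>"] tdeg_superset[of ?K \<alpha>] tdeg_superset[of ?K \<beta>]
    by (simp add: lookup_add sum.distrib)
qed

lemma tdeg_single [simp]: "tdeg (Poly_Mapping.single v m) = m"
  by (simp add: tdeg_def)

lemma exponent_minus_single:
  fixes \<alpha> :: "var \<Rightarrow>\<^sub>0 nat"
  assumes "v \<in> Poly_Mapping.keys \<alpha>"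
  shows "\<alpha> - Poly_Mapping.single v 1 + Poly_Mapping.single v 1 = \<alpha>"
  using assms by (intro poly_mapping_eqI)
    (auto simp: lookup_add lookup_minus lookup_single when_def in_keys_iff)

lemma keys_add_single:
  fixes \<alpha> :: "var \<Rightarrow>\<^sub>0 nat"
  shows "Poly_Mapping.keys (\<alpha> + Poly_Mapping.single v 1) = insert v (Poly_Mapping.keys \<alpha>)"
  by (auto simp: in_keys_iff lookup_add lookup_single when_def split: if_splits)

lemma exponent_induct [case_names zero add]:
  fixes \<alpha> :: "var \<Rightarrow>\<^sub>0 nat"
  assumes "P 0" and step: "\<And>v \<beta>. P \<beta> \<Longrightarrow> P (\<beta> + Poly_Mapping.single v 1)"
  shows "P \<alpha>"
proof (induction "tdeg \<alpha>" arbitrary: \<alpha>)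
  case 0
  have "\<alpha> = 0"
  proof (rule ccontr)
    assume "\<alpha> \<noteq> 0"
    then obtain v where v: "v \<in> Poly_Mapping.keys \<alpha>" by (rule ex_key)
    with 0 show False by (auto simp: tdeg_def in_keys_iff)
  qed
  with assms(1) show ?case by simp
next
  case (Suc m)
  have "\<alpha> \<noteq> 0" using Suc.hyps(2) by (auto simp: tdeg_def)
  then obtain v where v: "v \<in> Poly_Mapping.keys \<alpha>" by (rule ex_key)
  let ?\<beta> = "\<alpha> - Poly_Mapping.single v 1"
  note e = exponent_minus_single[OF v]
  have "tdeg ?\<beta> + 1 = tdeg \<alpha>"
    using arg_cong[OF e, of tdeg] by (simp add: tdeg_add)
  then have "m = tdeg ?\<beta>" using Suc.hyps(2) by simp
  from step[OF Suc.hyps(1)[OF this]] e show ?case by metis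
qed

lemma poly_ring_mult_Var:
  assumes "v \<in> V" "f \<in> poly_ring V"
  shows "Var v * f \<in> poly_ring V"
proof -
  have "Poly_Mapping.keys \<alpha> \<subseteq> V" if "\<alpha> \<in> Poly_Mapping.keys (Var v * f)" for \<alpha>
  proof -
    from that keys_Var_mult[of v f] obtain \<beta> where
      \<beta>: "\<beta> \<in> Poly_Mapping.keys f" "\<alpha> = \<beta> + Poly_Mapping.single v 1" by auto
    with assms keys_add[of \<beta> "Poly_Mapping.single v 1"] show ?thesis
      by (auto simp: poly_ring_def)
  qed
  then show ?thesis by (simp add: poly_ring_def)
qed

text \<open>Constants, sums and multiplication by one variable generate the ring, so homomorphism
  properties and chain rules need checking only there. The variables are confined to V because the
  sums in the chain rules run over such a set.\<close>

lemma poly_ring_induct [consumes 1, case_names Const add Var]: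
  assumes f: "f \<in> poly_ring V"
    and C: "\<And>c. P (Const c)"
    and A: "\<And>f g. f \<in> poly_ring V \<Longrightarrow> g \<in> poly_ring V \<Longrightarrow> P f \<Longrightarrow> P g \<Longrightarrow> P (f + g)"
    and M: "\<And>v f. v \<in> V \<Longrightarrow> f \<in> poly_ring V \<Longrightarrow> P f \<Longrightarrow> P (Var v * f)"
  shows "P f"
proof -
  have mono: "Poly_Mapping.keys \<alpha> \<subseteq> V \<Longrightarrow> P (Poly_Mapping.single \<alpha> c)" for \<alpha> c
  proof (induction \<alpha> rule: exponent_induct)
    case zero
    show ?case using C[of c] by (simp add: Const_def)
  next
    case (add v \<beta>)
    note k = keys_add_single[of \<beta> v]
    have "Poly_Mapping.single (\<beta> + Poly_Mapping.single v 1) c = Var v * Poly_Mapping.single \<beta> c"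
      by (simp add: Var_def mult_single add.commute)
    moreover have "P (Var v * Poly_Mapping.single \<beta> c)"
      using add k by (intro M poly_ring_monomial) auto
    ultimately show ?case by simp
  qed
  have "finite S \<Longrightarrow> (\<And>\<alpha>. \<alpha> \<in> S \<Longrightarrow> Poly_Mapping.keys \<alpha> \<subseteq> V) \<Longrightarrow>
      P (\<Sum>\<alpha>\<in>S. Poly_Mapping.single \<alpha> (Poly_Mapping.lookup f \<alpha>))" for S
  proof (induction S rule: finite_induct)
    case empty
    show ?case using C[of 0] by simp
  next
    case (insert \<alpha> S)
    then show ?case by (simp, intro A mono poly_ring_sum poly_ring_monomial) auto
  qed
  from this[of "Poly_Mapping.keys f"] f show ?thesis
    by (subst poly_sum_monomials) (auto simp: poly_ring_def)
qed

lemma cpoly_induct [case_names Const add Var]: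
  assumes "\<And>c. P (Const c)" "\<And>f g. P f \<Longrightarrow> P g \<Longrightarrow> P (f + g)" "\<And>v f. P f \<Longrightarrow> P (Var v * f)"
  shows "P f"
  using poly_ring_UNIV[of f] assms by (rule poly_ring_induct)

subsection \<open>Evaluation homomorphisms\<close>

text \<open>The target ring is a parameter because three targets occur: polynomials for
  \<open>subst\<close>, complex numbers for values at points, and \<open>complex poly\<close> for
  values along curves depending on t.\<close>

definition gev :: "(complex \<Rightarrow> 'b::comm_ring_1) \<Rightarrow> (var \<Rightarrow> 'b) \<Rightarrow> cpoly \<Rightarrow> 'b" where
  "gev h \<sigma> f = (\<Sum>\<alpha>\<in>Poly_Mapping.keys f. h (Poly_Mapping.lookup f \<alpha>) *
     (\<Prod>v\<in>Poly_Mapping.keys \<alpha>. \<sigma> v ^ Poly_Mapping.lookup \<alpha> v))"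

lemma subst_eq_gev: "subst = gev Const"
  by (intro ext) (simp add: subst_def gev_def)

locale coefficient_hom =
  fixes h :: "complex \<Rightarrow> 'b::comm_ring_1"
  assumes h_add: "h (a + b) = h a + h b" and h_mult: "h (a * b) = h a * h b" and h_1: "h 1 = 1"
begin

lemma h_0: "h 0 = 0"
  using h_add[of 0 0] by simp

lemma gev_superset:
  assumes "finite K" "Poly_Mapping.keys f \<subseteq> K"
  shows "gev h \<sigma> f = (\<Sum>\<alpha>\<in>K. h (Poly_Mapping.lookup f \<alpha>) *
     (\<Prod>v\<in>Poly_Mapping.keys \<alpha>. \<sigma> v ^ Poly_Mapping.lookup \<alpha> v))"
  unfolding gev_def using assms
  by (intro sum.mono_neutral_left) (auto simp: in_keys_iff h_0)

lemma gev_add: "gev h \<sigma> (f + g) = gev h \<sigma> f + gev h \<sigma> g"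
proof -
  let ?K = "Poly_Mapping.keys f \<union> Poly_Mapping.keys g"
  have "Poly_Mapping.keys (f + g) \<subseteq> ?K" by (rule keys_add)
  then show ?thesis
    using gev_superset[of ?K "f + g" \<sigma>] gev_superset[of ?K f \<sigma>] gev_superset[of ?K g \<sigma>]
    by (simp add: lookup_add h_add distrib_right sum.distrib)
qed

lemma gev_Const [simp]: "gev h \<sigma> (Const c) = h c"
  by (cases "c = 0") (simp_all add: gev_def Const_def h_0)

lemma gev_Var_mult: "gev h \<sigma> (Var v * f) = \<sigma> v * gev h \<sigma> f"
proof -
  let ?e = "Poly_Mapping.single v (1::nat)"
  have mono: "(\<Prod>u\<in>Poly_Mapping.keys (\<alpha> + ?e). \<sigma> u ^ Poly_Mapping.lookup (\<alpha> + ?e) u)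
      = \<sigma> v * (\<Prod>u\<in>Poly_Mapping.keys \<alpha>. \<sigma> u ^ Poly_Mapping.lookup \<alpha> u)" for \<alpha>
  proof -
    let ?K = "insert v (Poly_Mapping.keys \<alpha>)"
    note k = keys_add_single[of \<alpha> v]
    have "(\<Prod>u\<in>?K. \<sigma> u ^ Poly_Mapping.lookup (\<alpha> + ?e) u)
        = (\<Prod>u\<in>?K. \<sigma> u ^ Poly_Mapping.lookup ?e u) * (\<Prod>u\<in>?K. \<sigma> u ^ Poly_Mapping.lookup \<alpha> u)"
      by (simp only: lookup_add power_add prod.distrib mult.commute)
    also have "(\<Prod>u\<in>?K. \<sigma> u ^ Poly_Mapping.lookup ?e u) = (\<Prod>u\<in>{v}. \<sigma> u ^ Poly_Mapping.lookup ?e u)"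
      by (intro prod.mono_neutral_right) (auto simp: lookup_single when_def)
    also have "(\<Prod>u\<in>?K. \<sigma> u ^ Poly_Mapping.lookup \<alpha> u)
        = (\<Prod>u\<in>Poly_Mapping.keys \<alpha>. \<sigma> u ^ Poly_Mapping.lookup \<alpha> u)"
      by (intro prod.mono_neutral_right) (auto simp: in_keys_iff)
    finally show ?thesis unfolding k by simp
  qed
  have "gev h \<sigma> (Var v * f) = (\<Sum>\<alpha>\<in>(\<lambda>\<alpha>. \<alpha> + ?e) ` Poly_Mapping.keys f.
      h (Poly_Mapping.lookup (Var v * f) \<alpha>) *
     (\<Prod>v\<in>Poly_Mapping.keys \<alpha>. \<sigma> v ^ Poly_Mapping.lookup \<alpha> v))"
    by (rule gev_superset[OF _ keys_Var_mult]) simp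
  also have "\<dots> = (\<Sum>\<alpha>\<in>Poly_Mapping.keys f. h (Poly_Mapping.lookup f \<alpha>) *
     (\<sigma> v * (\<Prod>v\<in>Poly_Mapping.keys \<alpha>. \<sigma> v ^ Poly_Mapping.lookup \<alpha> v)))"
    by (subst sum.reindex) (simp_all add: inj_on_def lookup_Var_mult_add mono del: One_nat_def)
  finally show ?thesis
    by (simp add: gev_def sum_distrib_left ac_simps)
qed

lemma gev_mult: "gev h \<sigma> (f * g) = gev h \<sigma> f * gev h \<sigma> g"
proof (induction f rule: cpoly_induct)
  case (Const c)
  have "gev h \<sigma> (Const c * g) = h c * gev h \<sigma> g"
  proof (induction g rule: cpoly_induct)
    case (Const d)
    then show ?case by (simp add: Const_mult[symmetric] h_mult)
  next
    case (add f g)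
    then show ?case by (simp add: distrib_left gev_add)
  next
    case (Var v f)
    have "gev h \<sigma> (Const c * (Var v * f)) = gev h \<sigma> (Var v * (Const c * f))"
      by (simp add: ac_simps)
    also have "\<dots> = h c * gev h \<sigma> (Var v * f)"
      by (simp only: gev_Var_mult Var) (simp add: ac_simps)
    finally show ?case .
  qed
  then show ?case by simp
next
  case (add f1 f2)
  then show ?case by (simp add: distrib_right gev_add)
next
  case (Var v f)
  then show ?case by (simp add: gev_Var_mult mult.assoc)
qed

lemma gev_0 [simp]: "gev h \<sigma> 0 = 0" and gev_1 [simp]: "gev h \<sigma> 1 = 1"
  using gev_Const[of \<sigma> 0] gev_Const[of \<sigma> 1] by (simp_all add: h_0 h_1 del: gev_Const)

lemma gev_Var [simp]: "gev h \<sigma> (Var v) = \<sigma> v"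
  using gev_Var_mult[of \<sigma> v 1] by simp

lemma gev_uminus: "gev h \<sigma> (- f) = - gev h \<sigma> f"
  using gev_add[of \<sigma> f "- f"] by (simp add: eq_neg_iff_add_eq_0 add.commute)

lemma gev_diff: "gev h \<sigma> (f - g) = gev h \<sigma> f - gev h \<sigma> g"
  using gev_add[of \<sigma> f "- g"] by (simp add: gev_uminus)

lemma gev_sum: "gev h \<sigma> (\<Sum>x\<in>S. F x) = (\<Sum>x\<in>S. gev h \<sigma> (F x))"
  by (induction S rule: infinite_finite_induct) (simp_all add: gev_add)

lemma gev_cong:
  assumes "f \<in> poly_ring V" "\<And>v. v \<in> V \<Longrightarrow> \<sigma> v = \<tau> v"
  shows "gev h \<sigma> f = gev h \<tau> f"
  using assms(1) by (induction rule: poly_ring_induct) (simp_all add: gev_add gev_Var_mult assms(2))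

end

interpretation Const: coefficient_hom Const
  by unfold_locales (simp_all add: Const_add Const_mult)

abbreviation peval :: "(var \<Rightarrow> complex) \<Rightarrow> cpoly \<Rightarrow> complex" where
  "peval \<equiv> gev (\<lambda>c. c)"

interpretation peval: coefficient_hom "\<lambda>c. c"
  by unfold_locales simp_all

lemma gev_subst:
  assumes "coefficient_hom h"
  shows "gev h \<tau> (subst \<sigma> f) = gev h (\<lambda>v. gev h \<tau> (\<sigma> v)) f"
proof -
  interpret coefficient_hom h by fact
  show ?thesis unfolding subst_eq_gev
    by (induction f rule: cpoly_induct)
      (simp_all add: gev_add gev_mult gev_Var_mult Const.gev_add Const.gev_Var_mult)
qed

lemmas peval_subst = gev_subst[OF peval.coefficient_hom_axioms]

subsection \<open>Partial derivatives\<close>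

lemma pd_add: "pd v (f + g) = pd v f + pd v g"
  by (rule poly_mapping_eqI) (simp add: lookup_pd lookup_add algebra_simps)

lemma pd_0 [simp]: "pd v 0 = 0"
  using pd_Const[of v 0] by simp

lemma pd_1 [simp]: "pd v 1 = 0"
  using pd_Const[of v 1] by simp

lemma pd_uminus: "pd v (- f) = - pd v f"
  using pd_add[of v f "- f"] by (simp add: eq_neg_iff_add_eq_0 add.commute)

lemma pd_diff: "pd v (f - g) = pd v f - pd v g"
  using pd_add[of v f "- g"] by (simp add: pd_uminus)

lemma pd_sum: "pd v (\<Sum>x\<in>S. F x) = (\<Sum>x\<in>S. pd v (F x))"
  by (induction S rule: infinite_finite_induct) (simp_all add: pd_add)

lemma pd_Const_mult: "pd v (Const c * f) = Const c * pd v f"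
  by (rule poly_mapping_eqI) (simp only: lookup_pd lookup_Const_mult, simp)

lemma pd_commute: "pd u (pd v f) = pd v (pd u f)"
proof (cases "u = v")
  case False
  then show ?thesis
    by (intro poly_mapping_eqI) (simp add: lookup_pd lookup_add lookup_single ac_simps)
qed simp

lemma lookup_Var_mult_0:
  assumes "Poly_Mapping.lookup \<alpha> v = 0"
  shows "Poly_Mapping.lookup (Var v * f) \<alpha> = 0"
proof (rule ccontr)
  assume "\<not> ?thesis"
  then have "\<alpha> \<in> Poly_Mapping.keys (Var v * f)" by (simp add: in_keys_iff)
  with keys_Var_mult[of v f] assms show False by (auto simp: lookup_add)
qed

lemma pd_Var_mult: "pd v (Var u * f) = (if u = v then f else 0) + Var u * pd v f"
proof (rule poly_mapping_eqI)
  fix \<alpha> :: "var \<Rightarrow>\<^sub>0 nat"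
  let ?e = "\<lambda>v. Poly_Mapping.single v (1::nat)"
  show "Poly_Mapping.lookup (pd v (Var u * f)) \<alpha>
      = Poly_Mapping.lookup ((if u = v then f else 0) + Var u * pd v f) \<alpha>"
  proof (cases "Poly_Mapping.lookup \<alpha> u = 0")
    case True
    show ?thesis
    proof (cases "u = v")
      case True': True
      show ?thesis
        using True lookup_Var_mult_0[OF True] unfolding True'
        by (simp only: lookup_pd lookup_Var_mult_add lookup_add) simp
    next
      case False
      have "Poly_Mapping.lookup (\<alpha> + ?e v) u = 0"
        using True False by (simp add: lookup_add lookup_single)
      from lookup_Var_mult_0[OF this] lookup_Var_mult_0[OF True] False show ?thesis
        by (simp add: lookup_pd lookup_add)
    qed
  next
    case False
    then have "u \<in> Poly_Mapping.keys \<alpha>" by (simp add: in_keys_iff)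
    from exponent_minus_single[OF this] obtain \<beta> where \<beta>: "\<alpha> = \<beta> + ?e u" by metis
    have sw: "\<beta> + ?e u + ?e v = \<beta> + ?e v + ?e u" by (simp add: ac_simps)
    have R: "Poly_Mapping.lookup (Var u * pd v f) \<alpha> = Poly_Mapping.lookup (pd v f) \<beta>"
      unfolding \<beta> by (rule lookup_Var_mult_add)
    have Lh: "Poly_Mapping.lookup (Var u * f) (\<alpha> + ?e v) = Poly_Mapping.lookup f (\<beta> + ?e v)"
      unfolding \<beta> sw by (rule lookup_Var_mult_add)
    show ?thesis
      unfolding lookup_add R unfolding lookup_pd Lh
      by (simp add: \<beta> lookup_add lookup_single when_def algebra_simps)
  qed
qed

lemma pd_Var: "pd v (Var u) = (if u = v then 1 else 0)"
  using pd_Var_mult[of v u 1] by simp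

lemma pd_mult: "pd v (f * g) = pd v f * g + f * pd v g"
proof (induction f rule: cpoly_induct)
  case (Const c)
  show ?case by (simp add: pd_Const_mult pd_Const)
next
  case (add f1 f2)
  then show ?case by (simp add: pd_add algebra_simps)
next
  case (Var u f)
  then show ?case by (simp add: mult.assoc pd_Var_mult) (simp add: algebra_simps)
qed

lemma pd_subst:
  assumes "f \<in> poly_ring U" "finite U"
  shows "pd v (subst \<sigma> f) = (\<Sum>u\<in>U. pd v (\<sigma> u) * subst \<sigma> (pd u f))"
  using assms(1) unfolding subst_eq_gev
proof (induction rule: poly_ring_induct)
  case (Const c)
  show ?case by (simp add: pd_Const)
next
  case (add f g)
  then show ?case by (simp add: Const.gev_add pd_add distrib_left sum.distrib)
next
  case (Var w f)
  have "(\<Sum>u\<in>U. pd v (\<sigma> u) * gev Const \<sigma> (pd u (Var w * f)))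
      = (\<Sum>u\<in>U. (if u = w then pd v (\<sigma> u) * gev Const \<sigma> f else 0)
          + \<sigma> w * (pd v (\<sigma> u) * gev Const \<sigma> (pd u f)))"
    by (intro sum.cong) (auto simp: pd_Var_mult Const.gev_add Const.gev_Var_mult distrib_left mult.left_commute)
  also have "\<dots> = pd v (\<sigma> w) * gev Const \<sigma> f + \<sigma> w * pd v (gev Const \<sigma> f)"
    using Var assms(2) by (simp add: sum.distrib sum_distrib_left)
  finally show ?case by (simp add: Const.gev_Var_mult pd_mult)
qed

text \<open>Chain rule along a curve of points. It yields the infinitesimal form of covariance and,
  for a curve parallel to one axis, the derivatives of a polynomial function.\<close>

lemma DERIV_peval:
  assumes "f \<in> poly_ring U" "finite U"
    and \<rho>: "\<And>v. v \<in> U \<Longrightarrow> ((\<lambda>t. \<rho> t v) has_field_derivative \<rho>' v) (at t0)"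
  shows "((\<lambda>t. peval (\<rho> t) f) has_field_derivative (\<Sum>v\<in>U. \<rho>' v * peval (\<rho> t0) (pd v f))) (at t0)"
  using assms(1)
proof (induction rule: poly_ring_induct)
  case (Const c)
  show ?case by (simp add: pd_Const)
next
  case (add f g)
  from DERIV_add[OF add.IH] show ?case
    by (simp add: peval.gev_add pd_add distrib_left sum.distrib)
next
  case (Var w f)
  have e: "(\<Sum>u\<in>U. \<rho>' u * peval (\<rho> t0) (pd u (Var w * f)))
      = (\<Sum>u\<in>U. (if u = w then \<rho>' u * peval (\<rho> t0) f else 0)
          + \<rho> t0 w * (\<rho>' u * peval (\<rho> t0) (pd u f)))"
    by (intro sum.cong) (auto simp: pd_Var_mult peval.gev_add peval.gev_Var_mult distrib_left)
  show ?case
    using DERIV_mult[OF \<rho>[OF Var.hyps(1)] Var.IH] Var.hyps assms(2)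
    unfolding e peval.gev_Var_mult
    by (simp add: sum.distrib sum_distrib_left mult.commute mult.left_commute)
qed

lemma finite_vars_of:
  fixes f :: cpoly
  obtains U where "finite U" "f \<in> poly_ring U"
proof
  show "finite (\<Union>\<alpha>\<in>Poly_Mapping.keys f. Poly_Mapping.keys \<alpha>)" by simp
  show "f \<in> poly_ring (\<Union>\<alpha>\<in>Poly_Mapping.keys f. Poly_Mapping.keys \<alpha>)"
    by (auto simp: poly_ring_def)
qed

text \<open>A polynomial function that vanishes identically has vanishing derivatives, and
  the coefficients are read off from the derivatives at 0.\<close>

lemma peval_pd_eq_0:
  assumes "\<And>\<rho>. peval \<rho> f = 0"
  shows "peval \<rho> (pd v f) = 0"
proof -
  obtain U where U: "finite U" "f \<in> poly_ring U" by (rule finite_vars_of)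
  let ?U = "insert v U"
  have fU: "f \<in> poly_ring ?U" using U by (auto simp: poly_ring_def)
  have "((\<lambda>t. peval (\<rho>(v := \<rho> v + t)) f) has_field_derivative
      (\<Sum>u\<in>?U. (if u = v then 1 else 0) * peval (\<rho>(v := \<rho> v + 0)) (pd u f))) (at 0)"
    using U by (intro DERIV_peval[OF fU]) (auto intro!: derivative_eq_intros)
  moreover have "(\<Sum>u\<in>?U. (if u = v then 1 else 0) * peval (\<rho>(v := \<rho> v + 0)) (pd u f))
      = (\<Sum>u\<in>?U. if u = v then peval \<rho> (pd u f) else 0)"
    by (intro sum.cong) auto
  ultimately have "((\<lambda>t. 0) has_field_derivative peval \<rho> (pd v f)) (at (0::complex))"
    using U by (simp add: assms)
  from DERIV_unique[OF this DERIV_const] show ?thesis .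
qed

lemma peval_lookup_0: "peval (\<lambda>_. 0) f = Poly_Mapping.lookup f 0"
proof (induction f rule: cpoly_induct)
  case (Const c)
  have "Poly_Mapping.lookup (Const c) 0 = c" by (simp add: Const_def)
  then show ?case by simp
next
  case (add f g)
  then show ?case by (simp add: peval.gev_add lookup_add)
next
  case (Var v f)
  then show ?case by (simp add: peval.gev_Var_mult lookup_Var_mult_0)
qed

lemma peval_eq_0_imp:
  assumes "\<And>\<rho>. peval \<rho> f = 0"
  shows "f = 0"
proof (rule poly_mapping_eqI)
  fix \<alpha>
  have "(\<And>\<rho>. peval \<rho> f = 0) \<Longrightarrow> Poly_Mapping.lookup f \<alpha> = 0" for f
  proof (induction \<alpha> arbitrary: f rule: exponent_induct)
    case zero
    then show ?case using peval_lookup_0[of f] by simp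
  next
    case (add v \<beta>)
    have "Poly_Mapping.lookup (pd v f) \<beta> = 0"
      by (rule add.IH) (rule peval_pd_eq_0[OF add.prems])
    then show ?case by (simp add: lookup_pd del: of_nat_Suc)
  qed
  from this[OF assms] show "Poly_Mapping.lookup f \<alpha> = Poly_Mapping.lookup 0 \<alpha>" by simp
qed

lemma peval_inject:
  assumes "\<And>\<rho>. peval \<rho> f = peval \<rho> g"
  shows "f = g"
  using peval_eq_0_imp[of "f - g"] assms by (simp add: peval.gev_diff)

section \<open>The norm\<close>

abbreviation ip :: "cpoly \<Rightarrow> cpoly \<Rightarrow> complex" where "ip \<equiv> fock_formula"

lemma ip_add_right: "ip f (g + h) = ip f g + ip f h"
  unfolding fock_formula_herm[of f] fock_formula_add by simp

lemma ip_scale_right: "ip f (Const c * g) = cnj c * ip f g"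
  unfolding fock_formula_herm[of f] fock_formula_scale by simp

lemma ip_0_left [simp]: "ip 0 g = 0"
  by (simp add: fock_formula_def)

lemma ip_0_right [simp]: "ip f 0 = 0"
  using fock_formula_herm[of 0 f] by simp

lemma ip_sum_left: "ip (\<Sum>x\<in>S. F x) g = (\<Sum>x\<in>S. ip (F x) g)"
  by (induction S rule: infinite_finite_induct) (simp_all add: fock_formula_add)

lemma ip_sum_right: "ip f (\<Sum>x\<in>S. F x) = (\<Sum>x\<in>S. ip f (F x))"
  by (induction S rule: infinite_finite_induct) (simp_all add: ip_add_right)

lemma ip_adjoint: "ip (Var v * f) g = ip f (pd v g)" "ip (pd v f) g = ip f (Var v * g)"
  by (rule fock_formula_adjoint)
    (simp only: fock_formula_herm[of "pd v f"] fock_formula_herm[of f] fock_formula_adjoint)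

text \<open>Monomials are orthogonal with squared norm \<open>mfact\<close>, so the norm is a
  weighted Euclidean norm on coefficients, and the triangle and Cauchy-Schwarz inequalities are
  inherited from \<open>L2_set\<close>. A superset K lets two polynomials share one index
  set.\<close>

lemma fock_norm_eq_L2_set:
  assumes "finite K" "Poly_Mapping.keys f \<subseteq> K"
  shows "fock_norm f = L2_set (\<lambda>\<alpha>. cmod (Poly_Mapping.lookup f \<alpha>) * sqrt (mfact \<alpha>)) K"
proof -
  have eq: "Re (Poly_Mapping.lookup f \<alpha> * cnj (Poly_Mapping.lookup f \<alpha>) * of_real (mfact \<alpha>))
      = (cmod (Poly_Mapping.lookup f \<alpha>) * sqrt (mfact \<alpha>))\<^sup>2" for \<alpha>
    unfolding complex_norm_square[symmetric] of_real_mult[symmetric]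
    using mfact_pos[of \<alpha>] by (simp add: power_mult_distrib)
  show ?thesis
    unfolding fock_norm_def fock_inner_eq fock_formula_superset[OF assms] Re_sum eq L2_set_def ..
qed

lemma fock_norm_nonneg [simp]: "0 \<le> fock_norm f"
  by (simp add: fock_norm_eq_L2_set[OF finite_keys order_refl] L2_set_nonneg)

lemma ip_self: "ip f f = of_real ((fock_norm f)\<^sup>2)"
proof -
  have "0 \<le> Re (ip f f)"
    by (cases "f = 0") (auto intro: less_imp_le fock_formula_pos)
  then have "Re (ip f f) = (fock_norm f)\<^sup>2" by (simp add: fock_norm_def fock_inner_eq)
  moreover have "Im (ip f f) = 0" using fock_formula_herm[of f f] by (simp add: complex_eq_iff)
  ultimately show ?thesis by (simp add: complex_eq_iff)
qed

lemma fock_norm_0 [simp]: "fock_norm 0 = 0"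
  by (simp add: fock_norm_def fock_inner_eq)

lemma fock_norm_triangle: "fock_norm (f + g) \<le> fock_norm f + fock_norm g"
proof -
  let ?K = "Poly_Mapping.keys f \<union> Poly_Mapping.keys g"
  let ?n = "\<lambda>f \<alpha>. cmod (Poly_Mapping.lookup f \<alpha>) * sqrt (mfact \<alpha>)"
  have "fock_norm (f + g) = L2_set (?n (f + g)) ?K"
    by (intro fock_norm_eq_L2_set keys_add) simp
  also have "\<dots> \<le> L2_set (\<lambda>\<alpha>. ?n f \<alpha> + ?n g \<alpha>) ?K"
  proof (intro L2_set_mono)
    fix \<alpha>
    have "cmod (Poly_Mapping.lookup (f + g) \<alpha>) \<le> cmod (Poly_Mapping.lookup f \<alpha>) + cmod (Poly_Mapping.lookup g \<alpha>)"
      by (simp add: lookup_add norm_triangle_ineq)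
    then show "?n (f + g) \<alpha> \<le> ?n f \<alpha> + ?n g \<alpha>"
      unfolding distrib_right[symmetric]
      by (rule mult_right_mono) (simp add: less_imp_le[OF mfact_pos])
    show "0 \<le> ?n (f + g) \<alpha>" by (simp add: less_imp_le[OF mfact_pos])
  qed
  also have "\<dots> \<le> L2_set (?n f) ?K + L2_set (?n g) ?K" by (rule L2_set_triangle_ineq)
  also have "\<dots> = fock_norm f + fock_norm g"
    by (simp add: fock_norm_eq_L2_set[of ?K])
  finally show ?thesis .
qed

lemma fock_norm_scale: "fock_norm (Const c * f) = cmod c * fock_norm f"
proof -
  have "ip (Const c * f) (Const c * f) = of_real ((cmod c * fock_norm f)\<^sup>2)"
    by (simp only: fock_formula_scale ip_scale_right ip_self[of f] power_mult_distrib of_real_mult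
        complex_norm_square mult.assoc mult.left_commute)
  then have "(fock_norm (Const c * f))\<^sup>2 = (cmod c * fock_norm f)\<^sup>2"
    unfolding ip_self of_real_eq_iff .
  then show ?thesis by (simp add: power2_eq_iff_nonneg)
qed

lemma fock_norm_uminus: "fock_norm (- f) = fock_norm f"
  using fock_norm_scale[of "- 1" f] by (simp add: Const_uminus)

lemma ip_Cauchy_Schwarz: "cmod (ip f g) \<le> fock_norm f * fock_norm g"
proof -
  let ?K = "Poly_Mapping.keys f \<union> Poly_Mapping.keys g"
  let ?n = "\<lambda>f \<alpha>. cmod (Poly_Mapping.lookup f \<alpha>) * sqrt (mfact \<alpha>)"
  have "cmod (ip f g) \<le> (\<Sum>\<alpha>\<in>?K. \<bar>?n f \<alpha>\<bar> * \<bar>?n g \<alpha>\<bar>)"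
    unfolding fock_formula_superset[of ?K f g, simplified]
  proof (rule order_trans[OF norm_sum], intro sum_mono)
    fix \<alpha>
    have s: "sqrt (mfact \<alpha>) * sqrt (mfact \<alpha>) = mfact \<alpha>" "0 \<le> sqrt (mfact \<alpha>)"
      using less_imp_le[OF mfact_pos] by simp_all
    have "x * s * (y * s) = x * y * (s * s)" for x y s :: real by simp
    with s have "\<bar>?n f \<alpha>\<bar> * \<bar>?n g \<alpha>\<bar>
        = cmod (Poly_Mapping.lookup f \<alpha>) * cmod (Poly_Mapping.lookup g \<alpha>) * mfact \<alpha>"
      by (simp add: abs_mult)
    then show "cmod (Poly_Mapping.lookup f \<alpha> * cnj (Poly_Mapping.lookup g \<alpha>) * of_real (mfact \<alpha>))
        \<le> \<bar>?n f \<alpha>\<bar> * \<bar>?n g \<alpha>\<bar>"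
      using less_imp_le[OF mfact_pos[of \<alpha>]] by (simp only: norm_mult norm_of_real complex_mod_cnj abs_of_nonneg order_refl)
  qed
  also have "\<dots> \<le> L2_set (?n f) ?K * L2_set (?n g) ?K" by (rule L2_set_mult_ineq)
  also have "\<dots> = fock_norm f * fock_norm g"
    by (simp add: fock_norm_eq_L2_set[of ?K])
  finally show ?thesis .
qed

lemma fock_norm_eq_0_iff [simp]: "fock_norm f = 0 \<longleftrightarrow> f = 0"
proof
  assume "fock_norm f = 0"
  then have "Re (ip f f) = 0" by (simp add: ip_self)
  then show "f = 0" using fock_formula_pos[of f] by force
qed simp

subsection \<open>Hermitian operators satisfying a fixed recurrence\<close>

text \<open>For Hermitian \<open>T\<close> the sequence of norms of \<open>T\<^sup>j v\<close> is log-convex, so it cannot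
  start growing faster than a recurrence for the powers of \<open>T\<close> permits.\<close>

lemma hermitian_norm_bound:
  assumes inv: "\<And>v. v \<in> S \<Longrightarrow> T v \<in> S"
    and herm: "\<And>u v. u \<in> S \<Longrightarrow> v \<in> S \<Longrightarrow> ip (T u) v = ip u (T v)"
    and rec: "\<And>v. v \<in> S \<Longrightarrow> (T ^^ m) v = (\<Sum>i<m. Const (c i) * (T ^^ i) v)"
    and v: "v \<in> S"
  shows "fock_norm (T v) \<le> (1 + (\<Sum>i<m. cmod (c i))) * fock_norm v"
proof (rule ccontr)
  \<comment> \<open>The summand 1 makes growth by more than R strictly increasing, and leaves R - 1
    as the factor that the recurrence allows.\<close>
  define R where "R = 1 + (\<Sum>i<m. cmod (c i))"
  define a where "a j = fock_norm ((T ^^ j) v)" for j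
  have S: "(T ^^ j) v \<in> S" for j by (induction j) (simp_all add: v inv)
  have a_nonneg: "0 \<le> a j" for j by (simp add: a_def)
  have R1: "1 \<le> R" unfolding R_def by (simp add: sum_nonneg)
  have convex: "(a (Suc j))\<^sup>2 \<le> a j * a (Suc (Suc j))" for j
  proof -
    have "complex_of_real ((a (Suc j))\<^sup>2) = ip ((T ^^ j) v) ((T ^^ Suc (Suc j)) v)"
      using herm[OF S[of j] S[of "Suc j"]] unfolding a_def ip_self[symmetric] by simp
    then have "(a (Suc j))\<^sup>2 = cmod (ip ((T ^^ j) v) ((T ^^ Suc (Suc j)) v))"
      by (metis norm_of_real abs_of_nonneg zero_le_power2)
    also have "\<dots> \<le> a j * a (Suc (Suc j))"
      unfolding a_def by (rule ip_Cauchy_Schwarz)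
    finally show ?thesis .
  qed
  assume "\<not> ?thesis"
  then have a1: "R * a 0 < a 1" by (simp add: a_def R_def)
  \<comment> \<open>Log-convexity makes the ratios of successive norms non-decreasing; if the first
    one exceeds R, all of them do.\<close>
  have grow: "0 < a j \<and> R * a j < a (Suc j)" for j
  proof (induction j)
    case 0
    have "0 < a 1" using a1 a_nonneg[of 0] R1 by (smt (verit) mult_nonneg_nonneg)
    moreover have "a 0 \<noteq> 0"
    proof
      assume "a 0 = 0"
      with convex[of 0] \<open>0 < a 1\<close> show False by simp
    qed
    ultimately show ?case using a1 a_nonneg[of 0] by simp
  next
    case (Suc j)
    then have p: "0 < a (Suc j)" using R1 by (smt (verit) mult_pos_pos)
    have "a j * (R * a (Suc j)) = (R * a j) * a (Suc j)" by simp
    also have "\<dots> < (a (Suc j))\<^sup>2"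
      unfolding power2_eq_square using Suc p by (intro mult_strict_right_mono) auto
    also have "\<dots> \<le> a j * a (Suc (Suc j))" by (rule convex)
    finally have "R * a (Suc j) < a (Suc (Suc j))"
      using Suc by (simp only: mult_less_cancel_left_pos)
    with p show ?case by simp
  qed
  have inc: "a i \<le> a j" if "i \<le> j" for i j
    using that
  proof (induction j rule: dec_induct)
    case (step j)
    have "1 * a j \<le> R * a j" by (intro mult_right_mono R1 a_nonneg)
    with step.IH conjunct2[OF grow[of j]] show ?case by linarith
  qed simp
  have am: "a m \<le> (\<Sum>i<m. cmod (c i) * a i)"
  proof -
    have "fock_norm (\<Sum>i\<in>I. Const (c i) * (T ^^ i) v) \<le> (\<Sum>i\<in>I. cmod (c i) * a i)" if "finite I" for I
      using that
    proof (induction I rule: finite_induct)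
      case (insert i I)
      then show ?case
        using fock_norm_triangle[of "Const (c i) * (T ^^ i) v" "\<Sum>i\<in>I. Const (c i) * (T ^^ i) v"]
        by (simp add: fock_norm_scale a_def)
    qed simp
    from this[of "{..<m}"] show ?thesis by (simp add: a_def rec[OF v])
  qed
  show False
  proof (cases m)
    case 0
    with am grow[of 0] show False by simp
  next
    case (Suc l)
    \<comment> \<open>The recurrence bounds a m by R - 1 times the largest earlier norm, which is a
      l by monotonicity, whereas \<open>grow\<close> forces a m to exceed R times a l.\<close>
    have "a m \<le> (\<Sum>i<m. cmod (c i) * a l)"
      using am Suc by (intro order_trans[OF am] sum_mono mult_left_mono inc) auto
    also have "\<dots> = (R - 1) * a l" by (simp add: R_def sum_distrib_right)
    also have "\<dots> \<le> R * a l" by (intro mult_right_mono a_nonneg) simp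
    also have "\<dots> < a m" using grow[of l] Suc by simp
    finally show False by simp
  qed
qed

section \<open>Linear recurrences in finite-dimensional spaces of coefficients\<close>

lemma vector_space_poly_mapping:
  "vector_space (\<lambda>(c::complex) (f::'k \<Rightarrow>\<^sub>0 complex). Poly_Mapping.map ((*) c) f)"
proof
  fix a b :: complex and x y :: "'k \<Rightarrow>\<^sub>0 complex"
  have l: "Poly_Mapping.lookup (Poly_Mapping.map ((*) c) f) k = c * Poly_Mapping.lookup f k"
    for c and f :: "'k \<Rightarrow>\<^sub>0 complex" and k
    by (simp add: Poly_Mapping.map.rep_eq when_def)
  show "Poly_Mapping.map ((*) a) (x + y) = Poly_Mapping.map ((*) a) x + Poly_Mapping.map ((*) a) y"
    "Poly_Mapping.map ((*) (a + b)) x = Poly_Mapping.map ((*) a) x + Poly_Mapping.map ((*) b) x"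
    "Poly_Mapping.map ((*) a) (Poly_Mapping.map ((*) b) x) = Poly_Mapping.map ((*) (a * b)) x"
    "Poly_Mapping.map ((*) 1) x = x"
    by (rule poly_mapping_eqI, simp add: l lookup_add algebra_simps)+
qed

lemma lookup_map_times:
  "Poly_Mapping.lookup (Poly_Mapping.map ((*) c) f) k = (c::complex) * Poly_Mapping.lookup f k"
  by (simp add: Poly_Mapping.map.rep_eq when_def)

text \<open>More vectors than the dimension are dependent, so some term lies in the span of the
  earlier ones. The key type is arbitrary because the lemma is applied to matrix entries indexed by
  pairs.\<close>

lemma sequence_recurrence:
  fixes F :: "nat \<Rightarrow> ('k \<Rightarrow>\<^sub>0 complex)"
  assumes K: "finite K" "\<And>j. Poly_Mapping.keys (F j) \<subseteq> K"
  obtains m c where "\<And>k. Poly_Mapping.lookup (F m) k = (\<Sum>i<m. c i * Poly_Mapping.lookup (F i) k)"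
proof -
  interpret V: vector_space "\<lambda>(c::complex) (f::'k \<Rightarrow>\<^sub>0 complex). Poly_Mapping.map ((*) c) f"
    by (rule vector_space_poly_mapping)
  define E where "E = (\<lambda>k::'k. Poly_Mapping.single k (1::complex)) ` K"
  have FE: "F j \<in> V.span E" for j
  proof -
    have "F j = (\<Sum>k\<in>K. Poly_Mapping.map ((*) (Poly_Mapping.lookup (F j) k)) (Poly_Mapping.single k 1))"
    proof (rule poly_mapping_eqI)
      fix k
      have "Poly_Mapping.lookup (\<Sum>k\<in>K. Poly_Mapping.map ((*) (Poly_Mapping.lookup (F j) k)) (Poly_Mapping.single k 1)) k
          = (\<Sum>l\<in>K. if l = k then Poly_Mapping.lookup (F j) l else 0)"
        unfolding lookup_sum lookup_map_times lookup_single
        by (intro sum.cong) (auto simp: when_def)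
      then show "Poly_Mapping.lookup (F j) k
          = Poly_Mapping.lookup (\<Sum>k\<in>K. Poly_Mapping.map ((*) (Poly_Mapping.lookup (F j) k)) (Poly_Mapping.single k 1)) k"
        using K(1) K(2)[of j] by (auto simp: in_keys_iff)
    qed
    also have "\<dots> \<in> V.span E"
      unfolding E_def by (intro V.span_sum V.span_scale V.span_base imageI)
    finally show ?thesis .
  qed
  have "\<exists>m. F m \<in> V.span (F ` {..<m})"
  proof (rule ccontr)
    assume no: "\<nexists>m. F m \<in> V.span (F ` {..<m})"
    have ind: "V.independent (F ` {..<m}) \<and> card (F ` {..<m}) = m" for m
    proof (induction m)
      case (Suc m)
      have n: "F m \<notin> V.span (F ` {..<m})" using no by blast
      then have "F m \<notin> F ` {..<m}" using V.span_base[of "F m" "F ` {..<m}"] by metis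
      moreover note n
      ultimately show ?case
        using Suc V.independent_insert[of "F m" "F ` {..<m}"] by (auto simp: lessThan_Suc)
    qed (simp add: V.independent_empty)
    have "finite E" unfolding E_def using K(1) by simp
    moreover have "F ` {..<Suc (card K)} \<subseteq> V.span E" using FE by blast
    ultimately have "card (F ` {..<Suc (card K)}) \<le> card E"
      using V.independent_span_bound[OF _ conjunct1[OF ind[of "Suc (card K)"]], of E] by metis
    also have "\<dots> \<le> card K" unfolding E_def by (rule card_image_le[OF K(1)])
    finally show False using ind[of "Suc (card K)"] by simp
  qed
  then obtain m where m: "F m \<in> V.span (F ` {..<m})" ..
  let ?W = "{f. \<exists>c. \<forall>k. Poly_Mapping.lookup f k = (\<Sum>i<m. c i * Poly_Mapping.lookup (F i) k)}"
  have "V.subspace ?W"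
  proof (rule V.subspaceI)
    show "0 \<in> ?W" by (auto intro!: exI[of _ "\<lambda>_. 0"])
  next
    fix x y assume "x \<in> ?W" "y \<in> ?W"
    then obtain c d where "\<And>k. Poly_Mapping.lookup x k = (\<Sum>i<m. c i * Poly_Mapping.lookup (F i) k)"
      "\<And>k. Poly_Mapping.lookup y k = (\<Sum>i<m. d i * Poly_Mapping.lookup (F i) k)" by auto
    then show "x + y \<in> ?W"
      by (auto intro!: exI[of _ "\<lambda>i. c i + d i"] simp: lookup_add sum.distrib distrib_right)
  next
    fix a x assume "x \<in> ?W"
    then obtain c where "\<And>k. Poly_Mapping.lookup x k = (\<Sum>i<m. c i * Poly_Mapping.lookup (F i) k)" by auto
    then show "Poly_Mapping.map ((*) a) x \<in> ?W"
      by (auto intro!: exI[of _ "\<lambda>i. a * c i"] simp: lookup_map_times sum_distrib_left mult.assoc)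
  qed
  moreover have "F ` {..<m} \<subseteq> ?W"
  proof clarify
    fix j assume "j < m"
    have "(\<Sum>i<m. (if i = j then 1 else 0) * Poly_Mapping.lookup (F i) k)
        = (\<Sum>i<m. if i = j then Poly_Mapping.lookup (F i) k else 0)" for k
      by (intro sum.cong) auto
    with \<open>j < m\<close> show "\<exists>c. \<forall>k. Poly_Mapping.lookup (F j) k = (\<Sum>i<m. c i * Poly_Mapping.lookup (F i) k)"
      by (intro exI[of _ "\<lambda>i. if i = j then 1 else 0"]) simp
  qed
  ultimately have "V.span (F ` {..<m}) \<subseteq> ?W"
    by (rule V.span_minimal[rotated])
  with m have "F m \<in> ?W" by (rule subsetD[rotated])
  then obtain c where "\<forall>k. Poly_Mapping.lookup (F m) k = (\<Sum>i<m. c i * Poly_Mapping.lookup (F i) k)"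
    by (elim CollectE exE)
  with that show thesis by metis
qed

interpretation cpoly: vector_space "\<lambda>c (f::cpoly). Const c * f"
  by unfold_locales (simp_all add: Const_add Const_mult algebra_simps)

text \<open>The powers of T on S live in a finite-dimensional space of matrices, which gives a monic
  polynomial annihilating T on S.\<close>

lemma operator_recurrence:
  assumes sub: "cpoly.subspace S" and fin: "finite K" "\<And>f. f \<in> S \<Longrightarrow> Poly_Mapping.keys f \<subseteq> K"
    and inv: "\<And>v. v \<in> S \<Longrightarrow> T v \<in> S"
    and add: "\<And>u v. T (u + v) = T u + T v" and scale: "\<And>c v. T (Const c * v) = Const c * T v"
  obtains m c where "\<And>v. v \<in> S \<Longrightarrow> (T ^^ m) v = (\<Sum>i<m. Const (c i) * (T ^^ i) v)"
proof -
  obtain B where B: "B \<subseteq> S" "cpoly.independent B" "S \<subseteq> cpoly.span B"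
    using cpoly.maximal_independent_subset[of S] by blast
  have "S \<subseteq> cpoly.span ((\<lambda>\<alpha>. Poly_Mapping.single \<alpha> 1) ` K)"
  proof
    fix f assume f: "f \<in> S"
    have "f = (\<Sum>\<alpha>\<in>Poly_Mapping.keys f. Const (Poly_Mapping.lookup f \<alpha>) * Poly_Mapping.single \<alpha> 1)"
      by (subst poly_sum_monomials) (simp add: Const_def mult_single)
    also have "\<dots> \<in> cpoly.span ((\<lambda>\<alpha>. Poly_Mapping.single \<alpha> 1) ` K)"
      using fin(2)[OF f] by (intro cpoly.span_sum cpoly.span_scale cpoly.span_base) auto
    finally show "f \<in> \<dots>" .
  qed
  then have finB: "finite B"
    using cpoly.independent_span_bound[OF _ B(2)] B(1) fin(1) by blast
  have powS: "v \<in> S \<Longrightarrow> (T ^^ j) v \<in> S" for j v by (induction j) (simp_all add: inv)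
  \<comment> \<open>F j collects the coefficients of T^j on all basis vectors at once, so that a
    single recurrence holds for all of them.\<close>
  define F :: "nat \<Rightarrow> (cpoly \<times> (var \<Rightarrow>\<^sub>0 nat)) \<Rightarrow>\<^sub>0 complex" where
    "F j = (\<Sum>(b, \<alpha>)\<in>B \<times> K. Poly_Mapping.single (b, \<alpha>) (Poly_Mapping.lookup ((T ^^ j) b) \<alpha>))" for j
  have lF: "Poly_Mapping.lookup (F j) (b, \<alpha>)
      = (if b \<in> B \<and> \<alpha> \<in> K then Poly_Mapping.lookup ((T ^^ j) b) \<alpha> else 0)" for j b \<alpha>
  proof -
    have "Poly_Mapping.lookup (F j) (b, \<alpha>)
      = (\<Sum>x\<in>B \<times> K. if x = (b, \<alpha>) then Poly_Mapping.lookup ((T ^^ j) (fst x)) (snd x) else 0)"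
      unfolding F_def lookup_sum
      by (intro sum.cong) (auto simp: lookup_single when_def split: if_splits)
    then show ?thesis using finB fin(1) by simp
  qed
  have "Poly_Mapping.keys (F j) \<subseteq> B \<times> K" for j
    by (auto simp: in_keys_iff lF split: if_splits)
  moreover have "finite (B \<times> K)" using finB fin(1) by simp
  ultimately obtain m c where
    mc: "\<And>k. Poly_Mapping.lookup (F m) k = (\<Sum>i<m. c i * Poly_Mapping.lookup (F i) k)"
    using sequence_recurrence[of "B \<times> K" F] by metis
  have recB: "(T ^^ m) b = (\<Sum>i<m. Const (c i) * (T ^^ i) b)" if b: "b \<in> B" for b
  proof (rule poly_mapping_eqI)
    fix \<alpha>
    have bS: "b \<in> S" using b B by blast
    show "Poly_Mapping.lookup ((T ^^ m) b) \<alpha> = Poly_Mapping.lookup (\<Sum>i<m. Const (c i) * (T ^^ i) b) \<alpha>"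
    proof (cases "\<alpha> \<in> K")
      case True
      then show ?thesis using mc[of "(b, \<alpha>)"] b by (simp add: lF lookup_sum lookup_Const_mult)
    next
      case False
      then have "Poly_Mapping.lookup ((T ^^ j) b) \<alpha> = 0" for j
        using fin(2)[OF powS[OF bS]] by (meson in_keys_iff subsetD)
      then show ?thesis by (simp add: lookup_sum lookup_Const_mult)
    qed
  qed
  have add': "(T ^^ j) (u + v) = (T ^^ j) u + (T ^^ j) v" for j u v by (induction j) (simp_all add: add)
  have scale': "(T ^^ j) (Const a * v) = Const a * (T ^^ j) v" for j a v
    by (induction j) (simp_all add: scale)
  have "cpoly.subspace {v. (T ^^ m) v = (\<Sum>i<m. Const (c i) * (T ^^ i) v)}"
    using scale'[of _ 0 0]
    by (intro cpoly.subspaceI)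
      (auto simp: add' scale' distrib_left sum.distrib sum_distrib_left mult.left_commute)
  moreover have "B \<subseteq> {v. (T ^^ m) v = (\<Sum>i<m. Const (c i) * (T ^^ i) v)}" using recB by blast
  ultimately have "cpoly.span B \<subseteq> {v. (T ^^ m) v = (\<Sum>i<m. Const (c i) * (T ^^ i) v)}"
    by (rule cpoly.span_minimal[rotated])
  then have "\<And>v. v \<in> S \<Longrightarrow> (T ^^ m) v = (\<Sum>i<m. Const (c i) * (T ^^ i) v)"
    using B(3) by auto
  then show thesis by (rule that)
qed

section \<open>Operators\<close>

abbreviation vX :: "nat \<Rightarrow> nat \<Rightarrow> cpoly" where "vX i j \<equiv> Var (XVar i j)"
abbreviation vA :: "nat \<Rightarrow> nat \<Rightarrow> cpoly" where "vA a i \<equiv> Var (AVar a i)"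
abbreviation dY :: "nat \<Rightarrow> nat \<Rightarrow> cpoly \<Rightarrow> cpoly" where "dY i j \<equiv> pd (XVar j i)"
abbreviation dB :: "nat \<Rightarrow> nat \<Rightarrow> cpoly \<Rightarrow> cpoly" where "dB i a \<equiv> pd (AVar a i)"

text \<open>In the paper's notation these are $A^aB_b$, $A^aYB_b$, $A^aXB_b$, $A^aXYB_b$ and
  $A^aYXB_b$, with all operators composed in the written order.\<close>

definition W1 :: "nat \<Rightarrow> nat \<Rightarrow> nat \<Rightarrow> cpoly \<Rightarrow> cpoly" where
  "W1 N a b f = (\<Sum>i<N. vA a i * dB i b f)"

definition WY :: "nat \<Rightarrow> nat \<Rightarrow> nat \<Rightarrow> cpoly \<Rightarrow> cpoly" where
  "WY N a b f = (\<Sum>i<N. vA a i * (\<Sum>j<N. dY i j (dB j b f)))"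

definition WX :: "nat \<Rightarrow> nat \<Rightarrow> nat \<Rightarrow> cpoly \<Rightarrow> cpoly" where
  "WX N a b f = (\<Sum>i<N. vA a i * (\<Sum>j<N. vX i j * dB j b f))"

definition WXY :: "nat \<Rightarrow> nat \<Rightarrow> nat \<Rightarrow> cpoly \<Rightarrow> cpoly" where
  "WXY N a b f = (\<Sum>i<N. vA a i * (\<Sum>j<N. vX i j * (\<Sum>l<N. dY j l (dB l b f))))"

definition WYX :: "nat \<Rightarrow> nat \<Rightarrow> nat \<Rightarrow> cpoly \<Rightarrow> cpoly" where
  "WYX N a b f = (\<Sum>i<N. vA a i * (\<Sum>j<N. dY i j (\<Sum>l<N. vX j l * dB l b f)))"

text \<open>The moment map: the $(p,q)$ component of the action of the Lie algebra of $GL_N$,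
  shifted so that it annihilates covariants of weight $\det^{-k}$.\<close>

definition moment :: "nat \<Rightarrow> nat \<Rightarrow> nat \<Rightarrow> nat \<Rightarrow> nat \<Rightarrow> cpoly \<Rightarrow> cpoly" where
  "moment n k N q p f = (\<Sum>j<N. vX q j * dY j p f) - (\<Sum>i<N. vX i p * dY q i f)
     - (\<Sum>c<n. vA c p * dB q c f) + Const (if q = p then of_nat k else 0) * f"

lemma dB_sum_vA:
  assumes "j < N"
  shows "dB j b (\<Sum>p<N. vA c p * F p) = (if b = c then F j else 0) + (\<Sum>p<N. vA c p * dB j b (F p))"
proof -
  have "dB j b (\<Sum>p<N. vA c p * F p)
      = (\<Sum>p<N. (if p = j then (if b = c then F p else 0) else 0) + vA c p * dB j b (F p))"
    unfolding pd_sum by (intro sum.cong) (auto simp: pd_Var_mult)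
  then show ?thesis using assms by (simp add: sum.distrib)
qed

lemma dY_sum_vX_row:
  assumes "i < N"
  shows "dY i j (\<Sum>q<N. vX p q * F q) = (if p = j then F i else 0) + (\<Sum>q<N. vX p q * dY i j (F q))"
proof -
  have "dY i j (\<Sum>q<N. vX p q * F q)
      = (\<Sum>q<N. (if q = i then (if p = j then F q else 0) else 0) + vX p q * dY i j (F q))"
    unfolding pd_sum by (intro sum.cong) (auto simp: pd_Var_mult)
  then show ?thesis using assms by (simp add: sum.distrib)
qed

lemma dB_vX: "dB i a (vX p q * f) = vX p q * dB i a f"
  by (simp add: pd_Var_mult)

lemma dY_vA: "dY i j (vA c p * f) = vA c p * dY i j f"
  by (simp add: pd_Var_mult)

lemma sum_commute_nested:
  fixes F :: "'a \<Rightarrow> 'b \<Rightarrow> 'c::comm_ring_1"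
  shows "(\<Sum>i\<in>I. u i * (\<Sum>p\<in>J. w p * F i p)) = (\<Sum>p\<in>J. w p * (\<Sum>i\<in>I. u i * F i p))"
  by (simp add: sum_distrib_left mult.left_commute, rule sum.swap)

lemma sum_distrib_swap:
  fixes F :: "'a \<Rightarrow> 'b \<Rightarrow> 'c::comm_ring_1"
  shows "(\<Sum>q\<in>J. u q * (\<Sum>j\<in>I. F j q)) = (\<Sum>j\<in>I. \<Sum>q\<in>J. u q * F j q)"
  by (simp only: sum_distrib_left) (rule sum.swap)

lemma W1_W1:
  "W1 N a d (W1 N c b f) = (\<Sum>i<N. vA a i * (\<Sum>j<N. vA c j * dB i d (dB j b f)))
     + (if c = d then W1 N a b f else 0)"
proof -
  have "W1 N a d (W1 N c b f)
      = (\<Sum>i<N. vA a i * ((if d = c then dB i b f else 0) + (\<Sum>j<N. vA c j * dB i d (dB j b f))))"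
    unfolding W1_def by (intro sum.cong refl arg_cong2[of _ _ _ _ "(*)"] dB_sum_vA) simp
  then show ?thesis
    by (auto simp: W1_def distrib_left sum.distrib)
qed

text \<open>Normal ordering: the uncontracted term \<open>M\<close> is the same in both orders.
  Contracting B_b with A^c leaves A^aYXB_d, contracting B_d with A^a leaves A^cXYB_b, and
  contracting Y with X leaves two A followed by two B, which \<open>W1_W1\<close> rewrites as a
  product minus its own contraction.\<close>

lemma WY_WX_commutator:
  "WY N a b (WX N c d f) - WX N c d (WY N a b f)
     = W1 N a d (W1 N c b f) - (if c = d then W1 N a b f else 0)
       + (if b = c then WYX N a d f else 0) - (if a = d then WXY N c b f else 0)"
proof -
  define M where "M = (\<Sum>i<N. vA a i * (\<Sum>j<N. \<Sum>p<N. vA c p * (\<Sum>q<N. vX p q * dY i j (dB j b (dB q d f)))))"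
  have 1: "WY N a b (WX N c d f) = (if b = c then WYX N a d f else 0)
      + (\<Sum>i<N. vA a i * (\<Sum>j<N. vA c j * dB j b (dB i d f))) + M"
  proof -
    have s: "(\<Sum>j<N. dY i j (dB j b (WX N c d f))) =
        (if b = c then (\<Sum>j<N. dY i j (\<Sum>l<N. vX j l * dB l d f)) else 0)
        + (\<Sum>j<N. vA c j * dB j b (dB i d f))
        + (\<Sum>j<N. \<Sum>p<N. vA c p * (\<Sum>q<N. vX p q * dY i j (dB j b (dB q d f))))" if i: "i < N" for i
    proof -
      have "dY i j (dB j b (WX N c d f)) = (if b = c then dY i j (\<Sum>l<N. vX j l * dB l d f) else 0)
         + vA c j * dB j b (dB i d f)
         + (\<Sum>p<N. vA c p * (\<Sum>q<N. vX p q * dY i j (dB j b (dB q d f))))" if j: "j < N" for j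
      proof -
        have "dY i j (dB j b (WX N c d f)) = (if b = c then dY i j (\<Sum>l<N. vX j l * dB l d f) else 0)
            + (\<Sum>p<N. vA c p * dY i j (\<Sum>q<N. vX p q * dB j b (dB q d f)))"
          unfolding WX_def by (subst dB_sum_vA[OF j]) (simp add: pd_add pd_sum dB_vX dY_vA)
        also have "(\<Sum>p<N. vA c p * dY i j (\<Sum>q<N. vX p q * dB j b (dB q d f)))
            = (\<Sum>p<N. (if p = j then vA c p * dB j b (dB i d f) else 0)
                + vA c p * (\<Sum>q<N. vX p q * dY i j (dB j b (dB q d f))))"
          by (intro sum.cong refl, subst dY_sum_vX_row[OF i]) (simp add: distrib_left)
        also have "\<dots> = vA c j * dB j b (dB i d f)
            + (\<Sum>p<N. vA c p * (\<Sum>q<N. vX p q * dY i j (dB j b (dB q d f))))"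
          using j by (simp add: sum.distrib)
        finally show ?thesis by (simp add: add.assoc)
      qed
      then have "(\<Sum>j<N. dY i j (dB j b (WX N c d f))) =
          (\<Sum>j<N. (if b = c then dY i j (\<Sum>l<N. vX j l * dB l d f) else 0)
         + vA c j * dB j b (dB i d f)
         + (\<Sum>p<N. vA c p * (\<Sum>q<N. vX p q * dY i j (dB j b (dB q d f)))))"
        by (intro sum.cong) auto
      then show ?thesis by (simp add: sum.distrib)
    qed
    have "WY N a b (WX N c d f) = (\<Sum>i<N. vA a i *
       ((if b = c then (\<Sum>j<N. dY i j (\<Sum>l<N. vX j l * dB l d f)) else 0)
        + (\<Sum>j<N. vA c j * dB j b (dB i d f))
        + (\<Sum>j<N. \<Sum>p<N. vA c p * (\<Sum>q<N. vX p q * dY i j (dB j b (dB q d f))))))"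
      unfolding WY_def by (intro sum.cong refl arg_cong2[of _ _ _ _ "(*)"] s) simp
    then show ?thesis by (simp add: WYX_def M_def distrib_left sum.distrib)
  qed
  have 2: "WX N c d (WY N a b f) = (if a = d then WXY N c b f else 0) + M"
  proof -
    have "(\<Sum>q<N. vX p q * dB q d (WY N a b f))
        = (if d = a then (\<Sum>q<N. vX p q * (\<Sum>j<N. dY q j (dB j b f))) else 0)
          + (\<Sum>i<N. vA a i * (\<Sum>j<N. \<Sum>q<N. vX p q * dY i j (dB j b (dB q d f))))" for p
    proof -
      have "(\<Sum>q<N. vX p q * dB q d (WY N a b f)) = (\<Sum>q<N. vX p q *
        ((if d = a then (\<Sum>j<N. dY q j (dB j b f)) else 0)
         + (\<Sum>i<N. vA a i * (\<Sum>j<N. dY i j (dB j b (dB q d f))))))"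
        unfolding WY_def
        by (intro sum.cong refl arg_cong2[of _ _ _ _ "(*)"], subst dB_sum_vA)
          (simp_all add: pd_sum pd_commute[of "AVar d _"])
      also have "\<dots> = (if d = a then (\<Sum>q<N. vX p q * (\<Sum>j<N. dY q j (dB j b f))) else 0)
          + (\<Sum>q<N. vX p q * (\<Sum>i<N. vA a i * (\<Sum>j<N. dY i j (dB j b (dB q d f)))))"
        by (simp add: distrib_left sum.distrib)
      also have "(\<Sum>q<N. vX p q * (\<Sum>i<N. vA a i * (\<Sum>j<N. dY i j (dB j b (dB q d f)))))
          = (\<Sum>i<N. vA a i * (\<Sum>q<N. vX p q * (\<Sum>j<N. dY i j (dB j b (dB q d f)))))"
        by (rule sum_commute_nested)
      also have "\<dots> = (\<Sum>i<N. vA a i * (\<Sum>j<N. \<Sum>q<N. vX p q * dY i j (dB j b (dB q d f))))"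
        by (simp only: sum_distrib_swap)
      finally show ?thesis .
    qed
    then have "WX N c d (WY N a b f) = (\<Sum>p<N. vA c p *
        ((if d = a then (\<Sum>q<N. vX p q * (\<Sum>j<N. dY q j (dB j b f))) else 0)
          + (\<Sum>i<N. vA a i * (\<Sum>j<N. \<Sum>q<N. vX p q * dY i j (dB j b (dB q d f))))))"
      unfolding WX_def by simp
    also have "\<dots> = (if a = d then WXY N c b f else 0) +
        (\<Sum>p<N. vA c p * (\<Sum>i<N. vA a i * (\<Sum>j<N. \<Sum>q<N. vX p q * dY i j (dB j b (dB q d f)))))"
      by (auto simp: distrib_left sum.distrib WXY_def)
    also have "(\<Sum>p<N. vA c p * (\<Sum>i<N. vA a i * (\<Sum>j<N. \<Sum>q<N. vX p q * dY i j (dB j b (dB q d f)))))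
        = (\<Sum>i<N. vA a i * (\<Sum>p<N. vA c p * (\<Sum>j<N. \<Sum>q<N. vX p q * dY i j (dB j b (dB q d f)))))"
      by (rule sum_commute_nested)
    also have "\<dots> = M"
      unfolding M_def by (simp only: sum_distrib_swap)
    finally show ?thesis .
  qed
  show ?thesis unfolding 1 2 W1_W1 pd_commute[of "AVar b _"] by (auto simp: pd_commute)
qed

text \<open>The moment relation is differentiated by B^p_b, multiplied by A^a_q and summed over p
  and q. Moving B past A there, and Y past X in A^aYXB_b, both produce N times \<open>W1\<close>;
  these cancel, so the coefficient k + n that remains does not depend on N.\<close>

lemma WXY_minus_WYX:
  assumes f: "\<And>q p. q < N \<Longrightarrow> p < N \<Longrightarrow> moment n k N q p f = 0" and "b < n"
  shows "WXY N a b f - WYX N a b f = (\<Sum>c<n. W1 N a c (W1 N c b f)) - of_nat (k + n) * W1 N a b f"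
proof -
  \<comment> \<open>\<open>Z\<close> is the normally ordered form of A^aYXB_b, and \<open>Q\<close>
    that of the sum over c of A^aB_cA^cB_b.\<close>
  define Z where "Z = (\<Sum>q<N. vA a q * (\<Sum>p<N. \<Sum>i<N. vX i p * dY q i (dB p b f)))"
  define Q where "Q = (\<Sum>c<n. \<Sum>q<N. vA a q * (\<Sum>p<N. vA c p * dB q c (dB p b f)))"
  have dm: "dB p b (moment n k N q p f) = (\<Sum>j<N. vX q j * dY j p (dB p b f))
      - (\<Sum>i<N. vX i p * dY q i (dB p b f))
      - (dB q b f + (\<Sum>c<n. vA c p * dB q c (dB p b f)))
      + (if q = p then of_nat k * dB p b f else 0)" for p q
  proof -
    have "dB p b (\<Sum>c<n. vA c p * dB q c f)
        = (\<Sum>c<n. (if c = b then dB q c f else 0) + vA c p * dB q c (dB p b f))"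
      unfolding pd_sum by (intro sum.cong) (auto simp: pd_Var_mult pd_commute[of "AVar b p"])
    also have "\<dots> = dB q b f + (\<Sum>c<n. vA c p * dB q c (dB p b f))"
      using \<open>b < n\<close> by (simp add: sum.distrib)
    finally have "dB p b (\<Sum>c<n. vA c p * dB q c f) = dB q b f + (\<Sum>c<n. vA c p * dB q c (dB p b f))" .
    then show ?thesis
      by (simp add: moment_def pd_add pd_diff pd_sum pd_Const_mult dB_vX Const_of_nat
          pd_commute[of "AVar b p" "XVar _ _"])
  qed
  have "0 = (\<Sum>q<N. vA a q * (\<Sum>p<N. dB p b (moment n k N q p f)))"
    using f by simp
  also have "\<dots> = WXY N a b f - Z - (of_nat N * W1 N a b f + Q) + of_nat k * W1 N a b f"
  proof -
    have "(\<Sum>p<N. dB p b (moment n k N q p f)) = (\<Sum>j<N. vX q j * (\<Sum>p<N. dY j p (dB p b f)))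
        - (\<Sum>p<N. \<Sum>i<N. vX i p * dY q i (dB p b f))
        - (of_nat N * dB q b f + (\<Sum>p<N. \<Sum>c<n. vA c p * dB q c (dB p b f)))
        + of_nat k * dB q b f" if "q < N" for q
      unfolding dm using that
      by (simp add: sum.distrib sum_subtractf) (simp add: sum_distrib_left, rule sum.swap)
    then have "(\<Sum>q<N. vA a q * (\<Sum>p<N. dB p b (moment n k N q p f))) =
        (\<Sum>q<N. vA a q * ((\<Sum>j<N. vX q j * (\<Sum>p<N. dY j p (dB p b f)))
        - (\<Sum>p<N. \<Sum>i<N. vX i p * dY q i (dB p b f))
        - (of_nat N * dB q b f + (\<Sum>p<N. \<Sum>c<n. vA c p * dB q c (dB p b f)))
        + of_nat k * dB q b f))" by simp
    also have "\<dots> = WXY N a b f - Z - (of_nat N * W1 N a b f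
        + (\<Sum>q<N. vA a q * (\<Sum>p<N. \<Sum>c<n. vA c p * dB q c (dB p b f)))) + of_nat k * W1 N a b f"
      by (simp add: WXY_def Z_def W1_def distrib_left right_diff_distrib sum.distrib sum_subtractf
          sum_distrib_left[of "of_nat _"] mult.left_commute)
    also have "(\<Sum>q<N. vA a q * (\<Sum>p<N. \<Sum>c<n. vA c p * dB q c (dB p b f))) = Q"
      unfolding Q_def sum_distrib_swap[symmetric] by (simp only: sum.swap[of _ "{..<n}"])
    finally show ?thesis .
  qed
  finally have 1: "WXY N a b f - Z - (of_nat N * W1 N a b f + Q) + of_nat k * W1 N a b f = 0" by simp
  have 2: "WYX N a b f = of_nat N * W1 N a b f + Z"
  proof -
    have "WYX N a b f = (\<Sum>i<N. vA a i * (\<Sum>j<N. dB i b f + (\<Sum>l<N. vX j l * dY i j (dB l b f))))"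
      unfolding WYX_def
      by (intro sum.cong refl arg_cong2[of _ _ _ _ "(*)"], subst dY_sum_vX_row) auto
    also have "\<dots> = of_nat N * W1 N a b f
        + (\<Sum>i<N. vA a i * (\<Sum>j<N. \<Sum>l<N. vX j l * dY i j (dB l b f)))"
      by (simp add: W1_def sum.distrib distrib_left sum_distrib_left[of "of_nat _"] mult.left_commute)
    also have "(\<Sum>i<N. vA a i * (\<Sum>j<N. \<Sum>l<N. vX j l * dY i j (dB l b f))) = Z"
      unfolding Z_def by (subst (2) sum.swap) (rule refl)
    finally show ?thesis .
  qed
  have 3: "(\<Sum>c<n. W1 N a c (W1 N c b f)) = Q + of_nat n * W1 N a b f"
    unfolding W1_W1 Q_def by (simp add: sum.distrib)
  show ?thesis unfolding 2 3 using 1 by (simp add: algebra_simps)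
qed

subsection \<open>Linearity and adjoints\<close>

definition linear_op :: "(cpoly \<Rightarrow> cpoly) \<Rightarrow> bool" where
  "linear_op T \<longleftrightarrow> (\<forall>f g. T (f + g) = T f + T g) \<and> (\<forall>c f. T (Const c * f) = Const c * T f)"

lemma linear_opD:
  assumes "linear_op T"
  shows "T (f + g) = T f + T g" "T (Const c * f) = Const c * T f" "T 0 = 0"
    "T (- f) = - T f" "T (f - g) = T f - T g" "T (\<Sum>x\<in>S. F x) = (\<Sum>x\<in>S. T (F x))"
proof -
  show add: "T (f + g) = T f + T g" for f g using assms by (simp add: linear_op_def)
  show scale: "T (Const c * f) = Const c * T f" for c f using assms by (simp add: linear_op_def)
  show zero: "T 0 = 0" using scale[of 0 0] by simp
  show "T (- f) = - T f" using scale[of "- 1" f] by (simp add: Const_uminus)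
  then show "T (f - g) = T f - T g" using add[of f "- g"] scale[of "- 1" g] by (simp add: Const_uminus)
  show "T (\<Sum>x\<in>S. F x) = (\<Sum>x\<in>S. T (F x))"
    by (induction S rule: infinite_finite_induct) (simp_all add: zero add)
qed

lemma linear_op_intros:
  "linear_op (\<lambda>f. f)" "linear_op (\<lambda>f. 0)"
  "linear_op S \<Longrightarrow> linear_op T \<Longrightarrow> linear_op (\<lambda>f. S f + T f)"
  "linear_op S \<Longrightarrow> linear_op T \<Longrightarrow> linear_op (\<lambda>f. S f - T f)"
  "linear_op T \<Longrightarrow> linear_op (\<lambda>f. g * T f)"
  "linear_op T \<Longrightarrow> linear_op (\<lambda>f. pd v (T f))"
  "(\<And>x. x \<in> I \<Longrightarrow> linear_op (G x)) \<Longrightarrow> linear_op (\<lambda>f. \<Sum>x\<in>I. G x f)"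
  by (simp_all add: linear_op_def algebra_simps pd_add pd_Const_mult sum.distrib sum_distrib_left)

lemma linear_op_comp: "linear_op S \<Longrightarrow> linear_op T \<Longrightarrow> linear_op (\<lambda>f. S (T f))"
  unfolding linear_op_def by metis

lemma linear_op_W:
  "linear_op (W1 N a b)" "linear_op (WY N a b)" "linear_op (WX N a b)" "linear_op (WXY N a b)"
  unfolding W1_def WY_def WX_def WXY_def by (intro linear_op_intros)+

text \<open>Taking adjoints reverses a word and exchanges variables with derivatives: X with Y, and
  A^a with B_a. Hence a and b trade places here and in the next two lemmas.\<close>

lemma ip_W1: "ip (W1 N a b f) g = ip f (W1 N b a g)"
  by (simp add: W1_def ip_sum_left ip_sum_right ip_adjoint)

lemma ip_WY: "ip (WY N a b f) g = ip f (WX N b a g)"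
proof -
  have "ip (WY N a b f) g = (\<Sum>i<N. \<Sum>j<N. ip f (vA b j * (vX j i * dB i a g)))"
    by (simp add: WY_def ip_sum_left ip_adjoint)
  also have "\<dots> = ip f (WX N b a g)"
    by (subst sum.swap) (simp add: WX_def ip_sum_right sum_distrib_left)
  finally show ?thesis .
qed

lemma ip_WXY: "ip (WXY N a b f) g = ip f (WXY N b a g)"
proof -
  have "ip (WXY N a b f) g
      = (\<Sum>i<N. \<Sum>j<N. \<Sum>l<N. ip f (vA b l * (vX l j * dY j i (dB i a g))))"
    by (simp add: WXY_def ip_sum_left ip_adjoint)
  also have "\<dots> = (\<Sum>i<N. \<Sum>l<N. \<Sum>j<N. ip f (vA b l * (vX l j * dY j i (dB i a g))))"
    by (rule sum.cong[OF refl], rule sum.swap)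
  also have "\<dots> = (\<Sum>l<N. \<Sum>i<N. \<Sum>j<N. ip f (vA b l * (vX l j * dY j i (dB i a g))))"
    by (rule sum.swap)
  also have "\<dots> = (\<Sum>l<N. \<Sum>j<N. \<Sum>i<N. ip f (vA b l * (vX l j * dY j i (dB i a g))))"
    by (rule sum.cong[OF refl], rule sum.swap)
  also have "\<dots> = ip f (WXY N b a g)"
    by (simp add: WXY_def ip_sum_right sum_distrib_left)
  finally show ?thesis .
qed

lemma poly_ring_Const_mult:
  assumes "f \<in> poly_ring V"
  shows "Const c * f \<in> poly_ring V"
  using assms unfolding poly_ring_def by (auto simp: in_keys_iff lookup_Const_mult)

lemma poly_ring_mult:
  assumes "f \<in> poly_ring V" "g \<in> poly_ring V"
  shows "f * g \<in> poly_ring V"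
  using assms(1)
  by (induction rule: poly_ring_induct)
    (simp_all add: poly_ring_Const_mult assms(2) distrib_right poly_ring_add mult.assoc poly_ring_mult_Var)

lemma XVar_in_vars: "XVar i j \<in> vars n N \<longleftrightarrow> i < N \<and> j < N"
  and AVar_in_vars: "AVar a i \<in> vars n N \<longleftrightarrow> a < n \<and> i < N"
  by (auto simp: vars_def)

lemma vars_eq:
  "vars n N = (\<lambda>(i, j). XVar i j) ` ({..<N} \<times> {..<N}) \<union> (\<lambda>(a, i). AVar a i) ` ({..<n} \<times> {..<N})"
  by (auto simp: vars_def image_iff)

lemma finite_vars: "finite (vars n N)"
  unfolding vars_eq by simp

lemma sum_vars:
  "(\<Sum>v\<in>vars n N. F v) = (\<Sum>i<N. \<Sum>j<N. F (XVar i j)) + (\<Sum>a<n. \<Sum>i<N. F (AVar a i))"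
proof -
  have "(\<Sum>v\<in>vars n N. F v) = (\<Sum>v\<in>(\<lambda>(i, j). XVar i j) ` ({..<N} \<times> {..<N}). F v)
      + (\<Sum>v\<in>(\<lambda>(a, i). AVar a i) ` ({..<n} \<times> {..<N}). F v)"
    unfolding vars_eq by (rule sum.union_disjoint) auto
  then show ?thesis
    by (simp add: sum.reindex inj_on_def sum.cartesian_product split_def)
qed

lemma W_poly_ring:
  assumes "f \<in> poly_ring (vars n N)" "a < n"
  shows "W1 N a b f \<in> poly_ring (vars n N)" "WY N a b f \<in> poly_ring (vars n N)"
    "WX N a b f \<in> poly_ring (vars n N)" "WXY N a b f \<in> poly_ring (vars n N)"
  unfolding W1_def WY_def WX_def WXY_def
  by (intro poly_ring_sum poly_ring_mult_Var poly_ring_pd assms, simp_all add: XVar_in_vars AVar_in_vars assms(2))+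

lemma poly_ring_uminus: "f \<in> poly_ring V \<Longrightarrow> - f \<in> poly_ring V"
  using poly_ring_Const_mult[of f V "- 1"] by (simp add: Const_uminus)

lemma poly_ring_diff: "f \<in> poly_ring V \<Longrightarrow> g \<in> poly_ring V \<Longrightarrow> f - g \<in> poly_ring V"
  using poly_ring_add[of f V "- g"] by (simp add: poly_ring_uminus)

lemma Const_hom: "comm_ring_hom Const"
  by unfold_locales (simp_all add: Const_add Const_mult)

lemma mat3_entry:
  assumes "A \<in> carrier_mat l N" "B \<in> carrier_mat N N" "C \<in> carrier_mat N m" "i < l" "j < m"
  shows "(A * B * C) $$ (i, j) = (\<Sum>q<N. \<Sum>p<N. A $$ (i, p) * B $$ (p, q) * C $$ (q, j))"
proof -
  have "(A * B * C) $$ (i, j) = (\<Sum>q<N. (A * B) $$ (i, q) * C $$ (q, j))"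
    using assms by (simp add: scalar_prod_def lessThan_atLeast0 del: assoc_mult_mat)
  also have "\<dots> = (\<Sum>q<N. \<Sum>p<N. A $$ (i, p) * B $$ (p, q) * C $$ (q, j))"
    using assms by (intro sum.cong refl) (simp add: scalar_prod_def lessThan_atLeast0 sum_distrib_right)
  finally show ?thesis .
qed

lemma mat2_entry:
  assumes "A \<in> carrier_mat l N" "B \<in> carrier_mat N m" "i < l" "j < m"
  shows "(A * B) $$ (i, j) = (\<Sum>p<N. A $$ (i, p) * B $$ (p, j))"
  using assms by (simp add: scalar_prod_def lessThan_atLeast0)

subsection \<open>Invariance of the operators\<close>

text \<open>The substitution \<open>gl\<close> replaces $X$ by $gXh$ and $A$ by $Ah$, where $gh = hg = 1$. A family
  \<open>u\<close> of polynomials with one upper index is related to \<open>w\<close> if it is the transform of \<open>w\<close>.\<close>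

locale gl_pair =
  fixes n N :: nat and g h :: "complex mat"
  assumes carrier: "g \<in> carrier_mat N N" "h \<in> carrier_mat N N"
    and gh: "g * h = 1\<^sub>m N" and hg: "h * g = 1\<^sub>m N"
begin

definition gl_subst :: "var \<Rightarrow> cpoly" where
  "gl_subst v = (case v of
        XVar i j \<Rightarrow> (map_mat Const g * Xmat N * map_mat Const h) $$ (i, j)
      | AVar a i \<Rightarrow> (Amat n N * map_mat Const h) $$ (a, i))"

abbreviation gl :: "cpoly \<Rightarrow> cpoly" where "gl \<equiv> subst gl_subst"

lemma gl_act_eq: "gl_act n N g h = gl"
  unfolding gl_act_def gl_subst_def by (rule refl)

abbreviation cg where "cg i j \<equiv> Const (g $$ (i, j))"
abbreviation ch where "ch i j \<equiv> Const (h $$ (i, j))"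

abbreviation G where "G \<equiv> map_mat Const g"
abbreviation H where "H \<equiv> map_mat Const h"

lemma carrier': "G \<in> carrier_mat N N" "H \<in> carrier_mat N N" "Xmat N \<in> carrier_mat N N"
    "Amat n N \<in> carrier_mat n N"
  using carrier by (auto simp: Xmat_def Amat_def)

lemma GH: "G * H = 1\<^sub>m N" "H * G = 1\<^sub>m N"
proof -
  interpret C: comm_ring_hom Const by (rule Const_hom)
  show "G * H = 1\<^sub>m N" "H * G = 1\<^sub>m N"
    using C.mat_hom_mult[OF carrier] C.mat_hom_mult[OF carrier(2,1)] gh hg by (simp_all add: C.mat_hom_one)
qed

lemma sum_cg_ch: "i < N \<Longrightarrow> j < N \<Longrightarrow> (\<Sum>l<N. cg i l * ch l j) = (if i = j then 1 else 0)"
  using mat2_entry[OF carrier'(1,2), of i j] carrier by (simp add: GH)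

lemma gl_subst_XVar:
  assumes "i < N" "j < N"
  shows "gl_subst (XVar i j) = (\<Sum>q<N. \<Sum>p<N. cg i p * vX p q * ch q j)"
  using mat3_entry[OF carrier'(1,3,2) assms] assms carrier by (simp add: gl_subst_def Xmat_def)

lemma gl_subst_AVar:
  assumes "a < n" "i < N"
  shows "gl_subst (AVar a i) = (\<Sum>p<N. vA a p * ch p i)"
  using mat2_entry[OF carrier'(4,2) assms] assms carrier by (simp add: gl_subst_def Amat_def)

text \<open>The substitution solved for the original variables, from H(GXH)G = X. It serves to
  rewrite a variable times \<open>gl f\<close> as a combination of transforms.\<close>

lemma vX_eq:
  assumes "i < N" "j < N"
  shows "vX i j = (\<Sum>q<N. \<Sum>p<N. ch i p * gl_subst (XVar p q) * cg q j)"
proof -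
  let ?Z = "G * Xmat N * H"
  have Z: "?Z \<in> carrier_mat N N" using carrier' by simp
  have "H * ?Z * G = H * (?Z * G)" using carrier' by (intro assoc_mult_mat) auto
  also have "?Z * G = G * Xmat N * (H * G)" using carrier' by (intro assoc_mult_mat) auto
  also have "\<dots> = G * Xmat N" using carrier' by (simp add: GH)
  also have "H * (G * Xmat N) = H * G * Xmat N" using carrier' by (intro assoc_mult_mat[symmetric]) auto
  also have "\<dots> = Xmat N" using carrier' by (simp add: GH)
  finally have "vX i j = (H * ?Z * G) $$ (i, j)" using assms by (simp add: Xmat_def)
  also have "\<dots> = (\<Sum>q<N. \<Sum>p<N. H $$ (i, p) * ?Z $$ (p, q) * G $$ (q, j))"
    by (rule mat3_entry[OF carrier'(2) Z carrier'(1) assms])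
  also have "\<dots> = (\<Sum>q<N. \<Sum>p<N. ch i p * gl_subst (XVar p q) * cg q j)"
    using carrier assms by (intro sum.cong refl) (simp add: gl_subst_def)
  finally show ?thesis .
qed

lemma vA_eq:
  assumes "a < n" "i < N"
  shows "vA a i = (\<Sum>p<N. gl_subst (AVar a p) * cg p i)"
proof -
  let ?Z = "Amat n N * H"
  have Z: "?Z \<in> carrier_mat n N" using carrier' by simp
  have "?Z * G = Amat n N * (H * G)" using carrier' by (intro assoc_mult_mat) auto
  also have "\<dots> = Amat n N" using carrier' by (simp add: GH)
  finally have "vA a i = (?Z * G) $$ (a, i)" using assms by (simp add: Amat_def)
  also have "\<dots> = (\<Sum>p<N. ?Z $$ (a, p) * G $$ (p, i))"
    by (rule mat2_entry[OF Z carrier'(1) assms])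
  also have "\<dots> = (\<Sum>p<N. gl_subst (AVar a p) * cg p i)"
    using carrier assms by (intro sum.cong refl) (simp add: gl_subst_def)
  finally show ?thesis .
qed

abbreviation R where "R \<equiv> poly_ring (vars n N)"

lemma gl_add: "gl (f + f') = gl f + gl f'" and gl_mult: "gl (f * f') = gl f * gl f'"
  and gl_sum: "gl (\<Sum>x\<in>S. F x) = (\<Sum>x\<in>S. gl (F x))" and gl_Var_mult: "gl (Var v * f) = gl_subst v * gl f"
  by (simp_all add: subst_eq_gev Const.gev_add Const.gev_mult Const.gev_sum)

lemma dB_gl:
  assumes f: "f \<in> R" and b: "b < n" "i < N"
  shows "dB i b (gl f) = (\<Sum>q<N. ch i q * gl (dB q b f))"
proof -
  have X: "pd (AVar b i) (gl_subst (XVar p q)) = 0" if "p < N" "q < N" for p q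
    using that by (simp add: gl_subst_XVar pd_sum pd_mult pd_Const pd_Var)
  have A: "pd (AVar b i) (gl_subst (AVar a q)) = (if a = b then ch i q else 0)" if "a < n" "q < N" for a q
  proof -
    have "pd (AVar b i) (gl_subst (AVar a q)) = (\<Sum>p<N. if p = i then (if a = b then ch p q else 0) else 0)"
      unfolding gl_subst_AVar[OF that] pd_sum
      by (intro sum.cong) (auto simp: pd_mult pd_Const pd_Var)
    then show ?thesis using b by simp
  qed
  have "dB i b (gl f) = (\<Sum>a<n. \<Sum>q<N. (if a = b then ch i q else 0) * gl (pd (AVar a q) f))"
    unfolding pd_subst[OF f finite_vars] sum_vars by (simp add: X A)
  also have "\<dots> = (\<Sum>a<n. if a = b then \<Sum>q<N. ch i q * gl (dB q a f) else 0)"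
    by (intro sum.cong) auto
  finally show ?thesis using b by simp
qed

lemma dY_gl:
  assumes f: "f \<in> R" and ij: "i < N" "j < N"
  shows "dY i j (gl f) = (\<Sum>p<N. \<Sum>q<N. cg p j * ch i q * gl (dY q p f))"
proof -
  have A: "pd (XVar j i) (gl_subst (AVar a q)) = 0" if "a < n" "q < N" for a q
    using that by (simp add: gl_subst_AVar pd_sum pd_mult pd_Const pd_Var)
  have X: "pd (XVar j i) (gl_subst (XVar p q)) = cg p j * ch i q" if "p < N" "q < N" for p q
  proof -
    have "pd (XVar j i) (gl_subst (XVar p q))
        = (\<Sum>t<N. \<Sum>s<N. if s = j then (if t = i then cg p s * ch t q else 0) else 0)"
      unfolding gl_subst_XVar[OF that] pd_sum
      by (intro sum.cong) (auto simp: pd_mult pd_Const pd_Var)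
    then show ?thesis using ij by simp
  qed
  show ?thesis
    unfolding pd_subst[OF f finite_vars] sum_vars by (simp add: X A)
qed

lemma vX_gl:
  assumes "i < N" "j < N"
  shows "vX i j * gl f = (\<Sum>q<N. \<Sum>p<N. ch i p * cg q j * gl (vX p q * f))"
  unfolding vX_eq[OF assms] sum_distrib_right gl_Var_mult
  by (intro sum.cong refl) (simp only: ac_simps)

lemma vA_gl:
  assumes "a < n" "i < N"
  shows "vA a i * gl f = (\<Sum>p<N. cg p i * gl (vA a p * f))"
  unfolding vA_eq[OF assms] sum_distrib_right gl_Var_mult
  by (intro sum.cong refl) (simp only: ac_simps)

definition vec_rel :: "(nat \<Rightarrow> cpoly) \<Rightarrow> (nat \<Rightarrow> cpoly) \<Rightarrow> bool" where
  "vec_rel u w \<longleftrightarrow> (\<forall>i<N. w i \<in> R \<and> u i = (\<Sum>q<N. ch i q * gl (w q)))"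

text \<open>A word A^a...B_b is transformed letter by letter from the right: B_b starts a family
  with one upper index, Y and X carry it to another such family, and A^a contracts the
  index.\<close>

lemma vec_rel_dB:
  assumes "f \<in> R" "b < n"
  shows "vec_rel (\<lambda>i. dB i b (gl f)) (\<lambda>i. dB i b f)"
  using assms by (simp add: vec_rel_def dB_gl poly_ring_pd)

lemma sum_contract:
  fixes F :: "nat \<Rightarrow> cpoly"
  assumes "p < N"
  shows "(\<Sum>j<N. \<Sum>q<N. cg p j * ch j q * F q) = F p"
proof -
  have "(\<Sum>j<N. \<Sum>q<N. cg p j * ch j q * F q) = (\<Sum>q<N. (\<Sum>j<N. cg p j * ch j q) * F q)"
    by (subst sum.swap) (simp add: sum_distrib_right)
  also have "\<dots> = (\<Sum>q<N. if q = p then F q else 0)"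
    using assms by (intro sum.cong) (auto simp: sum_cg_ch)
  finally show ?thesis using assms by simp
qed

lemma vec_rel_dY:
  assumes "vec_rel u w"
  shows "vec_rel (\<lambda>i. \<Sum>j<N. dY i j (u j)) (\<lambda>i. \<Sum>j<N. dY i j (w j))"
  unfolding vec_rel_def
proof (intro allI impI conjI)
  fix i assume i: "i < N"
  have w: "w q \<in> R" "u q = (\<Sum>s<N. ch q s * gl (w s))" if "q < N" for q
    using assms that by (auto simp: vec_rel_def)
  show "(\<Sum>j<N. dY i j (w j)) \<in> R" by (intro poly_ring_sum poly_ring_pd w) simp
  have "(\<Sum>j<N. dY i j (u j)) = (\<Sum>j<N. \<Sum>q<N. ch j q * dY i j (gl (w q)))"
    by (intro sum.cong) (simp_all add: w pd_sum pd_Const_mult)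
  also have "\<dots> = (\<Sum>j<N. \<Sum>q<N. \<Sum>p<N. \<Sum>s<N. cg p j * ch j q * (ch i s * gl (dY s p (w q))))"
    using i by (intro sum.cong) (simp_all add: dY_gl w sum_distrib_left ac_simps)
  also have "\<dots> = (\<Sum>p<N. \<Sum>s<N. \<Sum>j<N. \<Sum>q<N. cg p j * ch j q * (ch i s * gl (dY s p (w q))))"
    by (subst (1) sum.swap, subst (2) sum.swap, subst (2) sum.swap, subst (1) sum.swap) simp
  also have "\<dots> = (\<Sum>p<N. \<Sum>s<N. ch i s * gl (dY s p (w p)))"
    by (intro sum.cong refl sum_contract) simp
  also have "\<dots> = (\<Sum>s<N. ch i s * gl (\<Sum>p<N. dY s p (w p)))"
    unfolding gl_sum sum_distrib_left by (rule sum.swap)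
  finally show "(\<Sum>j<N. dY i j (u j)) = (\<Sum>q<N. ch i q * gl (\<Sum>j<N. dY q j (w j)))" .
qed

lemma vec_rel_vX:
  assumes "vec_rel u w"
  shows "vec_rel (\<lambda>i. \<Sum>j<N. vX i j * u j) (\<lambda>i. \<Sum>j<N. vX i j * w j)"
  unfolding vec_rel_def
proof (intro allI impI conjI)
  fix i assume i: "i < N"
  have w: "w q \<in> R" "u q = (\<Sum>s<N. ch q s * gl (w s))" if "q < N" for q
    using assms that by (auto simp: vec_rel_def)
  show "(\<Sum>j<N. vX i j * w j) \<in> R"
    by (intro poly_ring_sum poly_ring_mult_Var w) (simp_all add: i XVar_in_vars)
  have "(\<Sum>j<N. vX i j * u j) = (\<Sum>j<N. \<Sum>q<N. ch j q * (vX i j * gl (w q)))"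
    by (intro sum.cong) (simp_all add: w sum_distrib_left mult.left_commute)
  also have "\<dots> = (\<Sum>j<N. \<Sum>q<N. \<Sum>t<N. \<Sum>p<N. cg t j * ch j q * (ch i p * gl (vX p t * w q)))"
    using i by (intro sum.cong) (simp_all only: vX_gl lessThan_iff sum_distrib_left ac_simps)
  also have "\<dots> = (\<Sum>t<N. \<Sum>p<N. \<Sum>j<N. \<Sum>q<N. cg t j * ch j q * (ch i p * gl (vX p t * w q)))"
    by (subst (1) sum.swap, subst (2) sum.swap, subst (2) sum.swap, subst (1) sum.swap) simp
  also have "\<dots> = (\<Sum>t<N. \<Sum>p<N. ch i p * gl (vX p t * w t))"
    by (intro sum.cong refl sum_contract) simp
  also have "\<dots> = (\<Sum>p<N. ch i p * gl (\<Sum>t<N. vX p t * w t))"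
    unfolding gl_sum sum_distrib_left by (rule sum.swap)
  finally show "(\<Sum>j<N. vX i j * u j) = (\<Sum>q<N. ch i q * gl (\<Sum>j<N. vX q j * w j))" .
qed

lemma vec_rel_vA:
  assumes "vec_rel u w" "a < n"
  shows "(\<Sum>i<N. vA a i * u i) = gl (\<Sum>i<N. vA a i * w i)"
proof -
  have w: "w q \<in> R" "u q = (\<Sum>s<N. ch q s * gl (w s))" if "q < N" for q
    using assms that by (auto simp: vec_rel_def)
  have "(\<Sum>i<N. vA a i * u i) = (\<Sum>i<N. \<Sum>q<N. ch i q * (vA a i * gl (w q)))"
    by (intro sum.cong) (simp_all add: w sum_distrib_left mult.left_commute)
  also have "\<dots> = (\<Sum>i<N. \<Sum>q<N. \<Sum>p<N. cg p i * ch i q * gl (vA a p * w q))"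
    using assms by (intro sum.cong) (simp_all only: vA_gl lessThan_iff sum_distrib_left ac_simps)
  also have "\<dots> = (\<Sum>p<N. \<Sum>i<N. \<Sum>q<N. cg p i * ch i q * gl (vA a p * w q))"
    by (subst (2) sum.swap, subst (1) sum.swap) simp
  also have "\<dots> = (\<Sum>p<N. gl (vA a p * w p))"
    by (intro sum.cong refl sum_contract) simp
  finally show ?thesis by (simp add: gl_sum)
qed

lemma W_gl:
  assumes "f \<in> R" "a < n" "b < n"
  shows "W1 N a b (gl f) = gl (W1 N a b f)" "WY N a b (gl f) = gl (WY N a b f)"
    "WX N a b (gl f) = gl (WX N a b f)" "WXY N a b (gl f) = gl (WXY N a b f)"
  unfolding W1_def WY_def WX_def WXY_def
  by (intro vec_rel_vA vec_rel_vX vec_rel_dY vec_rel_dB assms)+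

end

lemma Hspace_poly_ring: "f \<in> Hspace n k N \<Longrightarrow> f \<in> poly_ring (vars n N)"
  by (simp add: Hspace_def)

lemma HspaceD:
  assumes "f \<in> Hspace n k N" "g \<in> carrier_mat N N" "h \<in> carrier_mat N N" "g * h = 1\<^sub>m N" "h * g = 1\<^sub>m N"
  shows "gl_act n N g h f = Const (inverse (det g) ^ k) * f"
  using assms by (auto simp: Hspace_def inverts_mat_def)

lemma HspaceI:
  assumes "f \<in> poly_ring (vars n N)"
    "\<And>g h. gl_pair N g h \<Longrightarrow> gl_act n N g h f = Const (inverse (det g) ^ k) * f"
  shows "f \<in> Hspace n k N"
  using assms by (auto simp: Hspace_def inverts_mat_def gl_pair_def)

lemma Hspace_W:
  assumes f: "f \<in> Hspace n k N" and ab: "a < n" "b < n"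
  shows "W1 N a b f \<in> Hspace n k N" "WY N a b f \<in> Hspace n k N"
    "WX N a b f \<in> Hspace n k N" "WXY N a b f \<in> Hspace n k N"
proof -
  note R = Hspace_poly_ring[OF f]
  have "gl_act n N g h (W f) = Const (inverse (det g) ^ k) * W f"
    if W: "linear_op W" "\<And>g h. gl_pair N g h \<Longrightarrow> W (gl_act n N g h f) = gl_act n N g h (W f)"
      and gh: "gl_pair N g h" for W g h
    using HspaceD[OF f, of g h] gh by (simp add: W(2)[OF gh, symmetric] linear_opD(2)[OF W(1)] gl_pair_def)
  note * = this[OF linear_op_W(1)] this[OF linear_op_W(2)] this[OF linear_op_W(3)] this[OF linear_op_W(4)]
  show "W1 N a b f \<in> Hspace n k N" "WY N a b f \<in> Hspace n k N"
    "WX N a b f \<in> Hspace n k N" "WXY N a b f \<in> Hspace n k N"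
    by (rule HspaceI, rule W_poly_ring[OF R ab(1)], rule *, simp add: gl_pair.gl_act_eq gl_pair.W_gl[OF _ R ab], assumption)+
qed

lemma gl_act_linear:
  assumes "gl_pair N g h"
  shows "gl_act n N g h (f + f') = gl_act n N g h f + gl_act n N g h f'"
    "gl_act n N g h (Const c * f) = Const c * gl_act n N g h f"
  unfolding gl_pair.gl_act_eq[OF assms] subst_eq_gev
  by (simp_all add: Const.gev_add Const.gev_mult)

lemma Hspace_add: "f \<in> Hspace n k N \<Longrightarrow> g \<in> Hspace n k N \<Longrightarrow> f + g \<in> Hspace n k N"
  by (rule HspaceI) (auto simp: gl_act_linear Hspace_poly_ring poly_ring_add distrib_left HspaceD gl_pair_def)

lemma Hspace_scale: "f \<in> Hspace n k N \<Longrightarrow> Const c * f \<in> Hspace n k N"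
  by (rule HspaceI) (auto simp: gl_act_linear Hspace_poly_ring poly_ring_Const_mult mult.left_commute HspaceD gl_pair_def)

subsection \<open>Covariants are annihilated by the moment map\<close>

text \<open>Infinitesimal covariance under 1 + tE, where E has its only entry 1 at (p, q). The
  inverse of such a matrix has the same form and the determinant is explicit, so one derivative at t
  = 0 suffices and no matrix exponential is involved.\<close>

lemma moment_Hspace:
  assumes f: "f \<in> Hspace n k N" and q: "q < N" and p: "p < N"
  shows "moment n k N q p f = 0"
proof (rule peval_eq_0_imp)
  fix \<rho> :: "var \<Rightarrow> complex"
  note R = Hspace_poly_ring[OF f]
  define \<delta> :: complex where "\<delta> = of_bool (p = q)"
  define e where "e t i j = of_bool (i = j) + of_bool (i = p \<and> j = q) * t" for t :: complex and i j :: nat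
  \<comment> \<open>Solves t + s + \<delta> t s = 0, so that the matrix for s t inverts the one for
    t: s t = -t off the diagonal and -t/(1 + t) on it.\<close>
  define s where "s t = - t / (1 + \<delta> * t)" for t
  have e_left: "(\<Sum>l<N. e t i l * F l) = F i + of_bool (i = p) * t * F q" if "i < N" for t i F
  proof -
    have "(\<Sum>l<N. e t i l * F l)
        = (\<Sum>l<N. (if l = i then F l else 0) + (if l = q then of_bool (i = p) * t * F l else 0))"
      by (intro sum.cong) (auto simp: e_def algebra_simps)
    then show ?thesis using that q by (simp add: sum.distrib)
  qed
  have e_right: "(\<Sum>l<N. F l * e t l j) = F j + of_bool (j = q) * t * F p" if "j < N" for t j F
  proof -
    have "(\<Sum>l<N. F l * e t l j)
        = (\<Sum>l<N. (if l = j then F l else 0) + (if l = p then of_bool (j = q) * t * F l else 0))"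
      by (intro sum.cong) (auto simp: e_def algebra_simps)
    then show ?thesis using that p by (simp add: sum.distrib)
  qed
  define g where "g t = mat N N (\<lambda>(i, j). e t i j)" for t
  have g_carrier: "g t \<in> carrier_mat N N" for t by (simp add: g_def)
  have gg: "g t * g u = 1\<^sub>m N" if "t + u + \<delta> * t * u = 0" for t u
  proof (rule eq_matI)
    fix i j assume "i < dim_row (1\<^sub>m N :: complex mat)" "j < dim_col (1\<^sub>m N :: complex mat)"
    then have ij: "i < N" "j < N" by auto
    have "(g t * g u) $$ (i, j) = (\<Sum>l<N. e t i l * e u l j)"
      using ij by (simp add: g_def scalar_prod_def lessThan_atLeast0)
    also have "\<dots> = e u i j + of_bool (i = p) * t * e u q j"
      by (rule e_left[OF ij(1)])
    also have "\<dots> = of_bool (i = j) + of_bool (i = p \<and> j = q) * (t + u + \<delta> * t * u)"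
      by (auto simp: e_def \<delta>_def algebra_simps)
    finally show "(g t * g u) $$ (i, j) = (1\<^sub>m N) $$ (i, j)" using ij that by simp
  qed (simp_all add: g_def)
  have det_g: "det (g t) = 1 + \<delta> * t" for t
  proof (cases "p = q")
    case True
    have "g t = multrow_mat N p (1 + t)"
      unfolding g_def multrow_mat_def e_def using True by (intro cong_mat) auto
    then show ?thesis using det_multrow_mat[OF p, of "1 + t"] True by (simp add: \<delta>_def)
  next
    case False
    have "g t = addrow_mat N t p q"
      unfolding g_def addrow_mat_def e_def using False by (intro cong_mat) (auto simp: Let_def)
    then show ?thesis using det_addrow_mat[OF False, of N t] False by (simp add: \<delta>_def)
  qed
  define x where "x i j = \<rho> (XVar i j)" for i j
  define y where "y a i = \<rho> (AVar a i)" for a i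
  \<comment> \<open>The entries of gXh and Ah at the point \<rho>, multiplied out, for g = 1 + tE
    and h = 1 + s(t)E.\<close>
  define \<rho>t where "\<rho>t t v = (case v of
      XVar i j \<Rightarrow> x i j + of_bool (i = p) * t * x q j
        + of_bool (j = q) * s t * (x i p + of_bool (i = p) * t * x q p)
    | AVar a i \<Rightarrow> y a i + of_bool (i = q) * s t * y a p)" for t v
  have eval: "peval (\<rho>t t) f = inverse (1 + \<delta> * t) ^ k * peval \<rho> f" if t: "1 + \<delta> * t \<noteq> 0" for t
  proof -
    have "t + s t + \<delta> * t * s t = 0" using t by (simp add: s_def field_simps)
    then have inv: "g t * g (s t) = 1\<^sub>m N" "g (s t) * g t = 1\<^sub>m N"
      by (auto intro!: gg simp: algebra_simps)
    interpret gl_pair n N "g t" "g (s t)"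
      by unfold_locales (use g_carrier inv in auto)
    have cg: "cg i j = Const (e t i j)" "ch i j = Const (e (s t) i j)" if "i < N" "j < N" for i j
      using that by (simp_all add: g_def)
    have "\<rho>t t v = peval \<rho> (gl_subst v)" if v: "v \<in> vars n N" for v
    proof (cases v)
      case (XVar i j)
      with v have ij: "i < N" "j < N" by (auto simp: XVar_in_vars)
      have "peval \<rho> (gl_subst v) = (\<Sum>b<N. (\<Sum>a<N. e t i a * x a b) * e (s t) b j)"
        unfolding XVar gl_subst_XVar[OF ij] peval.gev_sum sum_distrib_right
        by (intro sum.cong) (auto simp: cg ij peval.gev_mult x_def)
      also have "\<dots> = (\<Sum>a<N. e t i a * x a j) + of_bool (j = q) * s t * (\<Sum>a<N. e t i a * x a p)"
        by (rule e_right[OF ij(2)])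
      finally show ?thesis unfolding e_left[OF ij(1)] by (simp add: XVar \<rho>t_def algebra_simps)
    next
      case (AVar a i)
      with v have ai: "a < n" "i < N" by (auto simp: AVar_in_vars)
      have "peval \<rho> (gl_subst v) = (\<Sum>b<N. y a b * e (s t) b i)"
        unfolding AVar gl_subst_AVar[OF ai] peval.gev_sum
        by (intro sum.cong) (auto simp: cg ai peval.gev_mult y_def)
      also have "\<dots> = y a i + of_bool (i = q) * s t * y a p"
        by (rule e_right[OF ai(2)])
      finally show ?thesis by (simp add: AVar \<rho>t_def)
    qed
    then have "peval (\<rho>t t) f = peval \<rho> (gl_act n N (g t) (g (s t)) f)"
      unfolding gl_act_eq peval_subst by (rule peval.gev_cong[OF R])
    also have "gl_act n N (g t) (g (s t)) f = Const (inverse (1 + \<delta> * t) ^ k) * f"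
      using HspaceD[OF f g_carrier g_carrier inv] by (simp add: det_g)
    finally show ?thesis by (simp add: peval.gev_mult)
  qed
  define \<rho>' where "\<rho>' v = (case v of XVar i j \<Rightarrow> of_bool (i = p) * x q j - of_bool (j = q) * x i p
      | AVar a i \<Rightarrow> - of_bool (i = q) * y a p)" for v
  have s0: "s 0 = 0" by (simp add: s_def)
  have ds: "(s has_field_derivative - 1) (at 0)"
    unfolding s_def by (auto intro!: derivative_eq_intros)
  have d\<rho>: "((\<lambda>t. \<rho>t t v) has_field_derivative \<rho>' v) (at 0)" for v
  proof (cases v)
    case (XVar i j)
    show ?thesis unfolding \<rho>t_def \<rho>'_def XVar
      by (auto intro!: derivative_eq_intros ds simp: s0)
  next
    case (AVar a i)
    show ?thesis unfolding \<rho>t_def \<rho>'_def AVar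
      by (auto intro!: derivative_eq_intros ds simp: s0)
  qed
  have \<rho>0: "\<rho>t 0 = \<rho>"
    by (rule ext) (simp add: \<rho>t_def s0 x_def y_def split: var.split)
  have "((\<lambda>t. peval (\<rho>t t) f) has_field_derivative (\<Sum>v\<in>vars n N. \<rho>' v * peval (\<rho>t 0) (pd v f))) (at 0)"
    by (rule DERIV_peval[OF R finite_vars d\<rho>])
  moreover have "((\<lambda>t. peval (\<rho>t t) f) has_field_derivative (- of_nat k * \<delta> * peval \<rho> f)) (at 0)"
  \<comment> \<open>For |t| < 1 the determinant 1 + \<delta> t is nonzero, which is what
    \<open>eval\<close> requires.\<close>
  proof (rule has_field_derivative_transform_within_open[where S = "ball 0 1"])
    show "((\<lambda>t. inverse (1 + \<delta> * t) ^ k * peval \<rho> f) has_field_derivative (- of_nat k * \<delta> * peval \<rho> f)) (at 0)"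
      by (auto intro!: derivative_eq_intros)
  next
    fix t :: complex assume "t \<in> ball 0 1"
    then have "1 + \<delta> * t \<noteq> 0"
      by (auto simp: \<delta>_def add_eq_0_iff)
    then show "inverse (1 + \<delta> * t) ^ k * peval \<rho> f = peval (\<rho>t t) f" by (simp add: eval)
  qed auto
  ultimately have "(\<Sum>v\<in>vars n N. \<rho>' v * peval \<rho> (pd v f)) = - of_nat k * \<delta> * peval \<rho> f"
    unfolding \<rho>0 by (rule DERIV_unique)
  moreover have "(\<Sum>v\<in>vars n N. \<rho>' v * peval \<rho> (pd v f))
      = (\<Sum>j<N. x q j * peval \<rho> (dY j p f)) - (\<Sum>i<N. x i p * peval \<rho> (dY q i f))
        - (\<Sum>c<n. y c p * peval \<rho> (dB q c f))"
  proof -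
    have "(\<Sum>i<N. \<Sum>j<N. \<rho>' (XVar i j) * peval \<rho> (pd (XVar i j) f))
       = (\<Sum>i<N. (if i = p then \<Sum>j<N. x q j * peval \<rho> (pd (XVar i j) f) else 0)
            - (\<Sum>j<N. if j = q then x i p * peval \<rho> (pd (XVar i j) f) else 0))"
    proof (intro sum.cong refl)
      fix i
      have "(\<Sum>j<N. \<rho>' (XVar i j) * peval \<rho> (pd (XVar i j) f))
          = (\<Sum>j<N. of_bool (i = p) * (x q j * peval \<rho> (pd (XVar i j) f))
              - (if j = q then x i p * peval \<rho> (pd (XVar i j) f) else 0))"
        by (intro sum.cong refl) (auto simp: \<rho>'_def left_diff_distrib)
      then show "(\<Sum>j<N. \<rho>' (XVar i j) * peval \<rho> (pd (XVar i j) f))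
          = (if i = p then \<Sum>j<N. x q j * peval \<rho> (pd (XVar i j) f) else 0)
            - (\<Sum>j<N. if j = q then x i p * peval \<rho> (pd (XVar i j) f) else 0)"
        by (auto simp: sum_subtractf)
    qed
    moreover have "(\<Sum>i<N. \<rho>' (AVar a i) * peval \<rho> (pd (AVar a i) f))
       = (\<Sum>i<N. if i = q then - (y a p * peval \<rho> (pd (AVar a i) f)) else 0)" for a
      by (intro sum.cong refl) (auto simp: \<rho>'_def)
    ultimately show ?thesis
      unfolding sum_vars using p q by (simp add: sum_subtractf sum_negf)
  qed
  ultimately show "peval \<rho> (moment n k N q p f) = 0"
    by (auto simp: moment_def peval.gev_add peval.gev_diff peval.gev_sum peval.gev_mult x_def y_def \<delta>_def)
qed

subsection \<open>Degrees\<close>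

definition var_xdeg :: "var \<Rightarrow> nat" where
  "var_xdeg v = (case v of XVar i j \<Rightarrow> 1 | AVar a i \<Rightarrow> 0)"

lemma xdeg_eq: "xdeg \<alpha> = (\<Sum>v\<in>Poly_Mapping.keys \<alpha>. Poly_Mapping.lookup \<alpha> v * var_xdeg v)"
  unfolding xdeg_def var_xdeg_def by (intro sum.cong) (auto split: var.split)

lemma xdeg_superset:
  assumes "finite K" "Poly_Mapping.keys \<alpha> \<subseteq> K"
  shows "xdeg \<alpha> = (\<Sum>v\<in>K. Poly_Mapping.lookup \<alpha> v * var_xdeg v)"
  unfolding xdeg_eq using assms by (intro sum.mono_neutral_left) (auto simp: in_keys_iff)

lemma xdeg_add: "xdeg (\<alpha> + \<beta>) = xdeg \<alpha> + xdeg \<beta>"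
proof -
  let ?K = "Poly_Mapping.keys \<alpha> \<union> Poly_Mapping.keys \<beta>"
  have "Poly_Mapping.keys (\<alpha> + \<beta>) \<subseteq> ?K" by (rule keys_add)
  then show ?thesis
    using xdeg_superset[of ?K "\<alpha> + \<beta>"] xdeg_superset[of ?K \<alpha>] xdeg_superset[of ?K \<beta>]
    by (simp add: lookup_add sum.distrib distrib_right)
qed

lemma xdeg_single [simp]: "xdeg (Poly_Mapping.single v 1) = var_xdeg v"
  by (simp add: xdeg_eq)

text \<open>The weight is a parameter because both the degree in X and the total degree occur. The
  bound is an integer so that lowering operators can shift it freely; a negative bound leaves only
  0.\<close>

definition deg_le :: "((var \<Rightarrow>\<^sub>0 nat) \<Rightarrow> nat) \<Rightarrow> int \<Rightarrow> cpoly set" where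
  "deg_le w D = {f. \<forall>\<alpha>\<in>Poly_Mapping.keys f. int (w \<alpha>) \<le> D}"

lemma deg_le_mono: "f \<in> deg_le w D \<Longrightarrow> D \<le> D' \<Longrightarrow> f \<in> deg_le w D'"
  by (auto simp: deg_le_def)

lemma deg_le_0 [simp]: "0 \<in> deg_le w D"
  by (simp add: deg_le_def)

lemma deg_le_add: "f \<in> deg_le w D \<Longrightarrow> g \<in> deg_le w D \<Longrightarrow> f + g \<in> deg_le w D"
  using keys_add[of f g] unfolding deg_le_def by blast

lemma deg_le_scale: "f \<in> deg_le w D \<Longrightarrow> Const c * f \<in> deg_le w D"
  by (auto simp: deg_le_def in_keys_iff lookup_Const_mult)

lemma deg_le_sum: "(\<And>x. x \<in> S \<Longrightarrow> F x \<in> deg_le w D) \<Longrightarrow> (\<Sum>x\<in>S. F x) \<in> deg_le w D"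
  by (induction S rule: infinite_finite_induct) (auto intro: deg_le_add)

lemma deg_le_Var_mult:
  assumes "\<And>\<alpha>. w (\<alpha> + Poly_Mapping.single v 1) = w \<alpha> + m" "f \<in> deg_le w (D - int m)"
  shows "Var v * f \<in> deg_le w D"
  using assms keys_Var_mult[of v f] by (fastforce simp: deg_le_def)

lemma deg_le_pd:
  assumes "\<And>\<alpha>. w (\<alpha> + Poly_Mapping.single v 1) = w \<alpha> + m" "f \<in> deg_le w (D + int m)"
  shows "pd v f \<in> deg_le w D"
  unfolding deg_le_def
proof clarify
  fix \<alpha> assume "\<alpha> \<in> Poly_Mapping.keys (pd v f)"
  then have "\<alpha> + Poly_Mapping.single v 1 \<in> Poly_Mapping.keys f"
    unfolding in_keys_iff lookup_pd by auto
  then have "int (w (\<alpha> + Poly_Mapping.single v 1)) \<le> D + int m"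
    using assms(2) unfolding deg_le_def by blast
  then show "int (w \<alpha>) \<le> D" unfolding assms(1) by simp
qed

lemma xdeg_step: "xdeg (\<alpha> + Poly_Mapping.single v 1) = xdeg \<alpha> + var_xdeg v"
  unfolding xdeg_add xdeg_single ..

lemma deg_le_xdeg_intros:
  "f \<in> deg_le xdeg (D - 1) \<Longrightarrow> vX i j * f \<in> deg_le xdeg D"
  "f \<in> deg_le xdeg D \<Longrightarrow> vA a i * f \<in> deg_le xdeg D"
  "f \<in> deg_le xdeg (D + 1) \<Longrightarrow> dY i j f \<in> deg_le xdeg D"
  "f \<in> deg_le xdeg D \<Longrightarrow> dB i a f \<in> deg_le xdeg D"
  using deg_le_Var_mult[where w = xdeg, OF xdeg_step, of f D "XVar i j"]
    deg_le_Var_mult[where w = xdeg, OF xdeg_step, of f D "AVar a i"]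
    deg_le_pd[where w = xdeg, OF xdeg_step, of f D "XVar j i"]
    deg_le_pd[where w = xdeg, OF xdeg_step, of f D "AVar a i"]
  by (simp_all add: var_xdeg_def)

lemma deg_le_W:
  assumes "f \<in> deg_le xdeg D"
  shows "W1 N a b f \<in> deg_le xdeg D" "WY N a b f \<in> deg_le xdeg (D - 1)"
    "WX N a b f \<in> deg_le xdeg (D + 1)" "WXY N a b f \<in> deg_le xdeg D"
  unfolding W1_def WY_def WX_def WXY_def using assms
  by (intro deg_le_sum deg_le_xdeg_intros; simp)+

lemma lookup_number_op:
  "Poly_Mapping.lookup (Var v * pd v f) \<alpha> = of_nat (Poly_Mapping.lookup \<alpha> v) * Poly_Mapping.lookup f \<alpha>"
proof (cases "Poly_Mapping.lookup \<alpha> v = 0")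
  case True
  then show ?thesis by (simp add: lookup_Var_mult_0)
next
  case False
  then have "v \<in> Poly_Mapping.keys \<alpha>" by (simp add: in_keys_iff)
  from exponent_minus_single[OF this] obtain \<beta> where \<beta>: "\<alpha> = \<beta> + Poly_Mapping.single v 1" by metis
  show ?thesis unfolding \<beta> lookup_Var_mult_add lookup_pd by (simp add: lookup_add)
qed

text \<open>Covariants have degree $kN$ in $A$, because the centre of $GL_N$ acts on $A$ only.\<close>

lemma Hspace_tdeg:
  assumes f: "f \<in> Hspace n k N" and \<alpha>: "\<alpha> \<in> Poly_Mapping.keys f"
  shows "tdeg \<alpha> = xdeg \<alpha> + k * N"
proof -
  let ?l = "Poly_Mapping.lookup"
  \<comment> \<open>The trace of the moment map: its two terms in X cancel, and the term in A is the
    Euler operator of the A-variables.\<close>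
  have "0 = (\<Sum>q<N. moment n k N q q f)" using moment_Hspace[OF f] by simp
  also have "\<dots> = (\<Sum>q<N. \<Sum>j<N. vX q j * dY j q f) - (\<Sum>q<N. \<Sum>i<N. vX i q * dY q i f)
      - (\<Sum>q<N. \<Sum>c<n. vA c q * dB q c f) + of_nat (k * N) * f"
    by (simp add: moment_def sum.distrib sum_subtractf Const_of_nat algebra_simps)
  also have "(\<Sum>q<N. \<Sum>i<N. vX i q * dY q i f) = (\<Sum>q<N. \<Sum>j<N. vX q j * dY j q f)"
    by (rule sum.swap)
  finally have "(\<Sum>q<N. \<Sum>c<n. vA c q * dB q c f) = Const (of_nat (k * N)) * f"
    by (simp add: Const_of_nat Const_mult)
  from arg_cong[OF this, of "\<lambda>f. ?l f \<alpha>"]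
  have "of_nat (\<Sum>q<N. \<Sum>c<n. ?l \<alpha> (AVar c q)) * ?l f \<alpha> = of_nat (k * N) * ?l f \<alpha>"
    unfolding lookup_sum lookup_number_op lookup_Const_mult
    by (simp add: sum_distrib_right)
  moreover have "?l f \<alpha> \<noteq> 0" using \<alpha> by (simp add: in_keys_iff)
  ultimately have A: "(\<Sum>q<N. \<Sum>c<n. ?l \<alpha> (AVar c q)) = k * N"
    unfolding mult_cancel_right of_nat_eq_iff by blast
  have sub: "Poly_Mapping.keys \<alpha> \<subseteq> vars n N"
    using Hspace_poly_ring[OF f] \<alpha> by (auto simp: poly_ring_def)
  have "(\<Sum>q<N. \<Sum>c<n. ?l \<alpha> (AVar c q)) = (\<Sum>c<n. \<Sum>q<N. ?l \<alpha> (AVar c q))"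
    by (rule sum.swap)
  with A show ?thesis
    unfolding tdeg_superset[OF finite_vars sub] xdeg_superset[OF finite_vars sub] sum_vars
    by (simp add: var_xdeg_def)
qed

lemma finite_bounded_exponents:
  assumes "finite V"
  shows "finite {\<alpha> :: var \<Rightarrow>\<^sub>0 nat. Poly_Mapping.keys \<alpha> \<subseteq> V \<and> tdeg \<alpha> \<le> M}" (is "finite ?S")
proof (rule finite_imageD)
  have "Poly_Mapping.lookup ` ?S \<subseteq> {f. \<forall>x. (x \<in> V \<longrightarrow> f x \<in> {..M}) \<and> (x \<notin> V \<longrightarrow> f x = 0)}"
  proof clarify
    fix \<alpha> :: "var \<Rightarrow>\<^sub>0 nat" and v assume \<alpha>: "Poly_Mapping.keys \<alpha> \<subseteq> V" "tdeg \<alpha> \<le> M"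
    have "Poly_Mapping.lookup \<alpha> v \<le> M"
    proof (cases "v \<in> Poly_Mapping.keys \<alpha>")
      case True
      then have "Poly_Mapping.lookup \<alpha> v \<le> tdeg \<alpha>"
        unfolding tdeg_def by (intro member_le_sum) auto
      with \<alpha> show ?thesis by simp
    qed (simp add: in_keys_iff)
    with \<alpha> show "(v \<in> V \<longrightarrow> Poly_Mapping.lookup \<alpha> v \<in> {..M}) \<and> (v \<notin> V \<longrightarrow> Poly_Mapping.lookup \<alpha> v = 0)"
      by (auto simp: in_keys_iff)
  qed
  then show "finite (Poly_Mapping.lookup ` ?S)"
    by (rule finite_subset) (intro finite_set_of_finite_funs assms finite_atMost)
  show "inj_on Poly_Mapping.lookup ?S"
    by (rule inj_onI) (simp add: lookup_inject)
qed

section \<open>Covariants filtered by the degree above the ground degree\<close>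

definition ground_deg :: "nat \<Rightarrow> nat \<Rightarrow> nat \<Rightarrow> nat \<Rightarrow> nat" where
  "ground_deg n k r L = k * n * (L * (L - 1) div 2) + k * r * L"

text \<open>A degree bound instead of a sum of graded components: it contains
  \<open>Htilde_le\<close> and passes through sums, operators and the restriction without any
  splitting into homogeneous parts.\<close>

definition HH :: "nat \<Rightarrow> nat \<Rightarrow> nat \<Rightarrow> nat \<Rightarrow> int \<Rightarrow> cpoly set" where
  "HH n k r L e = {f \<in> Htilde n k r L. f \<in> deg_le xdeg (int (ground_deg n k r L) + e)}"

lemma HH_Hspace: "f \<in> HH n k r L e \<Longrightarrow> f \<in> Hspace n k (n * L + r)"
  by (simp add: HH_def Htilde_def)

lemma HH_mono: "f \<in> HH n k r L e \<Longrightarrow> e \<le> e' \<Longrightarrow> f \<in> HH n k r L e'"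
  by (auto simp: HH_def intro: deg_le_mono)

lemma Hspace_0: "0 \<in> Hspace n k N"
  by (rule HspaceI) (auto simp: poly_ring_def gl_act_def subst_def)

lemma HH_subspace: "cpoly.subspace (HH n k r L e)"
  by (rule cpoly.subspaceI)
    (auto simp: HH_def Htilde_def Hspace_add Hspace_scale Hspace_0 deg_le_add deg_le_scale)

lemmas HH_add = cpoly.subspace_add[OF HH_subspace]
  and HH_scale = cpoly.subspace_scale[OF HH_subspace]
  and HH_sum = cpoly.subspace_sum[OF HH_subspace]
  and HH_diff = cpoly.subspace_diff[OF HH_subspace]

lemma HH_W:
  assumes f: "f \<in> HH n k r L e" and ab: "a < n" "b < n"
  shows "W1 (n * L + r) a b f \<in> HH n k r L e" "WY (n * L + r) a b f \<in> HH n k r L (e - 1)"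
    "WX (n * L + r) a b f \<in> HH n k r L (e + 1)" "WXY (n * L + r) a b f \<in> HH n k r L e"
  using Hspace_W[OF HH_Hspace[OF f] ab] deg_le_W[of f "int (ground_deg n k r L) + e" "n * L + r" a b] f
  by (simp_all add: HH_def Htilde_def algebra_simps)

lemma Htilde_le_subset_HH: "Htilde_le n k r L e \<subseteq> HH n k r L (int e)"
proof
  fix f assume "f \<in> Htilde_le n k r L e"
  then obtain D v where f: "f = (\<Sum>d\<in>D. v d)"
    and v: "\<And>d. d \<in> D \<Longrightarrow> d \<le> int e \<and> v d \<in> Htilde_comp n k r L d"
    unfolding Htilde_le_def by blast
  show "f \<in> HH n k r L (int e)"
    unfolding f
  proof (rule HH_sum)
    fix d assume "d \<in> D"
    from v[OF this] show "v d \<in> HH n k r L (int e)"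
      unfolding HH_def Htilde_comp_def deg_le_def ground_deg_def by fastforce
  qed
qed

text \<open>\<open>Hspace_tdeg\<close> fixes the degree in A, so a bound on the degree in X bounds
  the total degree, and finitely many monomials in finitely many variables remain.\<close>

lemma HH_keys_finite:
  obtains K where "finite K" "\<And>f. f \<in> HH n k r L e \<Longrightarrow> Poly_Mapping.keys f \<subseteq> K"
proof
  let ?N = "n * L + r"
  let ?K = "{\<alpha>. Poly_Mapping.keys \<alpha> \<subseteq> vars n ?N
    \<and> tdeg \<alpha> \<le> nat (int (ground_deg n k r L) + e) + k * ?N}"
  show "finite ?K" by (rule finite_bounded_exponents[OF finite_vars])
  fix f assume f: "f \<in> HH n k r L e"
  show "Poly_Mapping.keys f \<subseteq> ?K"
  proof
    fix \<alpha> assume \<alpha>: "\<alpha> \<in> Poly_Mapping.keys f"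
    have "Poly_Mapping.keys \<alpha> \<subseteq> vars n ?N"
      using Hspace_poly_ring[OF HH_Hspace[OF f]] \<alpha> by (auto simp: poly_ring_def)
    moreover have "int (xdeg \<alpha>) \<le> int (ground_deg n k r L) + e"
      using f \<alpha> by (auto simp: HH_def deg_le_def)
    ultimately show "\<alpha> \<in> ?K"
      using Hspace_tdeg[OF HH_Hspace[OF f] \<alpha>] by auto
  qed
qed

section \<open>Restriction to smaller matrices\<close>

text \<open>The restriction to the matrices $X$ whose first $n$ columns vanish and whose remaining columns
  consist of an $n\times(N-n)$ block over an $(N-n)\times(N-n)$ block, with $A = (1_n \mid 0)$; the upper
  block of $X$ takes the role of $A$ for $N-n$. It is injective in small degrees, and the operators
  on both sides differ by simple terms.\<close>

definition restr_subst :: "nat \<Rightarrow> var \<Rightarrow> cpoly" where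
  "restr_subst n v = (case v of
      XVar i j \<Rightarrow> if j < n then 0 else if i < n then vA i (j - n) else vX (i - n) (j - n)
    | AVar a j \<Rightarrow> if a = j \<and> j < n then 1 else 0)"

definition restr :: "nat \<Rightarrow> cpoly \<Rightarrow> cpoly" where
  "restr n = subst (restr_subst n)"

lemma restr_hom:
  "restr n (f + g) = restr n f + restr n g" "restr n (f - g) = restr n f - restr n g"
  "restr n (f * g) = restr n f * restr n g" "restr n (Const c) = Const c"
  "restr n (\<Sum>x\<in>S. F x) = (\<Sum>x\<in>S. restr n (F x))" "restr n (Var v) = restr_subst n v"
  "restr n 0 = 0"
  unfolding restr_def subst_eq_gev
  by (simp_all add: Const.gev_add Const.gev_diff Const.gev_mult Const.gev_sum)

lemma restr_X [simp]:
  "j < n \<Longrightarrow> restr_subst n (XVar i j) = 0"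
  "i < n \<Longrightarrow> restr_subst n (XVar i (n + j)) = vA i j"
  "restr_subst n (XVar (n + i) (n + j)) = vX i j"
  "j < n \<Longrightarrow> restr_subst n (AVar a j) = (if a = j then 1 else 0)"
  "restr_subst n (AVar a (n + j)) = 0"
  by (simp_all add: restr_subst_def)

lemma sum_lessThan_split:
  fixes F :: "nat \<Rightarrow> 'a::comm_monoid_add"
  shows "(\<Sum>j<n + m. F j) = (\<Sum>j<n. F j) + (\<Sum>j<m. F (n + j))"
  by (induction m) (simp_all add: add.assoc)

lemma sum_delta_mult:
  fixes F :: "nat \<Rightarrow> 'a::comm_ring_1"
  shows "(\<Sum>i<n. (if a = i then 1 else 0) * F i) = (if a < n then F a else 0)"
proof -
  have "(\<Sum>i<n. (if a = i then 1 else 0) * F i) = (\<Sum>i<n. if a = i then F i else 0)"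
    by (intro sum.cong) auto
  then show ?thesis by simp
qed

text \<open>These variables stay free on the slice, and differentiation along the slice commutes
  with restriction to it.\<close>

lemma pd_restr:
  assumes f: "f \<in> poly_ring (vars n (n + N))"
  shows "\<beta> < n \<Longrightarrow> j < N \<Longrightarrow> restr n (pd (XVar \<beta> (n + j)) f) = pd (AVar \<beta> j) (restr n f)"
    and "i < N \<Longrightarrow> j < N \<Longrightarrow> restr n (pd (XVar (n + i) (n + j)) f) = pd (XVar i j) (restr n f)"
proof -
  have *: "pd v (restr n f) = restr n (pd u f)"
    if u: "u \<in> vars n (n + N)"
      and p: "\<And>w. w \<in> vars n (n + N) \<Longrightarrow> pd v (restr_subst n w) = (if w = u then 1 else 0)" for u v
  proof -
    have "pd v (restr n f) = (\<Sum>w\<in>vars n (n + N). if w = u then restr n (pd w f) else 0)"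
      unfolding restr_def pd_subst[OF f finite_vars] by (intro sum.cong refl) (simp add: p)
    then show ?thesis using u by (simp add: finite_vars)
  qed
  show "\<beta> < n \<Longrightarrow> j < N \<Longrightarrow> restr n (pd (XVar \<beta> (n + j)) f) = pd (AVar \<beta> j) (restr n f)"
    by (rule *[symmetric]) (auto simp: XVar_in_vars restr_subst_def pd_Var split: var.split)
  show "i < N \<Longrightarrow> j < N \<Longrightarrow> restr n (pd (XVar (n + i) (n + j)) f) = pd (XVar i j) (restr n f)"
    by (rule *[symmetric]) (auto simp: XVar_in_vars restr_subst_def pd_Var split: var.split)
qed

lemma subst_poly_ring:
  assumes "f \<in> poly_ring V" "\<And>v. v \<in> V \<Longrightarrow> \<sigma> v \<in> poly_ring W"
  shows "subst \<sigma> f \<in> poly_ring W"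
  using assms(1) unfolding subst_eq_gev
  by (induction rule: poly_ring_induct)
    (simp_all add: Const_poly_ring Const.gev_add poly_ring_add Const.gev_Var_mult poly_ring_mult assms(2))

lemma Var_poly_ring: "v \<in> V \<Longrightarrow> Var v \<in> poly_ring V"
  by (simp add: Var_def poly_ring_def)

lemma restr_poly_ring:
  assumes "f \<in> poly_ring (vars n (n + N))"
  shows "restr n f \<in> poly_ring (vars n N)"
  unfolding restr_def using assms
proof (rule subst_poly_ring)
  fix v assume "v \<in> vars n (n + N)"
  moreover have "0 \<in> poly_ring V" "1 \<in> poly_ring V" for V
    using Const_poly_ring[of 0] Const_poly_ring[of 1] by simp_all
  ultimately show "restr_subst n v \<in> poly_ring (vars n N)"
    by (cases v) (auto simp: restr_subst_def XVar_in_vars AVar_in_vars intro!: Var_poly_ring)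
qed

text \<open>The block matrix diag(1, g) preserves the slice: it keeps the zero columns and A = (1 |
  0), multiplies the upper block by h on the right and conjugates the lower one. Its determinant is
  det g, so the weight stays k.\<close>

lemma restr_Hspace:
  assumes f: "f \<in> Hspace n k (n + N)"
  shows "restr n f \<in> Hspace n k N"
proof (rule HspaceI)
  note R = Hspace_poly_ring[OF f]
  show "restr n f \<in> poly_ring (vars n N)" by (rule restr_poly_ring[OF R])
  fix g h assume gp: "gl_pair N g h"
  interpret S: gl_pair n N g h by fact
  define g1 where "g1 = four_block_mat (1\<^sub>m n) (0\<^sub>m n N) (0\<^sub>m N n) g"
  define h1 where "h1 = four_block_mat (1\<^sub>m n) (0\<^sub>m n N) (0\<^sub>m N n) h"
  have c1: "g1 \<in> carrier_mat (n + N) (n + N)" "h1 \<in> carrier_mat (n + N) (n + N)"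
    using S.carrier by (auto simp: g1_def h1_def)
  have one: "four_block_mat (1\<^sub>m n) (0\<^sub>m n N) (0\<^sub>m N n) (1\<^sub>m N) = (1\<^sub>m (n + N) :: complex mat)"
    by (intro eq_matI) auto
  have gh1: "g1 * h1 = 1\<^sub>m (n + N)" "h1 * g1 = 1\<^sub>m (n + N)"
    unfolding g1_def h1_def using S.carrier S.gh S.hg
    by (subst mult_four_block_mat[of _ n n _ N _ N _ _ n _ N]; simp add: one)+
  interpret B: gl_pair n "n + N" g1 h1
    by unfold_locales (use c1 gh1 in auto)
  have det: "det g1 = det g"
    unfolding g1_def using S.carrier by (subst det_four_block_mat_upper_right_zero) auto
  have e: "M $$ (i, j) = (if i < n then (if i = j then 1 else 0) else if j < n then 0 else m $$ (i - n, j - n))"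
    if "M = four_block_mat (1\<^sub>m n) (0\<^sub>m n N) (0\<^sub>m N n) m" "m \<in> carrier_mat N N" "i < n + N" "j < n + N"
    for M m :: "complex mat" and i j
    using that by auto
  note eg = e[OF g1_def S.carrier(1)] and eh = e[OF h1_def S.carrier(2)]
  have "peval \<rho> (gl_act n N g h (restr n f)) = peval \<rho> (Const (inverse (det g) ^ k) * restr n f)" for \<rho>
  proof -
    have "peval \<rho> (gl_act n N g h (restr n f))
        = peval (\<lambda>u. peval (\<lambda>v. peval \<rho> (S.gl_subst v)) (restr_subst n u)) f"
      unfolding S.gl_act_eq restr_def peval_subst ..
    \<comment> \<open>Acting with g after restricting amounts to acting with diag(1, g) before
      restricting. Both are substitutions, so it is enough to compare them on variables.\<close>
    also have "\<dots> = peval (\<lambda>u. peval (\<lambda>v. peval \<rho> (restr_subst n v)) (B.gl_subst u)) f"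
    proof (rule peval.gev_cong[OF R])
      fix u assume u: "u \<in> vars n (n + N)"
      let ?\<rho>1 = "\<lambda>v. peval \<rho> (restr_subst n v)"
      show "peval (\<lambda>v. peval \<rho> (S.gl_subst v)) (restr_subst n u) = peval ?\<rho>1 (B.gl_subst u)"
      proof (cases u)
        case (XVar i j)
        with u have ij: "i < n + N" "j < n + N" by (auto simp: XVar_in_vars)
        have E: "peval ?\<rho>1 (B.gl_subst (XVar i j))
            = (\<Sum>q<n+N. \<Sum>p<n+N. g1 $$ (i, p) * ?\<rho>1 (XVar p q) * h1 $$ (q, j))"
          unfolding B.gl_subst_XVar[OF ij] by (simp add: peval.gev_sum peval.gev_mult)
        also have "\<dots> = (\<Sum>q<N. \<Sum>p<n+N. g1 $$ (i, p) * ?\<rho>1 (XVar p (n + q)) * h1 $$ (n + q, j))"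
          unfolding sum_lessThan_split[of _ n N] by simp
        also have "\<dots> = peval (\<lambda>v. peval \<rho> (S.gl_subst v)) (restr_subst n (XVar i j))"
        proof (cases "j < n")
          case True
          then show ?thesis by (simp add: eh)
        next
          case False
          then obtain j' where j': "j = n + j'" "j' < N" using ij by (metis add_less_cancel_left le_add_diff_inverse not_less)
          show ?thesis
          proof (cases "i < n")
            case True
            have "(\<Sum>p<n+N. g1 $$ (i, p) * ?\<rho>1 (XVar p (n + q)) * h1 $$ (n + q, j))
                = ?\<rho>1 (XVar i (n + q)) * h $$ (q, j')" if "q < N" for q
            proof -
              have "(\<Sum>p<n+N. g1 $$ (i, p) * ?\<rho>1 (XVar p (n + q)) * h1 $$ (n + q, j))
                = (\<Sum>p<n+N. if p = i then ?\<rho>1 (XVar i (n + q)) * h $$ (q, j') else 0)"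
                using that True j' by (intro sum.cong refl) (auto simp: eg eh)
              then show ?thesis using True by simp
            qed
            then show ?thesis using True j'
              by (simp add: S.gl_subst_AVar peval.gev_sum peval.gev_mult)
          next
            case False
            then obtain i' where i': "i = n + i'" "i' < N" using ij by (metis add_less_cancel_left le_add_diff_inverse not_less)
            show ?thesis using i' j' unfolding sum_lessThan_split[of _ n N]
              by (simp add: eg eh S.gl_subst_XVar peval.gev_sum peval.gev_mult)
          qed
        qed
        finally show ?thesis by (simp add: XVar)
      next
        case (AVar a i)
        with u have ai: "a < n" "i < n + N" by (auto simp: AVar_in_vars)
        have "peval ?\<rho>1 (B.gl_subst (AVar a i)) = (\<Sum>p<n. (if a = p then 1 else 0) * h1 $$ (p, i))"
          unfolding B.gl_subst_AVar[OF ai] sum_lessThan_split[of _ n N] using ai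
          by (simp add: peval.gev_add peval.gev_sum peval.gev_mult if_distrib[of "peval \<rho>"] cong: if_cong)
        then have "peval ?\<rho>1 (B.gl_subst (AVar a i)) = h1 $$ (a, i)"
          using ai by (simp add: sum_delta_mult)
        then have "peval ?\<rho>1 (B.gl_subst (AVar a i)) = (if a = i then 1 else 0)"
          using ai by (simp add: eh)
        then show ?thesis using ai by (simp add: AVar restr_subst_def)
      qed
    qed
    also have "\<dots> = peval (\<lambda>v. peval \<rho> (restr_subst n v)) (gl_act n (n + N) g1 h1 f)"
      unfolding B.gl_act_eq peval_subst ..
    also have "gl_act n (n + N) g1 h1 f = Const (inverse (det g) ^ k) * f"
      using HspaceD[OF f c1 gh1] by (simp add: det)
    also have "peval (\<lambda>v. peval \<rho> (restr_subst n v)) \<dots> = peval \<rho> (Const (inverse (det g) ^ k) * restr n f)"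
      by (simp add: peval.gev_mult restr_def peval_subst)
    finally show ?thesis .
  qed
  then show "gl_act n N g h (restr n f) = Const (inverse (det g) ^ k) * restr n f"
    by (rule peval_inject)
qed

text \<open>The A-directions are transversal to the slice, so these derivatives are not read off
  from the restricted polynomial directly. The moment relation for the column b < n supplies them:
  on the slice this column of X is 0 and A^c_b = \<delta>^c_b, so the derivative in A stands alone
  and equals derivatives along the slice.\<close>

lemma restr_dB:
  assumes f: "f \<in> Hspace n k (n + N)" and b: "b < n"
  shows "a < n \<Longrightarrow> restr n (dB a b f)
      = W1 N a b (restr n f) + Const (if a = b then of_nat k else 0) * restr n f"
    and "l < N \<Longrightarrow> restr n (dB (n + l) b f) = (\<Sum>j<N. vX l j * dB j b (restr n f))"
proof -
  note R = Hspace_poly_ring[OF f]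
  have *: "restr n (dB q b f) = (\<Sum>j<N. restr_subst n (XVar q (n + j)) * dB j b (restr n f))
      + Const (if q = b then of_nat k else 0) * restr n f" if q: "q < n + N" for q
  proof -
    have "0 = restr n (moment n k (n + N) q b f)"
      using moment_Hspace[OF f q] b by (simp add: restr_hom)
    also have "\<dots> = (\<Sum>j<n + N. restr_subst n (XVar q j) * restr n (dY j b f))
       - (\<Sum>c<n. restr_subst n (AVar c b) * restr n (dB q c f))
       + Const (if q = b then of_nat k else 0) * restr n f"
      using b by (simp add: moment_def restr_hom)
    also have "(\<Sum>c<n. restr_subst n (AVar c b) * restr n (dB q c f))
       = (\<Sum>c<n. if c = b then restr n (dB q c f) else 0)"
      using b by (intro sum.cong) auto
    also have "(\<Sum>j<n + N. restr_subst n (XVar q j) * restr n (dY j b f))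
       = (\<Sum>j<N. restr_subst n (XVar q (n + j)) * dB j b (restr n f))"
      unfolding sum_lessThan_split using b by (simp add: pd_restr(1)[OF R])
    finally have "0 = (\<Sum>j<N. restr_subst n (XVar q (n + j)) * dB j b (restr n f)) - restr n (dB q b f)
      + Const (if q = b then of_nat k else 0) * restr n f" using b by simp
    then show ?thesis by (simp only: diff_add_eq eq_diff_eq add_0)
  qed
  show "restr n (dB a b f) = W1 N a b (restr n f) + Const (if a = b then of_nat k else 0) * restr n f"
    if "a < n"
    using *[of a] that by (simp add: W1_def)
  show "restr n (dB (n + l) b f) = (\<Sum>j<N. vX l j * dB j b (restr n f))" if "l < N"
    using *[of "n + l"] that b by simp
qed

lemma restr_W1:
  assumes f: "f \<in> Hspace n k (n + N)" and ab: "a < n" "b < n"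
  shows "restr n (W1 (n + N) a b f) = W1 N a b (restr n f) + Const (if a = b then of_nat k else 0) * restr n f"
proof -
  have "restr n (W1 (n + N) a b f) = restr n (dB a b f)"
    unfolding W1_def restr_hom sum_lessThan_split using ab by (simp add: sum_delta_mult)
  then show ?thesis using ab restr_dB(1)[OF f ab(2,1)] by simp
qed

text \<open>On the slice, A^aX is row a of the upper block, that is, the new A^a, which absorbs the
  X. In the remaining sum the indices below n give A^aB_eA^eB_b (summed over e) plus k A^aB_b, and
  the others give A^aYXB_b. \<open>WXY_minus_WYX\<close> for the smaller size restores the order XY,
  and k and k + n add up to 2k + n.\<close>

lemma restr_WXY:
  assumes f: "f \<in> Hspace n k (n + N)" and ab: "a < n" "b < n"
  shows "restr n (WXY (n + N) a b f) = WXY N a b (restr n f) + of_nat (2 * k + n) * W1 N a b (restr n f)"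
proof -
  note R = Hspace_poly_ring[OF f]
  define F where "F = restr n f"
  have "restr n (WXY (n + N) a b f) = (\<Sum>j<N. vA a j * (\<Sum>l<n+N. restr n (dY (n + j) l (dB l b f))))"
    unfolding WXY_def restr_hom sum_lessThan_split[of _ n N] using ab by (simp add: sum_delta_mult)
  also have "\<dots> = (\<Sum>j<N. vA a j * ((\<Sum>\<beta><n. dB j \<beta> (W1 N \<beta> b F))
      + of_nat k * dB j b F + (\<Sum>l<N. dY j l (\<Sum>m<N. vX l m * dB m b F))))"
  proof (intro sum.cong refl arg_cong2[of _ _ _ _ "(*)"])
    fix j assume "j \<in> {..<N}"
    then have j: "j < N" by simp
    have "(\<Sum>l<n. restr n (dY (n + j) l (dB l b f)))
        = (\<Sum>\<beta><n. dB j \<beta> (W1 N \<beta> b F) + (if \<beta> = b then of_nat k * dB j \<beta> F else 0))"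
    proof (intro sum.cong refl)
      fix \<beta> assume "\<beta> \<in> {..<n}"
      then have \<beta>: "\<beta> < n" by simp
      have "restr n (dY (n + j) \<beta> (dB \<beta> b f)) = dB j \<beta> (restr n (dB \<beta> b f))"
        by (rule pd_restr(1)[OF poly_ring_pd[OF R] \<beta> j])
      then show "restr n (dY (n + j) \<beta> (dB \<beta> b f)) = dB j \<beta> (W1 N \<beta> b F) + (if \<beta> = b then of_nat k * dB j \<beta> F else 0)"
        unfolding restr_dB(1)[OF f ab(2) \<beta>]
        by (auto simp: pd_add pd_Const_mult F_def simp flip: Const_of_nat)
    qed
    also have "\<dots> = (\<Sum>\<beta><n. dB j \<beta> (W1 N \<beta> b F)) + of_nat k * dB j b F"
      using ab by (simp add: sum.distrib)
    finally have 1: "(\<Sum>l<n. restr n (dY (n + j) l (dB l b f)))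
        = (\<Sum>\<beta><n. dB j \<beta> (W1 N \<beta> b F)) + of_nat k * dB j b F" .
    have 2: "(\<Sum>l<N. restr n (dY (n + j) (n + l) (dB (n + l) b f)))
        = (\<Sum>l<N. dY j l (\<Sum>m<N. vX l m * dB m b F))"
      using j by (intro sum.cong refl) (simp add: pd_restr(2)[OF poly_ring_pd[OF R]] restr_dB(2)[OF f ab(2)] F_def)
    show "(\<Sum>l<n+N. restr n (dY (n + j) l (dB l b f)))
        = (\<Sum>\<beta><n. dB j \<beta> (W1 N \<beta> b F)) + of_nat k * dB j b F + (\<Sum>l<N. dY j l (\<Sum>m<N. vX l m * dB m b F))"
      unfolding sum_lessThan_split 1 2 ..
  qed
  also have "\<dots> = (\<Sum>\<beta><n. W1 N a \<beta> (W1 N \<beta> b F)) + of_nat k * W1 N a b F + WYX N a b F"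
  proof -
    have "(\<Sum>j<N. vA a j * (\<Sum>\<beta><n. dB j \<beta> (W1 N \<beta> b F))) = (\<Sum>\<beta><n. W1 N a \<beta> (W1 N \<beta> b F))"
      unfolding sum_distrib_swap by (simp add: W1_def)
    then show ?thesis
      by (simp add: distrib_left sum.distrib WYX_def)
        (simp add: W1_def sum_distrib_left mult.left_commute)
  qed
  also have "(\<Sum>\<beta><n. W1 N a \<beta> (W1 N \<beta> b F)) = WXY N a b F - WYX N a b F + of_nat (k + n) * W1 N a b F"
    using WXY_minus_WYX[where f = F and n = n and k = k and N = N and a = a and b = b]
      moment_Hspace[OF restr_Hspace[OF f]] ab by (simp add: F_def)
  finally show ?thesis by (simp add: F_def algebra_simps)
qed

text \<open>X-variables become 0, A-variables or X-variables, and A-variables become constants; so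
  the old degree in X bounds the new total degree.\<close>

lemma restr_deg_le:
  assumes "f \<in> deg_le xdeg D"
  shows "restr n f \<in> deg_le tdeg D"
proof -
  have step: "tdeg (\<alpha> + Poly_Mapping.single v 1) = tdeg \<alpha> + 1" for \<alpha> v
    by (simp add: tdeg_add del: One_nat_def)
  have mono: "restr n (Poly_Mapping.single \<alpha> c) \<in> deg_le tdeg (int (xdeg \<alpha>))" for \<alpha> c
  proof (induction \<alpha> rule: exponent_induct)
    case zero
    have "restr n (Poly_Mapping.single 0 c) = Const c"
      using restr_hom(4)[of n c] by (simp add: Const_def)
    then show ?case by (auto simp: deg_le_def Const_def tdeg_def)
  next
    case (add v \<beta>)
    have "Poly_Mapping.single (\<beta> + Poly_Mapping.single v 1) c = Var v * Poly_Mapping.single \<beta> c"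
      by (simp add: Var_def mult_single add.commute)
    then have e: "restr n (Poly_Mapping.single (\<beta> + Poly_Mapping.single v 1) c)
        = restr_subst n v * restr n (Poly_Mapping.single \<beta> c)"
      by (simp add: restr_hom)
    have V: "Var u * restr n (Poly_Mapping.single \<beta> c) \<in> deg_le tdeg (int (xdeg \<beta>) + 1)" for u
      by (rule deg_le_Var_mult[where w = tdeg, OF step]) (use add in simp)
    show ?case
      unfolding e xdeg_step using add V
      by (cases v) (auto simp: restr_subst_def var_xdeg_def add.commute)
  qed
  have "restr n f = (\<Sum>\<alpha>\<in>Poly_Mapping.keys f. restr n (Poly_Mapping.single \<alpha> (Poly_Mapping.lookup f \<alpha>)))"
    by (subst poly_sum_monomials) (simp add: restr_hom)
  also have "\<dots> \<in> deg_le tdeg D"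
    using assms by (intro deg_le_sum deg_le_mono[OF mono]) (auto simp: deg_le_def)
  finally show ?thesis .
qed

lemma ground_deg_Suc: "ground_deg n k r (Suc L) = ground_deg n k r L + k * (n * L + r)"
proof -
  have "Suc L * L div 2 = L * (L - 1) div 2 + L"
  proof (cases L)
    case (Suc M)
    have "Suc (Suc M) * Suc M = Suc M * M + Suc M * 2" by simp
    then show ?thesis using Suc by simp
  qed simp
  then show ?thesis by (simp add: ground_deg_def algebra_simps)
qed

text \<open>Of the new total degree, k(nL + r) is degree in A. This is precisely the increase of
  \<open>ground_deg\<close> from L to L + 1, so the excess e over the ground degree is
  preserved.\<close>

lemma restr_HH:
  assumes f: "f \<in> HH n k r (Suc L) e"
  shows "restr n f \<in> HH n k r L e"
proof -
  have N: "n * Suc L + r = n + (n * L + r)" by simp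
  have H: "restr n f \<in> Hspace n k (n * L + r)"
    by (rule restr_Hspace) (use HH_Hspace[OF f] in \<open>simp only: N\<close>)
  have "restr n f \<in> deg_le tdeg (int (ground_deg n k r (Suc L)) + e)"
    using f by (intro restr_deg_le) (simp add: HH_def)
  then have "int (xdeg \<alpha>) \<le> int (ground_deg n k r L) + e" if "\<alpha> \<in> Poly_Mapping.keys (restr n f)" for \<alpha>
    using that Hspace_tdeg[OF H that] by (fastforce simp: deg_le_def ground_deg_Suc)
  with H show ?thesis by (auto simp: HH_def Htilde_def deg_le_def)
qed

subsection \<open>Krylov matrices and injectivity of the restriction\<close>

definition mat_assign :: "complex mat \<Rightarrow> complex mat \<Rightarrow> var \<Rightarrow> complex" where
  "mat_assign X A v = (case v of XVar i j \<Rightarrow> X $$ (i, j) | AVar a i \<Rightarrow> A $$ (a, i))"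

lemma Hspace_covariant:
  assumes f: "f \<in> Hspace n k N" and XA: "X \<in> carrier_mat N N" "A \<in> carrier_mat n N"
    and gp: "gl_pair N g h"
  shows "peval (mat_assign (g * X * h) (A * h)) f = inverse (det g) ^ k * peval (mat_assign X A) f"
proof -
  interpret gl_pair n N g h by fact
  have "peval (mat_assign (g * X * h) (A * h)) f = peval (\<lambda>v. peval (mat_assign X A) (gl_subst v)) f"
  proof (rule peval.gev_cong[OF Hspace_poly_ring[OF f]])
    fix v assume v: "v \<in> vars n N"
    show "mat_assign (g * X * h) (A * h) v = peval (mat_assign X A) (gl_subst v)"
    proof (cases v)
      case (XVar i j)
      with v have ij: "i < N" "j < N" by (auto simp: XVar_in_vars)
      show ?thesis
        unfolding XVar gl_subst_XVar[OF ij]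
        by (simp add: mat_assign_def mat3_entry[OF carrier(1) XA(1) carrier(2) ij] peval.gev_sum peval.gev_mult
            del: index_mult_mat)
    next
      case (AVar a i)
      with v have ai: "a < n" "i < N" by (auto simp: AVar_in_vars)
      show ?thesis
        unfolding AVar gl_subst_AVar[OF ai]
        by (simp add: mat_assign_def mat2_entry[OF XA(2) carrier(2) ai] peval.gev_sum peval.gev_mult
            del: index_mult_mat)
    qed
  qed
  also have "\<dots> = peval (mat_assign X A) (gl_act n N g h f)"
    unfolding gl_act_eq peval_subst ..
  also have "\<dots> = inverse (det g) ^ k * peval (mat_assign X A) f"
    using HspaceD[OF f carrier gh hg] by (simp add: peval.gev_mult)
  finally show ?thesis .
qed

text \<open>The first N rows of A, AX, AX^2, ... stacked. The ring is arbitrary because entries in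
  \<open>complex poly\<close> are used as well.\<close>

definition krylov :: "nat \<Rightarrow> nat \<Rightarrow> 'a::comm_ring_1 mat \<Rightarrow> 'a mat \<Rightarrow> 'a mat" where
  "krylov n N X A = mat N N (\<lambda>(i, j). (A * X ^\<^sub>m (i div n)) $$ (i mod n, j))"

interpretation poly_const: coefficient_hom "\<lambda>c. [:c:]"
  by unfold_locales (simp_all add: one_pCons)

lemma poly_gev: "poly (gev (\<lambda>c. [:c:]) \<sigma> f) t = peval (\<lambda>v. poly (\<sigma> v) t) f"
  by (induction f rule: cpoly_induct)
    (simp_all add: poly_const.gev_add poly_const.gev_Var_mult peval.gev_add peval.gev_Var_mult)

text \<open>Polynomials respect congruences modulo d. It is used with d a power of t.\<close>

lemma gev_dvd_diff:
  assumes "coefficient_hom h" "f \<in> poly_ring V" "\<And>v. v \<in> V \<Longrightarrow> d dvd \<sigma> v - \<tau> v"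
  shows "d dvd gev h \<sigma> f - gev h \<tau> f"
proof -
  interpret coefficient_hom h by fact
  show ?thesis using assms(2)
  proof (induction rule: poly_ring_induct)
    case (add f g)
    have "gev h \<sigma> (f + g) - gev h \<tau> (f + g) = (gev h \<sigma> f - gev h \<tau> f) + (gev h \<sigma> g - gev h \<tau> g)"
      by (simp add: gev_add)
    with add show ?case by simp
  next
    case (Var v f)
    have "gev h \<sigma> (Var v * f) - gev h \<tau> (Var v * f)
        = \<sigma> v * (gev h \<sigma> f - gev h \<tau> f) + (\<sigma> v - \<tau> v) * gev h \<tau> f"
      unfolding gev_Var_mult by (simp add: algebra_simps)
    with Var assms(3) show ?case by simp
  qed simp
qed

lemma degree_gev_le:
  assumes "f \<in> deg_le xdeg (int D)" "\<And>v. degree (\<sigma> v) \<le> var_xdeg v"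
  shows "degree (gev (\<lambda>c. [:c:]) \<sigma> f) \<le> D"
proof -
  have mono: "degree (gev (\<lambda>c. [:c:]) \<sigma> (Poly_Mapping.single \<alpha> c)) \<le> xdeg \<alpha>" for \<alpha> c
  proof (induction \<alpha> rule: exponent_induct)
    case zero
    show ?case using poly_const.gev_Const[of \<sigma> c] by (simp add: Const_def)
  next
    case (add v \<beta>)
    have "Poly_Mapping.single (\<beta> + Poly_Mapping.single v 1) c = Var v * Poly_Mapping.single \<beta> c"
      by (simp add: Var_def mult_single add.commute)
    then have "degree (gev (\<lambda>c. [:c:]) \<sigma> (Poly_Mapping.single (\<beta> + Poly_Mapping.single v 1) c))
        \<le> degree (\<sigma> v) + degree (gev (\<lambda>c. [:c:]) \<sigma> (Poly_Mapping.single \<beta> c))"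
      by (simp add: poly_const.gev_Var_mult degree_mult_le)
    with add assms(2)[of v] show ?case unfolding xdeg_step by simp
  qed
  have "gev (\<lambda>c. [:c:]) \<sigma> f = (\<Sum>\<alpha>\<in>Poly_Mapping.keys f.
      gev (\<lambda>c. [:c:]) \<sigma> (Poly_Mapping.single \<alpha> (Poly_Mapping.lookup f \<alpha>)))"
    by (subst poly_sum_monomials) (simp add: poly_const.gev_sum)
  also have "degree \<dots> \<le> D"
    using assms(1) by (intro degree_sum_le order_trans[OF mono]) (auto simp: deg_le_def)
  finally show ?thesis .
qed

lemma poly_eqI_nonzero:
  fixes p q :: "complex poly"
  assumes "\<And>t. t \<noteq> 0 \<Longrightarrow> poly p t = poly q t"
  shows "p = q"
proof -
  have "poly ([:0, 1:] * (p - q)) t = 0" for t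
    using assms[of t] by (cases "t = 0") simp_all
  then have "[:0, 1:] * (p - q) = 0" using poly_all_0_iff_0 by blast
  then show ?thesis unfolding mult_eq_0_iff by simp
qed

text \<open>The exponent of t in the determinant of diag(t^(i div n)). Its k-fold is
  \<open>ground_deg\<close>, which is where the degree shift comes from.\<close>

lemma sum_div:
  fixes n m L :: nat
  assumes "0 < n" "m \<le> n"
  shows "(\<Sum>i<n * L + m. i div n) = n * (L * (L - 1) div 2) + m * L"
proof -
  have tail: "(\<Sum>i<m. (n * L + i) div n) = m * L" if "m \<le> n" for m L
  proof -
    have "(n * L + i) div n = L" if "i < n" for i using that assms(1) by simp
    with that have "(\<Sum>i<m. (n * L + i) div n) = (\<Sum>i<m. L)"
      by (intro sum.cong) auto
    then show ?thesis by simp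
  qed
  have "(\<Sum>i<n * L. i div n) = n * (L * (L - 1) div 2)"
  proof (induction L)
    case (Suc L)
    have "(\<Sum>i<n * Suc L. i div n) = (\<Sum>i<n * L + n. i div n)" by (simp add: add.commute)
    also have "\<dots> = n * (L * (L - 1) div 2) + n * L"
      unfolding sum_lessThan_split Suc tail[OF order_refl] ..
    also have "\<dots> = n * (Suc L * (Suc L - 1) div 2)"
      using ground_deg_Suc[of n 1 0 L] by (simp add: ground_deg_def)
    finally show ?case .
  qed simp
  then show ?thesis
    unfolding sum_lessThan_split tail[OF assms(2)] by simp
qed

text \<open>The Krylov matrix conjugates \<open>X\<close> to a companion matrix; scaling \<open>X\<close> by \<open>t\<close> then scales the
  nontrivial entries of the companion matrix by non-negative powers of \<open>t\<close>, and those in the first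
  \<open>n\<close> columns by at least the power \<open>L\<close>.\<close>

lemma Hspace_eval_0_if_krylov:
  assumes n: "0 < n" and r: "r < n" and L: "1 \<le> L" and N: "N = n * L + r"
    and f: "f \<in> Hspace n k N" "f \<in> deg_le xdeg (int D)"
    and XA: "X \<in> carrier_mat N N" "A \<in> carrier_mat n N" and det: "det (krylov n N X A) \<noteq> 0"
    and D: "D < ground_deg n k r L \<or> D < ground_deg n k r L + L \<and> restr n f = 0"
  shows "peval (mat_assign X A) f = 0"
proof -
  note R = Hspace_poly_ring[OF f(1)]
  define K where "K = krylov n N X A"
  have Kc: "K \<in> carrier_mat N N" by (simp add: K_def krylov_def)
  have nN: "n \<le> N" using L N by (cases L) auto
  have modn: "i mod n < n" for i using n by simp
  obtain M where M: "M \<in> carrier_mat N N" "M * K = 1\<^sub>m N" "K * M = 1\<^sub>m N"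
    using det_non_zero_imp_unit[OF Kc, of undefined] det unfolding K_def[symmetric]
    by (auto simp: Units_def ring_mat_def)
  \<comment> \<open>The companion form: all rows but the last n are unit rows shifted by n, as
    \<open>C1\<close> shows.\<close>
  define C where "C = K * X * M"
  have Cc: "C \<in> carrier_mat N N" using Kc XA M by (simp add: C_def)
  have KX: "(K * X) $$ (i, j) = K $$ (i + n, j)" if "i + n < N" "j < N" for i j
  proof -
    have "(A * X ^\<^sub>m (i div n)) * X = A * (X ^\<^sub>m (i div n) * X)"
      using XA by (intro assoc_mult_mat) (auto intro!: pow_carrier_mat)
    also have "X ^\<^sub>m (i div n) * X = X ^\<^sub>m ((i + n) div n)" using n by simp
    finally have e: "(A * X ^\<^sub>m (i div n)) * X = A * X ^\<^sub>m ((i + n) div n)" .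
    have c: "A * X ^\<^sub>m (i div n) \<in> carrier_mat n N"
      using XA by (auto intro!: mult_carrier_mat pow_carrier_mat)
    have "(K * X) $$ (i, j) = (\<Sum>l<N. K $$ (i, l) * X $$ (l, j))"
      using that by (intro mat2_entry[OF Kc XA(1)]) auto
    also have "\<dots> = (\<Sum>l<N. (A * X ^\<^sub>m (i div n)) $$ (i mod n, l) * X $$ (l, j))"
      using that by (intro sum.cong refl) (simp add: K_def krylov_def)
    also have "\<dots> = ((A * X ^\<^sub>m (i div n)) * X) $$ (i mod n, j)"
      using that by (intro mat2_entry[OF c XA(1), symmetric] modn) auto
    also have "\<dots> = K $$ (i + n, j)"
      unfolding e using that by (simp add: K_def krylov_def)
    finally show ?thesis .
  qed
  have C1: "C $$ (i, j) = (if j = i + n then 1 else 0)" if "i + n < N" "j < N" for i j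
  proof -
    have KXc: "K * X \<in> carrier_mat N N" using Kc XA by simp
    have "C $$ (i, j) = (\<Sum>l<N. K $$ (i + n, l) * M $$ (l, j))"
      unfolding C_def using that
      by (subst mat2_entry[OF KXc M(1)]) (auto intro!: sum.cong simp: KX simp del: index_mult_mat)
    also have "\<dots> = (K * M) $$ (i + n, j)"
      using that by (intro mat2_entry[OF Kc M(1), symmetric]) auto
    finally show ?thesis using that by (auto simp: M)
  qed
  have AM: "(A * M) $$ (a, j) = (if a = j then 1 else 0)" if "a < n" "j < N" for a j
  proof -
    have "A $$ (a, l) = K $$ (a, l)" if "l < N" for l
      using that \<open>a < n\<close> nN XA by (simp add: K_def krylov_def)
    then have "(A * M) $$ (a, j) = (\<Sum>l<N. K $$ (a, l) * M $$ (l, j))"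
      using that by (subst mat2_entry[OF XA(2) M(1)]) auto
    also have "\<dots> = (K * M) $$ (a, j)"
      using that nN by (intro mat2_entry[OF Kc M(1), symmetric]) auto
    finally show ?thesis using that nN by (simp add: M)
  qed
  \<comment> \<open>The entries of d(tC)d^-1 for d = diag(t^(i div n)), as polynomials in t. In a
    shifted row the factor t cancels against the quotient of the powers; in the last n rows the
    exponent is 1 + i div n - j div n, where the truncated subtraction is exact by
    \<open>divs\<close>.\<close>
  define Cp where "Cp i j = (if i + n < N then [:if j = i + n then 1 else 0:]
      else monom (C $$ (i, j)) (1 + i div n - j div n))" for i j
  have divs: "j div n \<le> 1 + i div n" "L - 1 \<le> i div n" if "\<not> i + n < N" "i < N" "j < N" for i j
  proof -
    show 1: "L - 1 \<le> i div n"
    proof -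
      have "(L - 1) * n \<le> i" using that N L by (cases L) (auto simp: algebra_simps)
      then show ?thesis using n by (simp add: less_eq_div_iff_mult_less_eq)
    qed
    have "j div n \<le> L"
    proof -
      have "j < Suc L * n" using that N r by (simp add: mult.commute)
      then have "j div n < Suc L" using n by (simp add: div_less_iff_less_mult)
      then show ?thesis by simp
    qed
    with 1 show "j div n \<le> 1 + i div n" by simp
  qed
  \<comment> \<open>The values of f along the ray (tX, A); the degree in t is at most D.\<close>
  define P where "P = gev (\<lambda>c. [:c:]) (\<lambda>v. case v of XVar i j \<Rightarrow> [:0, X $$ (i, j):] | AVar a i \<Rightarrow> [:A $$ (a, i):]) f"
  define \<sigma> where "\<sigma> v = (case v of XVar i j \<Rightarrow> Cp i j | AVar a i \<Rightarrow> [:if a = i then 1 else 0 :: complex:])" for v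
  define Q where "Q = gev (\<lambda>c. [:c:]) \<sigma> f"
  define E where "E = (\<Sum>i<N. i div n)"
  have kE: "k * E = ground_deg n k r L"
    unfolding E_def N sum_div[OF n less_imp_le[OF r]] by (simp add: ground_deg_def algebra_simps)
  \<comment> \<open>Covariance under g = dK moves (tX, A) to the rescaled companion form, and
    det(g)^k contributes the power of t.\<close>
  have PQ: "poly P t = (t ^ E * det K) ^ k * poly Q t" if t: "t \<noteq> 0" for t
  proof -
    define d where "d = mat N N (\<lambda>(i, j). if i = j then t ^ (i div n) else 0)"
    define d' where "d' = mat N N (\<lambda>(i, j). if i = j then inverse (t ^ (i div n)) else 0)"
    have dc: "d \<in> carrier_mat N N" "d' \<in> carrier_mat N N" by (auto simp: d_def d'_def)
    have dl: "(d * B) $$ (i, j) = t ^ (i div n) * B $$ (i, j)" if "B \<in> carrier_mat N m" "i < N" "j < m" for B i j m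
    proof -
      have "(d * B) $$ (i, j) = (\<Sum>l<N. if l = i then t ^ (i div n) * B $$ (l, j) else 0)"
        unfolding mat2_entry[OF dc(1) that] using that by (intro sum.cong) (auto simp: d_def)
      then show ?thesis using that by simp
    qed
    have dr: "(B * d') $$ (i, j) = B $$ (i, j) * inverse (t ^ (j div n))" if "B \<in> carrier_mat m N" "i < m" "j < N" for B i j m
    proof -
      have "(B * d') $$ (i, j) = (\<Sum>l<N. if l = j then B $$ (i, l) * inverse (t ^ (j div n)) else 0)"
        unfolding mat2_entry[OF that(1) dc(2) that(2,3)] using that by (intro sum.cong) (auto simp: d'_def)
      then show ?thesis using that by simp
    qed
    have dd: "d * d' = 1\<^sub>m N"
    proof (rule eq_matI)
      fix i j assume "i < dim_row (1\<^sub>m N :: complex mat)" "j < dim_col (1\<^sub>m N :: complex mat)"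
      then have ij: "i < N" "j < N" by auto
      show "(d * d') $$ (i, j) = 1\<^sub>m N $$ (i, j)"
        unfolding dl[OF dc(2) ij] using ij t by (simp add: d'_def)
    qed (use dc in auto)
    have dd': "d' * d = 1\<^sub>m N"
      by (rule mat_mult_left_right_inverse[OF dc dd])
    define g where "g = d * K"
    define h where "h = M * d'"
    have gc: "g \<in> carrier_mat N N" "h \<in> carrier_mat N N" using dc Kc M by (auto simp: g_def h_def)
    have gh: "g * h = 1\<^sub>m N"
    proof -
      have "g * h = d * (K * (M * d'))" unfolding g_def h_def using dc Kc M by (intro assoc_mult_mat) auto
      also have "K * (M * d') = K * M * d'" using dc Kc M by (intro assoc_mult_mat[symmetric]) auto
      finally show ?thesis using dc by (simp add: M dd)
    qed
    have gp: "gl_pair N g h"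
      by unfold_locales (use gc gh mat_mult_left_right_inverse[OF gc gh] in auto)
    have "det d = prod_list (diag_mat d)"
      by (rule det_upper_triangular[OF _ dc(1)]) (auto simp: d_def)
    also have "\<dots> = (\<Prod>i<N. t ^ (i div n))"
    proof -
      have "diag_mat d = map (\<lambda>i. t ^ (i div n)) [0..<N]"
        unfolding diag_mat_def by (auto simp: d_def)
      then show ?thesis
        by (simp add: prod.list_conv_set_nth atLeast0LessThan)
    qed
    also have "\<dots> = t ^ E" by (simp add: E_def power_sum)
    finally have detg: "det g = t ^ E * det K"
      unfolding g_def using dc Kc by (simp add: det_mult)
    define Xt where "Xt = t \<cdot>\<^sub>m X"
    have Xt: "Xt \<in> carrier_mat N N" using XA by (simp add: Xt_def)
    have gXh: "(g * Xt * h) $$ (i, j) = poly (Cp i j) t" if ij: "i < N" "j < N" for i j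
    proof -
      have "g * Xt * h = g * Xt * M * d'"
        unfolding h_def using gc Xt M dc by (intro assoc_mult_mat[symmetric]) auto
      also have "g * Xt * M = d * (K * Xt * M)"
      proof -
        have "g * Xt = d * (K * Xt)" unfolding g_def using dc Kc Xt by (intro assoc_mult_mat) auto
        moreover have "d * (K * Xt) * M = d * (K * Xt * M)"
          using dc Kc Xt M by (intro assoc_mult_mat) auto
        ultimately show ?thesis by simp
      qed
      also have "K * Xt * M = t \<cdot>\<^sub>m C"
        unfolding Xt_def C_def mult_smult_distrib[OF Kc XA(1)]
        by (rule mult_smult_assoc_mat[OF mult_carrier_mat[OF Kc XA(1)] M(1)])
      finally have "(g * Xt * h) $$ (i, j) = t ^ (i div n) * (t * C $$ (i, j)) * inverse (t ^ (j div n))"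
        using ij Cc dc dr[of "d * (t \<cdot>\<^sub>m C)" N i j] dl[of "t \<cdot>\<^sub>m C" N i j]
        by (simp del: index_mult_mat(1))
      also have "\<dots> = poly (Cp i j) t"
      proof (cases "i + n < N")
        case True
        then show ?thesis using ij t n C1[of i j] by (auto simp: Cp_def field_simps)
      next
        case False
        have "t ^ (1 + i div n) = t ^ (1 + i div n - j div n) * t ^ (j div n)"
          using divs(1)[OF False ij] by (simp flip: power_add)
        then have "t ^ (i div n) * t * inverse (t ^ (j div n)) = t ^ (1 + i div n - j div n)"
          using t by (simp add: field_simps)
        then show ?thesis using False by (simp add: Cp_def poly_monom mult_ac)
      qed
      finally show ?thesis .
    qed
    have Ah: "(A * h) $$ (a, i) = (if a = i then 1 else 0)" if "a < n" "i < N" for a i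
    proof -
      have "A * h = A * M * d'" unfolding h_def using XA M dc by (intro assoc_mult_mat[symmetric]) auto
      moreover have "A * M \<in> carrier_mat n N" using XA M by simp
      ultimately have "(A * h) $$ (a, i) = (A * M) $$ (a, i) * inverse (t ^ (i div n))"
        using that by (simp add: dr[of _ n] del: index_mult_mat(1))
      then show ?thesis using that AM by auto
    qed
    have "poly Q t = peval (mat_assign (g * Xt * h) (A * h)) f"
      unfolding Q_def poly_gev
    proof (rule peval.gev_cong[OF R])
      fix v assume "v \<in> vars n N"
      then show "poly (\<sigma> v) t = mat_assign (g * Xt * h) (A * h) v"
        by (cases v) (auto simp: \<sigma>_def mat_assign_def XVar_in_vars AVar_in_vars gXh Ah simp del: index_mult_mat(1))
    qed
    also have "\<dots> = inverse (t ^ E * det K) ^ k * peval (mat_assign Xt A) f"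
      using Hspace_covariant[OF f(1) Xt XA(2) gp] by (simp add: detg)
    also have "peval (mat_assign Xt A) f = poly P t"
      unfolding P_def poly_gev
    proof (rule peval.gev_cong[OF R, symmetric])
      fix v assume "v \<in> vars n N"
      then show "poly (case v of XVar i j \<Rightarrow> [:0, X $$ (i, j):] | AVar a i \<Rightarrow> [:A $$ (a, i):]) t = mat_assign Xt A v"
        using XA by (cases v) (auto simp: mat_assign_def Xt_def XVar_in_vars)
    qed
    finally show ?thesis using t det unfolding K_def[symmetric] by (simp add: power_inverse field_simps)
  qed
  \<comment> \<open>The additional power of t dividing Q: none below the ground degree, and L when
    the restriction of f vanishes.\<close>
  define m where "m = (if D < ground_deg n k r L then 0 else L)"
  have Qdvd: "monom 1 m dvd Q"
  proof (cases "D < ground_deg n k r L")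
    case False
    then have m: "m = L" and r0: "restr n f = 0" using D by (auto simp: m_def)
    \<comment> \<open>The companion form without its first n columns. These columns vanish modulo
      t^L, so Q is congruent to the value of the restriction of f at \<tau>, which is 0.\<close>
    define \<tau> where "\<tau> v = (case v of XVar i j \<Rightarrow> Cp (n + i) (n + j) | AVar \<beta> j \<Rightarrow> Cp \<beta> (n + j))" for v
    have "monom 1 L dvd gev (\<lambda>c. [:c:]) \<sigma> f - gev (\<lambda>c. [:c:]) (\<lambda>v. gev (\<lambda>c. [:c:]) \<tau> (restr_subst n v)) f"
    proof (rule gev_dvd_diff[OF poly_const.coefficient_hom_axioms R])
      fix v assume v: "v \<in> vars n N"
      show "monom 1 L dvd \<sigma> v - gev (\<lambda>c. [:c:]) \<tau> (restr_subst n v)"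
      proof (cases v)
        case (XVar i j)
        with v have ij: "i < N" "j < N" by (auto simp: XVar_in_vars)
        show ?thesis
        proof (cases "j < n")
          case True
          have "monom 1 L dvd Cp i j"
          proof (cases "i + n < N")
            case False
            then have "L \<le> 1 + i div n - j div n" using divs(2)[OF False ij] True L by simp
            then show ?thesis using False by (simp add: Cp_def monom_1_dvd_iff')
          qed (use True in \<open>simp add: Cp_def\<close>)
          then show ?thesis using True by (simp add: XVar \<sigma>_def restr_subst_def)
        next
          case False
          then show ?thesis by (simp add: XVar \<sigma>_def restr_subst_def \<tau>_def)
        qed
      next
        case (AVar a j)
        with v have "a < n" by (auto simp: AVar_in_vars)
        then show ?thesis by (simp add: AVar \<sigma>_def restr_subst_def one_pCons)
      qed
    qed
    moreover have "gev (\<lambda>c. [:c:]) (\<lambda>v. gev (\<lambda>c. [:c:]) \<tau> (restr_subst n v)) f = 0"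
      using gev_subst[OF poly_const.coefficient_hom_axioms, of \<tau> "restr_subst n" f] r0
      unfolding restr_def by simp
    ultimately show ?thesis by (simp add: m Q_def)
  qed (simp add: m_def)
  have "P = monom 1 (E * k) * ([:det K ^ k:] * Q)"
    by (rule poly_eqI_nonzero) (simp add: PQ poly_monom power_mult_distrib power_mult)
  moreover have "monom 1 (E * k + m) = monom 1 (E * k) * (monom 1 m :: complex poly)"
    by (simp add: mult_monom)
  moreover have "monom 1 (E * k) * monom 1 m dvd monom 1 (E * k) * ([:det K ^ k:] * Q)"
    using Qdvd by (intro mult_dvd_mono dvd_refl dvd_mult)
  ultimately have dvd: "monom 1 (E * k + m) dvd P" by simp
  \<comment> \<open>t^(kE + m) divides P, whereas the degree of P is at most D < kE + m.\<close>
  have "P = 0"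
  proof (rule ccontr)
    assume "P \<noteq> 0"
    then have "E * k + m \<le> degree P" using dvd_imp_degree_le[OF dvd] by (simp add: degree_monom_eq)
    also have "degree P \<le> D"
      unfolding P_def by (rule degree_gev_le[OF f(2)]) (simp add: var_xdeg_def split: var.split)
    finally show False using D kE by (auto simp: m_def mult.commute split: if_splits)
  qed
  then have "0 = poly P 1" by simp
  also have "\<dots> = peval (mat_assign X A) f"
    unfolding P_def poly_gev
    by (rule peval.gev_cong[OF R]) (auto simp: mat_assign_def split: var.split)
  finally show ?thesis by simp
qed

text \<open>Pairs with invertible Krylov matrix are dense: on the line from any point to a pair with
  Krylov matrix 1, the determinant is a nonzero polynomial in t. Its product with f vanishes along
  the whole line, and \<open>complex poly\<close> has no zero divisors.\<close>

lemma peval_eq_0_if_krylov: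
  assumes n: "0 < n" and f: "f \<in> poly_ring (vars n N)"
    and z: "\<And>X A. X \<in> carrier_mat N N \<Longrightarrow> A \<in> carrier_mat n N \<Longrightarrow> det (krylov n N X A) \<noteq> 0
      \<Longrightarrow> peval (mat_assign X A) f = 0"
  shows "f = 0"
proof (rule peval_eq_0_imp)
  fix \<rho> :: "var \<Rightarrow> complex"
  \<comment> \<open>The shift by n; together with the first n unit rows in \<open>B\<close> it has
    the identity as its Krylov matrix.\<close>
  define S where "S = mat N N (\<lambda>(i, j). if j = i + n then 1 else 0 :: complex)"
  define B where "B = mat n N (\<lambda>(a, j). if a = j then 1 else 0 :: complex)"
  have SB: "S \<in> carrier_mat N N" "B \<in> carrier_mat n N" by (auto simp: S_def B_def)
  have BS: "(B * S ^\<^sub>m s) $$ (a, j) = (if j = a + s * n then 1 else 0)" if "a + s * n < N" "a < n" "j < N" for a s j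
    using that
  proof (induction s arbitrary: j)
    case 0
    then show ?case using SB by (auto simp: B_def)
  next
    case (Suc s)
    have c: "B * S ^\<^sub>m s \<in> carrier_mat n N" using SB by (auto intro!: mult_carrier_mat pow_carrier_mat)
    have "B * S ^\<^sub>m Suc s = (B * S ^\<^sub>m s) * S"
      using SB by (simp, intro assoc_mult_mat[symmetric]) (auto intro!: pow_carrier_mat)
    then have "(B * S ^\<^sub>m Suc s) $$ (a, j) = (\<Sum>l<N. (B * S ^\<^sub>m s) $$ (a, l) * S $$ (l, j))"
      using mat2_entry[OF c SB(1) Suc.prems(2,3)] by simp
    also have "\<dots> = (\<Sum>l<N. if l = a + s * n then S $$ (l, j) else 0)"
      using Suc by (intro sum.cong) auto
    finally show ?case using Suc.prems by (auto simp: S_def)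
  qed
  have KSB: "krylov n N S B = 1\<^sub>m N"
  proof (rule eq_matI)
    fix i j assume "i < dim_row (1\<^sub>m N :: complex mat)" "j < dim_col (1\<^sub>m N :: complex mat)"
    then show "krylov n N S B $$ (i, j) = 1\<^sub>m N $$ (i, j)"
      using BS[of "i mod n" "i div n" j] n by (auto simp: krylov_def)
  qed (auto simp: krylov_def)
  \<comment> \<open>The line that starts at the given point for t = 0 and reaches (S, B) for t =
    1.\<close>
  define Xp where "Xp = mat N N (\<lambda>(i, j). [:\<rho> (XVar i j), S $$ (i, j) - \<rho> (XVar i j):])"
  define Ap where "Ap = mat n N (\<lambda>(a, j). [:\<rho> (AVar a j), B $$ (a, j) - \<rho> (AVar a j):])"
  have pc: "Xp \<in> carrier_mat N N" "Ap \<in> carrier_mat n N" by (auto simp: Xp_def Ap_def)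
  define ev where "ev t = map_mat (\<lambda>p. poly p t)" for t :: complex
  have evK: "det (krylov n N (ev t Xp) (ev t Ap)) = poly (det (krylov n N Xp Ap)) t" for t
  proof -
    interpret ev: comm_ring_hom "\<lambda>p. poly p t" by unfold_locales auto
    have "krylov n N (ev t Xp) (ev t Ap) = ev t (krylov n N Xp Ap)"
    proof (rule eq_matI)
      fix i j assume "i < dim_row (ev t (krylov n N Xp Ap))" "j < dim_col (ev t (krylov n N Xp Ap))"
      then have ij: "i < N" "j < N" by (auto simp: ev_def krylov_def)
      have "ev t Ap * ev t Xp ^\<^sub>m (i div n) = ev t (Ap * Xp ^\<^sub>m (i div n))"
        unfolding ev_def ev.mat_hom_mult[OF pc(2) pow_carrier_mat[OF pc(1)]] ev.mat_hom_pow[OF pc(1)] ..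
      moreover have "i mod n < n" using n by simp
      ultimately show "krylov n N (ev t Xp) (ev t Ap) $$ (i, j) = ev t (krylov n N Xp Ap) $$ (i, j)"
        using ij pc by (simp add: krylov_def ev_def del: index_mult_mat(1))
    qed (auto simp: ev_def krylov_def)
    then show ?thesis by (simp add: ev_def)
  qed
  have ev1: "ev 1 Xp = S" "ev 1 Ap = B"
    by (auto simp: ev_def Xp_def Ap_def S_def B_def)
  have nz: "det (krylov n N Xp Ap) \<noteq> 0"
    using evK[of 1] by (auto simp: ev1 KSB)
  define F where "F = gev (\<lambda>c. [:c:]) (\<lambda>v. case v of XVar i j \<Rightarrow> Xp $$ (i, j) | AVar a i \<Rightarrow> Ap $$ (a, i)) f"
  have F: "poly F t = peval (mat_assign (ev t Xp) (ev t Ap)) f" for t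
    unfolding F_def poly_gev
    by (rule peval.gev_cong[OF f])
      (auto simp: mat_assign_def ev_def Xp_def Ap_def XVar_in_vars AVar_in_vars split: var.split)
  have "poly (F * det (krylov n N Xp Ap)) t = 0" for t
  proof (cases "poly (det (krylov n N Xp Ap)) t = 0")
    case False
    have "peval (mat_assign (ev t Xp) (ev t Ap)) f = 0"
      by (rule z) (use pc False in \<open>auto simp: ev_def evK[unfolded ev_def]\<close>)
    then show ?thesis by (simp add: F)
  qed simp
  then have "F * det (krylov n N Xp Ap) = 0" using poly_all_0_iff_0 by blast
  then have "F = 0" using nz by simp
  then have "0 = poly F 0" by simp
  also have "\<dots> = peval \<rho> f"
    unfolding F_def poly_gev
    by (rule peval.gev_cong[OF f])
      (auto simp: Xp_def Ap_def XVar_in_vars AVar_in_vars split: var.split)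
  finally show "peval \<rho> f = 0" by simp
qed

text \<open>The two alternatives serve different purposes: e < 0 says that nothing lies below the
  ground degree and starts the induction on degrees in \<open>XS_bound\<close>; the other is
  injectivity of the restriction in degrees below L.\<close>

lemma HH_eq_0:
  assumes nrL: "0 < n" "r < n" "1 \<le> L" and f: "f \<in> HH n k r L e"
    and e: "e < 0 \<or> e < int L \<and> restr n f = 0"
  shows "f = 0"
proof (cases "int (ground_deg n k r L) + e < 0")
  case True
  then have "Poly_Mapping.keys f = {}"
    using f by (fastforce simp: HH_def deg_le_def)
  then show ?thesis by simp
next
  case False
  define D where "D = nat (int (ground_deg n k r L) + e)"
  have "f \<in> deg_le xdeg (int D)" using f False by (simp add: HH_def D_def)
  moreover have "D < ground_deg n k r L \<or> D < ground_deg n k r L + L \<and> restr n f = 0"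
    using e False unfolding D_def by auto
  ultimately show ?thesis
    using Hspace_eval_0_if_krylov[OF nrL refl HH_Hspace[OF f]]
    by (intro peval_eq_0_if_krylov[OF nrL(1) Hspace_poly_ring[OF HH_Hspace[OF f]]]) blast
qed

section \<open>Uniform bounds\<close>

lemma kdelta_commute: "kdelta a b = kdelta b a"
  by (simp add: kdelta_def)

lemma cnj_kdelta [simp]: "cnj (kdelta a b) = kdelta a b"
  by (simp add: kdelta_def)

lemma ip_diff_left: "ip (f - g) h = ip f h - ip g h"
  using fock_formula_add[of "f - g" g h] by simp

lemma ip_diff_right: "ip h (f - g) = ip h f - ip h g"
  using ip_add_right[of h "f - g" g] by simp

section \<open>Sequences of operators bounded uniformly in L\<close>

locale covariants =
  fixes n k r :: nat
  assumes n_pos: "0 < n" and r_less: "r < n"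
begin

abbreviation HL where "HL L e \<equiv> HH n k r L e"
abbreviation NL where "NL L \<equiv> n * L + r"

text \<open>s is the shift of degree and h the order in 1/L; C may depend on e but not on L.
  Membership of the image is included so that bounds compose: the outer operator is estimated on the
  degrees that the inner one reaches.\<close>

definition bnd :: "int \<Rightarrow> nat \<Rightarrow> (nat \<Rightarrow> cpoly \<Rightarrow> cpoly) \<Rightarrow> bool" where
  "bnd s h T \<longleftrightarrow> (\<forall>e. \<exists>C\<ge>0. \<forall>L\<ge>1. \<forall>v\<in>HL L e.
     T L v \<in> HL L (e + s) \<and> fock_norm (T L v) \<le> C / real L ^ h * fock_norm v)"

lemma bndE:
  assumes "bnd s h T"
  obtains C where "C \<ge> 0" "\<And>L v. 1 \<le> L \<Longrightarrow> v \<in> HL L e \<Longrightarrow> T L v \<in> HL L (e + s)"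
    "\<And>L v. 1 \<le> L \<Longrightarrow> v \<in> HL L e \<Longrightarrow> fock_norm (T L v) \<le> C / real L ^ h * fock_norm v"
  using assms unfolding bnd_def by metis

lemma bnd_mem: "bnd s h T \<Longrightarrow> 1 \<le> L \<Longrightarrow> v \<in> HL L e \<Longrightarrow> T L v \<in> HL L (e + s)"
  by (metis bndE)

lemma bndI:
  assumes "\<And>L v e. 1 \<le> L \<Longrightarrow> v \<in> HL L e \<Longrightarrow> T L v \<in> HL L (e + s)"
    and "\<And>e. \<exists>C. \<forall>L\<ge>1. \<forall>v\<in>HL L e. fock_norm (T L v) \<le> C / real L ^ h * fock_norm v"
  shows "bnd s h T"
  unfolding bnd_def
proof
  fix e
  obtain C where C: "\<And>L v. 1 \<le> L \<Longrightarrow> v \<in> HL L e \<Longrightarrow> fock_norm (T L v) \<le> C / real L ^ h * fock_norm v"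
    using assms(2)[of e] by blast
  have "fock_norm (T L v) \<le> max C 0 / real L ^ h * fock_norm v" if "1 \<le> L" "v \<in> HL L e" for L v
    using C[OF that] by (rule order_trans) (intro mult_right_mono divide_right_mono, auto)
  then show "\<exists>C\<ge>0. \<forall>L\<ge>1. \<forall>v\<in>HL L e.
     T L v \<in> HL L (e + s) \<and> fock_norm (T L v) \<le> C / real L ^ h * fock_norm v"
    using assms(1) by (intro exI[of _ "max C 0"]) auto
qed

lemma bnd_add:
  assumes "bnd s h S" "bnd s h T"
  shows "bnd s h (\<lambda>L v. S L v + T L v)"
proof (rule bndI)
  fix e
  obtain C D where C: "\<And>L v. 1 \<le> L \<Longrightarrow> v \<in> HL L e \<Longrightarrow> fock_norm (S L v) \<le> C / real L ^ h * fock_norm v"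
    "\<And>L v. 1 \<le> L \<Longrightarrow> v \<in> HL L e \<Longrightarrow> fock_norm (T L v) \<le> D / real L ^ h * fock_norm v"
    by (metis bndE assms)
  have "fock_norm (S L v + T L v) \<le> (C + D) / real L ^ h * fock_norm v" if "1 \<le> L" "v \<in> HL L e" for L v
    using fock_norm_triangle[of "S L v" "T L v"] C[OF that] by (simp add: add_divide_distrib distrib_right)
  then show "\<exists>C. \<forall>L\<ge>1. \<forall>v\<in>HL L e. fock_norm (S L v + T L v) \<le> C / real L ^ h * fock_norm v" by blast
qed (intro HH_add bnd_mem[OF assms(1)] bnd_mem[OF assms(2)])

lemma bnd_scale:
  assumes "bnd s h T" "\<And>L. 1 \<le> L \<Longrightarrow> cmod (c L) \<le> B / real L ^ g"
  shows "bnd s (g + h) (\<lambda>L v. Const (c L) * T L v)"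
proof (rule bndI)
  fix e
  obtain C where C: "C \<ge> 0" "\<And>L v. 1 \<le> L \<Longrightarrow> v \<in> HL L e \<Longrightarrow> fock_norm (T L v) \<le> C / real L ^ h * fock_norm v"
    by (metis bndE assms(1))
  have "fock_norm (Const (c L) * T L v) \<le> (B * C) / real L ^ (g + h) * fock_norm v" if "1 \<le> L" "v \<in> HL L e" for L v
  proof -
    have "fock_norm (Const (c L) * T L v) \<le> (B / real L ^ g) * (C / real L ^ h * fock_norm v)"
      unfolding fock_norm_scale using assms(2)[OF that(1)] C(2)[OF that]
      by (rule mult_mono) (auto intro: order_trans[OF norm_ge_zero assms(2)[OF that(1)]])
    then show ?thesis by (simp add: power_add)
  qed
  then show "\<exists>C. \<forall>L\<ge>1. \<forall>v\<in>HL L e. fock_norm (Const (c L) * T L v) \<le> C / real L ^ (g + h) * fock_norm v" by blast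
qed (intro HH_scale bnd_mem[OF assms(1)])

lemma bnd_scale_const: "bnd s h T \<Longrightarrow> bnd s h (\<lambda>L v. Const c * T L v)"
  using bnd_scale[of s h T "\<lambda>_. c" "cmod c" 0] by simp

lemma bnd_uminus: "bnd s h T \<Longrightarrow> bnd s h (\<lambda>L v. - T L v)"
  using bnd_scale_const[of s h T "- 1"] by (simp add: Const_uminus)

lemma bnd_diff: "bnd s h S \<Longrightarrow> bnd s h T \<Longrightarrow> bnd s h (\<lambda>L v. S L v - T L v)"
  using bnd_add[of s h S "\<lambda>L v. - T L v"] bnd_uminus[of s h T] by simp

lemma bnd_comp:
  assumes "bnd s h S" "bnd t g T"
  shows "bnd (t + s) (h + g) (\<lambda>L v. S L (T L v))"
proof (rule bndI)
  fix e
  obtain C where C: "C \<ge> 0" "\<And>L v. 1 \<le> L \<Longrightarrow> v \<in> HL L (e + t) \<Longrightarrow> fock_norm (S L v) \<le> C / real L ^ h * fock_norm v"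
    by (metis bndE assms(1))
  obtain D where D: "\<And>L v. 1 \<le> L \<Longrightarrow> v \<in> HL L e \<Longrightarrow> T L v \<in> HL L (e + t)"
    "\<And>L v. 1 \<le> L \<Longrightarrow> v \<in> HL L e \<Longrightarrow> fock_norm (T L v) \<le> D / real L ^ g * fock_norm v"
    by (metis bndE assms(2))
  have "fock_norm (S L (T L v)) \<le> (C * D) / real L ^ (h + g) * fock_norm v" if "1 \<le> L" "v \<in> HL L e" for L v
  proof -
    have "fock_norm (S L (T L v)) \<le> C / real L ^ h * (D / real L ^ g * fock_norm v)"
      using C(2)[OF that(1) D(1)[OF that]] D(2)[OF that] C(1)
      by (meson order_trans mult_left_mono divide_nonneg_nonneg zero_le_power of_nat_0_le_iff)
    then show ?thesis by (simp add: power_add)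
  qed
  then show "\<exists>C. \<forall>L\<ge>1. \<forall>v\<in>HL L e. fock_norm (S L (T L v)) \<le> C / real L ^ (h + g) * fock_norm v" by blast
next
  fix L v e assume "1 \<le> L" "v \<in> HL L e"
  then show "S L (T L v) \<in> HL L (e + (t + s))"
    using bnd_mem[OF assms(1) _ bnd_mem[OF assms(2)]] by (simp add: add.assoc)
qed

lemma bnd_0: "bnd s h (\<lambda>L v. 0)"
  by (rule bndI) (auto simp: HH_def Htilde_def Hspace_0 intro!: exI[of _ 0])

lemma bnd_id: "bnd 0 0 (\<lambda>L v. v)"
  by (rule bndI) (auto intro!: exI[of _ 1])

lemma bnd_sum: "(\<And>x. x \<in> S \<Longrightarrow> bnd s h (T x)) \<Longrightarrow> bnd s h (\<lambda>L v. \<Sum>x\<in>S. T x L v)"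
  by (induction S rule: infinite_finite_induct) (auto intro: bnd_0 bnd_add)

lemma bnd_cong:
  assumes "bnd s h S" "\<And>L v. 1 \<le> L \<Longrightarrow> v \<in> Hspace n k (NL L) \<Longrightarrow> T L v = S L v"
  shows "bnd s h T"
  using assms unfolding bnd_def by (metis HH_Hspace)

subsection \<open>Operators compatible with the restriction\<close>

text \<open>Since the restriction is injective in degrees below \<open>L\<close>, the recurrence satisfied by the powers
  of \<open>S\<^sup>\<dagger>S\<close> for one value of \<open>L\<close> holds for all larger ones, and bounds the norm uniformly.\<close>

lemma bnd_if_intertwined:
  assumes inv: "\<And>L v e. 1 \<le> L \<Longrightarrow> v \<in> HL L e \<Longrightarrow> S L v \<in> HL L e"
    "\<And>L v e. 1 \<le> L \<Longrightarrow> v \<in> HL L e \<Longrightarrow> S' L v \<in> HL L e"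
    and lin: "\<And>L. linear_op (S L)" "\<And>L. linear_op (S' L)"
    and adj: "\<And>L u v. ip (S L u) v = ip u (S' L v)"
    and res: "\<And>L v. v \<in> Hspace n k (NL (Suc L)) \<Longrightarrow> restr n (S (Suc L) v) = S L (restr n v)"
    "\<And>L v. v \<in> Hspace n k (NL (Suc L)) \<Longrightarrow> restr n (S' (Suc L) v) = S' L (restr n v)"
  shows "bnd 0 0 S"
proof (rule bndI)
  fix e :: int
  \<comment> \<open>S itself may fail to be Hermitian; S'S is Hermitian, and <S'Sv, v> = |Sv|^2
    transfers its bound back to S.\<close>
  define T where "T L v = S' L (S L v)" for L v
  have adj': "ip (S' L u) v = ip u (S L v)" for L u v
    unfolding fock_formula_herm[of "S' L u"] fock_formula_herm[of u] adj ..
  have herm: "ip (T L u) v = ip u (T L v)" for L u v by (simp only: T_def adj adj')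
  have linT: "linear_op (T L)" for L unfolding T_def by (rule linear_op_comp[OF lin(2) lin(1)])
  have invT: "T L v \<in> HL L e" if "1 \<le> L" "v \<in> HL L e" for L v
    using that by (simp add: T_def inv)
  have powT: "(T L ^^ j) v \<in> HL L e" if "1 \<le> L" "v \<in> HL L e" for L v j
    by (induction j) (auto intro: that invT)
  have resT: "restr n (T (Suc L) v) = T L (restr n v)" if "1 \<le> L" "v \<in> HL (Suc L) e" for L v
  proof -
    have "S (Suc L) v \<in> HL (Suc L) e" using that by (intro inv) auto
    then show ?thesis unfolding T_def by (simp only: res(2)[OF HH_Hspace] res(1)[OF HH_Hspace[OF that(2)]])
  qed
  have respow: "restr n ((T (Suc L) ^^ j) v) = (T L ^^ j) (restr n v)" if "1 \<le> L" "v \<in> HL (Suc L) e" for L v j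
    using resT[OF that(1) powT[OF _ that(2)]] by (induction j) simp_all
  define rec where "rec L m c \<longleftrightarrow> (\<forall>v\<in>HL L e. (T L ^^ m) v = (\<Sum>i<m. Const (c i) * (T L ^^ i) v))"
    for L m and c :: "nat \<Rightarrow> complex"
  have bound: "fock_norm (T L v) \<le> (1 + (\<Sum>i<m. cmod (c i))) * fock_norm v"
    if "1 \<le> L" "rec L m c" "v \<in> HL L e" for L m c v
    by (rule hermitian_norm_bound[where S = "HL L e"]) (use that invT herm in \<open>auto simp: rec_def\<close>)
  have ex: "\<exists>m c. rec L m c" if L: "1 \<le> L" for L
  proof -
    obtain K where K: "finite K" "\<And>f. f \<in> HL L e \<Longrightarrow> Poly_Mapping.keys f \<subseteq> K"
      by (rule HH_keys_finite[of n k r L e]) blast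
    show ?thesis
      by (rule operator_recurrence[OF HH_subspace K invT[OF L] linear_opD(1)[OF linT] linear_opD(2)[OF linT]])
        (auto simp: rec_def)
  qed
  \<comment> \<open>The recurrence for L makes the restriction of the difference of both sides
    vanish, and e < L + 1 makes the restriction injective. The coefficients are taken over
    unchanged.\<close>
  have rec_Suc: "rec (Suc L) m c" if L: "1 \<le> L" "e < int (Suc L)" and rc: "rec L m c" for L m c
    unfolding rec_def
  proof
    fix v assume v: "v \<in> HL (Suc L) e"
    let ?w = "(T (Suc L) ^^ m) v - (\<Sum>i<m. Const (c i) * (T (Suc L) ^^ i) v)"
    have "?w \<in> HL (Suc L) e"
      using v by (intro HH_diff HH_sum HH_scale powT) auto
    moreover have "restr n ?w = 0"
      using rc restr_HH[OF v] L v unfolding rec_def by (simp add: restr_hom respow)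
    ultimately have "?w = 0"
      using HH_eq_0[OF n_pos r_less, of "Suc L" ?w k e] L by simp
    then show "(T (Suc L) ^^ m) v = (\<Sum>i<m. Const (c i) * (T (Suc L) ^^ i) v)" by simp
  qed
  \<comment> \<open>From here on e < L + 1 holds in each step, so one recurrence serves all L \<ge>
    L0. The finitely many smaller L have recurrences of their own, and \<open>B\<close> collects all
    the bounds.\<close>
  define L0 where "L0 = nat (max 1 e)"
  have L0: "1 \<le> L0" by (simp add: L0_def)
  obtain m c where mc: "rec L0 m c" using ex[OF L0] by blast
  have rec: "rec L m c" if "L0 \<le> L" for L
    using that
  proof (induction L rule: dec_induct)
    case (step L)
    have "1 \<le> L" "e < int (Suc L)" using step(1) L0 by (auto simp: L0_def)
    then show ?case using step.IH by (rule rec_Suc)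
  qed (rule mc)
  obtain M d where Md: "\<And>L. 1 \<le> L \<Longrightarrow> rec L (M L) (d L)" using ex by metis
  define B where "B = (\<Sum>L<L0. 1 + (\<Sum>i<M L. cmod (d L i))) + (1 + (\<Sum>i<m. cmod (c i)))"
  have nonneg: "0 \<le> 1 + (\<Sum>i\<in>I. cmod (x i))" for I :: "nat set" and x :: "nat \<Rightarrow> complex"
    by (simp add: add_nonneg_nonneg sum_nonneg)
  have T_bound: "fock_norm (T L v) \<le> B * fock_norm v" if L: "1 \<le> L" and v: "v \<in> HL L e" for L v
  proof (cases "L0 \<le> L")
    case True
    have "fock_norm (T L v) \<le> (1 + (\<Sum>i<m. cmod (c i))) * fock_norm v"
      by (rule bound[OF L rec[OF True] v])
    also have "\<dots> \<le> B * fock_norm v"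
      unfolding B_def by (intro mult_right_mono) (auto simp: add_nonneg_nonneg sum_nonneg)
    finally show ?thesis .
  next
    case False
    have "1 + (\<Sum>i<M L. cmod (d L i)) \<le> (\<Sum>L<L0. 1 + (\<Sum>i<M L. cmod (d L i)))"
      using False by (intro member_le_sum[of L _ "\<lambda>L. 1 + (\<Sum>i<M L. cmod (d L i))"] nonneg) auto
    then have "1 + (\<Sum>i<M L. cmod (d L i)) \<le> B"
      unfolding B_def using nonneg[of c "{..<m}"] by linarith
    then have "(1 + (\<Sum>i<M L. cmod (d L i))) * fock_norm v \<le> B * fock_norm v"
      by (intro mult_right_mono) auto
    with bound[OF L Md[OF L] v] show ?thesis by linarith
  qed
  have "fock_norm (S L v) \<le> sqrt B * fock_norm v" if L: "1 \<le> L" and v: "v \<in> HL L e" for L v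
  proof -
    have "(fock_norm (S L v))\<^sup>2 = cmod (ip (S L v) (S L v))"
      unfolding ip_self by (simp add: norm_power)
    also have "\<dots> = cmod (ip (T L v) v)" by (simp only: T_def adj')
    also have "\<dots> \<le> fock_norm (T L v) * fock_norm v" by (rule ip_Cauchy_Schwarz)
    also have "\<dots> \<le> B * fock_norm v * fock_norm v"
      by (intro mult_right_mono T_bound L v) simp
    finally have "(fock_norm (S L v))\<^sup>2 \<le> B * (fock_norm v)\<^sup>2" by (simp add: power2_eq_square)
    then have "sqrt ((fock_norm (S L v))\<^sup>2) \<le> sqrt (B * (fock_norm v)\<^sup>2)" by (rule real_sqrt_le_mono)
    then show ?thesis by (simp add: real_sqrt_mult)
  qed
  then show "\<exists>C. \<forall>L\<ge>1. \<forall>v\<in>HL L e. fock_norm (S L v) \<le> C / real L ^ 0 * fock_norm v" by auto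
qed (simp add: inv)

text \<open>The subtracted terms are the leading terms of \<open>W1\<close> and \<open>WXY\<close> for large \<open>L\<close>.\<close>

definition U :: "nat \<Rightarrow> nat \<Rightarrow> nat \<Rightarrow> cpoly \<Rightarrow> cpoly" where
  "U a b L v = W1 (NL L) a b v - Const (of_nat (k * L) * kdelta a b) * v"

definition V :: "nat \<Rightarrow> nat \<Rightarrow> nat \<Rightarrow> cpoly \<Rightarrow> cpoly" where
  "V a b L v = WXY (NL L) a b v - Const (of_nat ((2 * k + n) * L)) * W1 (NL L) a b v
     + Const (of_nat ((2 * k + n) * k) * of_nat (L * Suc L) / 2 * kdelta a b) * v"

lemma linear_op_UV: "linear_op (U a b L)" "linear_op (V a b L)"
  unfolding U_def V_def by (intro linear_op_intros linear_op_W)+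

lemma ip_U: "ip (U a b L f) g = ip f (U b a L g)"
  using fock_formula_add[of "U a b L f" "Const (of_nat (k * L) * kdelta a b) * f" g]
    ip_add_right[of f "U b a L g" "Const (of_nat (k * L) * kdelta a b) * g"]
  by (simp add: U_def kdelta_commute[of b a] ip_W1 fock_formula_scale ip_scale_right del: of_nat_mult)

lemma ip_V: "ip (V a b L f) g = ip f (V b a L g)"
  by (simp add: V_def kdelta_commute[of b a] ip_W1 ip_WXY fock_formula_scale ip_scale_right
      fock_formula_add ip_add_right ip_diff_left ip_diff_right)

lemma NL_Suc: "NL (Suc L) = n + NL L"
  by simp

lemma restr_U:
  assumes v: "v \<in> Hspace n k (NL (Suc L))" and ab: "a < n" "b < n"
  shows "restr n (U a b (Suc L) v) = U a b L (restr n v)"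
proof -
  let ?w = "restr n v"
  have "restr n (U a b (Suc L) v) = W1 (NL L) a b ?w + Const (of_nat k * kdelta a b) * ?w
      - Const (of_nat (k * Suc L) * kdelta a b) * ?w"
    using restr_W1[OF v[unfolded NL_Suc] ab]
    unfolding U_def NL_Suc restr_hom by (simp add: kdelta_def)
  also have "\<dots> = U a b L ?w"
    unfolding U_def mult_Suc_right of_nat_add distrib_right Const_add by simp
  finally show ?thesis .
qed

text \<open>Each enlargement adds 2k + n times \<open>W1\<close> to \<open>WXY\<close>, which the
  term linear in L absorbs. As \<open>W1\<close> itself gains k \<delta>^a_b, a constant (2k + n)k(L
  + 1) \<delta>^a_b is left over; these constants sum to the quadratic term (2k + n)k L(L +
  1)/2.\<close>

lemma restr_V:
  assumes v: "v \<in> Hspace n k (NL (Suc L))" and ab: "a < n" "b < n"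
  shows "restr n (V a b (Suc L) v) = V a b L (restr n v)"
proof -
  let ?w = "restr n v"
  let ?q = "\<lambda>L. of_nat ((2 * k + n) * k) * of_nat (L * Suc L) / 2 :: complex"
  have q: "?q (Suc L) = ?q L + of_nat ((2 * k + n) * Suc L) * of_nat k"
    by (simp add: field_simps)
  have "restr n (V a b (Suc L) v) = WXY (NL L) a b ?w + Const (of_nat (2 * k + n)) * W1 (NL L) a b ?w
      - Const (of_nat ((2 * k + n) * Suc L)) * (W1 (NL L) a b ?w + Const (of_nat k * kdelta a b) * ?w)
      + Const (?q (Suc L) * kdelta a b) * ?w"
    using restr_W1[OF v[unfolded NL_Suc] ab] restr_WXY[OF v[unfolded NL_Suc] ab]
    unfolding V_def NL_Suc restr_hom by (simp add: kdelta_def Const_of_nat[symmetric])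
  also have "\<dots> = V a b L ?w"
    unfolding q V_def by (simp add: Const_add Const_mult Const_of_nat algebra_simps)
  finally show ?thesis .
qed

lemma HL_U: "v \<in> HL L e \<Longrightarrow> a < n \<Longrightarrow> b < n \<Longrightarrow> U a b L v \<in> HL L e"
  and HL_V: "v \<in> HL L e \<Longrightarrow> a < n \<Longrightarrow> b < n \<Longrightarrow> V a b L v \<in> HL L e"
  unfolding U_def V_def by (simp_all add: HH_add HH_diff HH_scale HH_W)

lemma bnd_U:
  assumes ab: "a < n" "b < n"
  shows "bnd 0 0 (U a b)"
proof (rule bnd_if_intertwined[where S = "U a b" and S' = "U b a"])
  fix L v e assume v: "v \<in> HL L e"
  show "U a b L v \<in> HL L e" "U b a L v \<in> HL L e" by (rule HL_U[OF v], rule ab, rule ab)+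
next
  fix L show "linear_op (U a b L)" "linear_op (U b a L)" by (rule linear_op_UV)+
next
  fix L u v show "ip (U a b L u) v = ip u (U b a L v)" by (rule ip_U)
next
  fix L v assume v: "v \<in> Hspace n k (NL (Suc L))"
  show "restr n (U a b (Suc L) v) = U a b L (restr n v)"
    "restr n (U b a (Suc L) v) = U b a L (restr n v)"
    by (rule restr_U[OF v], rule ab, rule ab)+
qed

lemma bnd_V:
  assumes ab: "a < n" "b < n"
  shows "bnd 0 0 (V a b)"
proof (rule bnd_if_intertwined[where S = "V a b" and S' = "V b a"])
  fix L v e assume v: "v \<in> HL L e"
  show "V a b L v \<in> HL L e" "V b a L v \<in> HL L e" by (rule HL_V[OF v], rule ab, rule ab)+
next
  fix L show "linear_op (V a b L)" "linear_op (V b a L)" by (rule linear_op_UV)+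
next
  fix L u v show "ip (V a b L u) v = ip u (V b a L v)" by (rule ip_V)
next
  fix L v assume v: "v \<in> Hspace n k (NL (Suc L))"
  show "restr n (V a b (Suc L) v) = V a b L (restr n v)"
    "restr n (V b a (Suc L) v) = V b a L (restr n v)"
    by (rule restr_V[OF v], rule ab, rule ab)+
qed

end

section \<open>The current algebra\<close>

subsection \<open>Brackets of operators of the same sign\<close>

text \<open>Words A^aPB_b for a matrix P of operators. With \<open>X_op\<close> restricting the
  entries of P, powers of X and powers of Y become instances of one computation.\<close>

definition Tgen :: "nat \<Rightarrow> (nat \<Rightarrow> nat \<Rightarrow> cpoly \<Rightarrow> cpoly) \<Rightarrow> nat \<Rightarrow> nat \<Rightarrow> cpoly \<Rightarrow> cpoly" where
  "Tgen N P a b f = (\<Sum>i<N. \<Sum>j<N. vA a i * P i j (dB j b f))"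

definition X_op :: "nat \<Rightarrow> (nat \<Rightarrow> nat \<Rightarrow> cpoly \<Rightarrow> cpoly) \<Rightarrow> bool" where
  "X_op N P \<longleftrightarrow> (\<forall>i<N. \<forall>j<N. linear_op (P i j) \<and> (\<forall>c p f. P i j (vA c p * f) = vA c p * P i j f)
     \<and> (\<forall>p c f. dB p c (P i j f) = P i j (dB p c f)))"

text \<open>The entries of P and Q pass through the A-variables and their derivatives, so the only
  contraction is that of B_b with A^c.\<close>

lemma Tgen_Tgen:
  assumes P: "X_op N P" and Q: "X_op N Q"
  shows "Tgen N P a b (Tgen N Q c d f) = (if b = c then Tgen N (\<lambda>i q f. \<Sum>j<N. P i j (Q j q f)) a d f else 0)
     + (\<Sum>i<N. \<Sum>j<N. \<Sum>p<N. \<Sum>q<N. vA a i * (vA c p * P i j (Q p q (dB j b (dB q d f)))))"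
proof -
  have P1: "linear_op (P i j)" "P i j (vA c p * f) = vA c p * P i j f"
    if "i < N" "j < N" for i j c p f using P that by (auto simp: X_op_def)
  have Q1: "dB p c (Q i j f) = Q i j (dB p c f)" if "i < N" "j < N" for i j c p f
    using Q that by (auto simp: X_op_def)
  have 1: "dB j b (Tgen N Q c d f) = (if b = c then \<Sum>q<N. Q j q (dB q d f) else 0)
      + (\<Sum>p<N. \<Sum>q<N. vA c p * Q p q (dB j b (dB q d f)))" if j: "j < N" for j
  proof -
    have "dB j b (Tgen N Q c d f) = (\<Sum>p<N. (if p = j then (if b = c then \<Sum>q<N. Q p q (dB q d f) else 0) else 0)
        + (\<Sum>q<N. vA c p * Q p q (dB j b (dB q d f))))"
      unfolding Tgen_def pd_sum sum_distrib_left[symmetric]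
      by (intro sum.cong refl) (auto simp: pd_Var_mult pd_sum Q1)
    then show ?thesis using j by (simp add: sum.distrib)
  qed
  have 2: "P i j (dB j b (Tgen N Q c d f)) = (if b = c then \<Sum>q<N. P i j (Q j q (dB q d f)) else 0)
      + (\<Sum>p<N. \<Sum>q<N. vA c p * P i j (Q p q (dB j b (dB q d f))))" if ij: "i < N" "j < N" for i j
    unfolding 1[OF ij(2)] by (simp add: linear_opD[OF P1(1)[OF ij]] P1(2)[OF ij])
  have "Tgen N P a b (Tgen N Q c d f) = (\<Sum>i<N. \<Sum>j<N. vA a i *
      ((if b = c then \<Sum>q<N. P i j (Q j q (dB q d f)) else 0)
      + (\<Sum>p<N. \<Sum>q<N. vA c p * P i j (Q p q (dB j b (dB q d f))))))"
    unfolding Tgen_def[of N P] by (intro sum.cong refl) (simp add: 2)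
  also have "\<dots> = (if b = c then \<Sum>i<N. vA a i * (\<Sum>j<N. \<Sum>q<N. P i j (Q j q (dB q d f))) else 0)
     + (\<Sum>i<N. \<Sum>j<N. \<Sum>p<N. \<Sum>q<N. vA a i * (vA c p * P i j (Q p q (dB j b (dB q d f)))))"
    by (auto simp: distrib_left sum.distrib sum_distrib_left)
  also have "(\<Sum>i<N. vA a i * (\<Sum>j<N. \<Sum>q<N. P i j (Q j q (dB q d f))))
      = Tgen N (\<lambda>i q f. \<Sum>j<N. P i j (Q j q f)) a d f"
    unfolding Tgen_def by (rule sum.cong[OF refl]) (simp only: sum_distrib_left, rule sum.swap)
  finally show ?thesis .
qed

text \<open>Since the entries of P and Q commute with each other, the normally ordered term is
  symmetric in the two words. The two contractions survive, both carrying the matrix product R = PQ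
  = QP.\<close>

lemma Tgen_commutator:
  assumes P: "X_op N P" and Q: "X_op N Q" and R: "\<And>i q f. i < N \<Longrightarrow> q < N \<Longrightarrow> R i q f = (\<Sum>j<N. P i j (Q j q f))"
    "\<And>i q f. i < N \<Longrightarrow> q < N \<Longrightarrow> R i q f = (\<Sum>j<N. Q i j (P j q f))"
    and comm: "\<And>i j p q f. i < N \<Longrightarrow> j < N \<Longrightarrow> p < N \<Longrightarrow> q < N \<Longrightarrow> P i j (Q p q f) = Q p q (P i j f)"
  shows "Tgen N P a b (Tgen N Q c d f) - Tgen N Q c d (Tgen N P a b f)
    = Const (kdelta c b) * Tgen N R a d f - Const (kdelta a d) * Tgen N R c b f"
proof -
  have "(\<Sum>i<N. \<Sum>j<N. \<Sum>p<N. \<Sum>q<N. vA a i * (vA c p * P i j (Q p q (dB j b (dB q d f)))))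
      = (\<Sum>i<N. \<Sum>p<N. \<Sum>j<N. \<Sum>q<N. vA a i * (vA c p * P i j (Q p q (dB j b (dB q d f)))))"
    by (rule sum.cong[OF refl], rule sum.swap)
  also have "\<dots> = (\<Sum>p<N. \<Sum>i<N. \<Sum>j<N. \<Sum>q<N. vA a i * (vA c p * P i j (Q p q (dB j b (dB q d f)))))"
    by (rule sum.swap)
  also have "\<dots> = (\<Sum>p<N. \<Sum>i<N. \<Sum>q<N. \<Sum>j<N. vA a i * (vA c p * P i j (Q p q (dB j b (dB q d f)))))"
    by (rule sum.cong[OF refl], rule sum.cong[OF refl], rule sum.swap)
  also have "\<dots> = (\<Sum>p<N. \<Sum>q<N. \<Sum>i<N. \<Sum>j<N. vA a i * (vA c p * P i j (Q p q (dB j b (dB q d f)))))"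
    by (rule sum.cong[OF refl], rule sum.swap)
  also have "\<dots> = (\<Sum>p<N. \<Sum>q<N. \<Sum>i<N. \<Sum>j<N. vA c p * (vA a i * Q p q (P i j (dB q d (dB j b f)))))"
    by (intro sum.cong refl) (simp add: comm mult.left_commute pd_commute[of "AVar b _"])
  finally have N: "(\<Sum>i<N. \<Sum>j<N. \<Sum>p<N. \<Sum>q<N. vA a i * (vA c p * P i j (Q p q (dB j b (dB q d f)))))
      = (\<Sum>p<N. \<Sum>q<N. \<Sum>i<N. \<Sum>j<N. vA c p * (vA a i * Q p q (P i j (dB q d (dB j b f)))))" .
  have "Tgen N (\<lambda>i q f. \<Sum>j<N. P i j (Q j q f)) a d f = Tgen N R a d f"
    "Tgen N (\<lambda>i q f. \<Sum>j<N. Q i j (P j q f)) c b f = Tgen N R c b f"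
    unfolding Tgen_def by (intro sum.cong refl; simp add: R[symmetric])+
  then show ?thesis
    unfolding Tgen_Tgen[OF P Q] Tgen_Tgen[OF Q P] N by (auto simp: kdelta_def)
qed

lemma T_Y_eq: "T_Y N m a b f = Tgen N (Ypow N m) a b f"
  by (simp add: T_Y_def Tgen_def)

lemma linear_op_Ypow: "linear_op (Ypow N m i j)"
proof (induction m arbitrary: i)
  case 0
  show ?case by (simp add: linear_op_def)
next
  case (Suc m)
  have "Ypow N (Suc m) i j = (\<lambda>f. \<Sum>l<N. pd (XVar l i) (Ypow N m l j f))" by (intro ext) simp
  then show ?case by (simp only:) (intro linear_op_intros(6,7) Suc)
qed

lemma pd_Ypow: "pd u (Ypow N m i j f) = Ypow N m i j (pd u f)"
  by (induction m arbitrary: i) (simp_all add: pd_sum pd_commute[of u])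

lemma Ypow_vA: "Ypow N m i j (vA c p * f) = vA c p * Ypow N m i j f"
  by (induction m arbitrary: i) (simp_all add: pd_Var_mult sum_distrib_left)

lemma Ypow_commute: "Ypow N m i j (Ypow N l p q f) = Ypow N l p q (Ypow N m i j f)"
proof (induction m arbitrary: i)
  case 0
  show ?case by (simp add: linear_opD(3)[OF linear_op_Ypow])
next
  case (Suc m)
  show ?case
    by (simp only: Ypow.simps Suc linear_opD(6)[OF linear_op_Ypow] pd_Ypow[of _ N l p q])
qed

lemma Ypow_add:
  assumes "i < N"
  shows "Ypow N (m + l) i q f = (\<Sum>j<N. Ypow N m i j (Ypow N l j q f))"
  using assms
proof (induction m arbitrary: i)
  case (Suc m)
  then have "Ypow N (Suc m + l) i q f = (\<Sum>s<N. pd (XVar s i) (\<Sum>j<N. Ypow N m s j (Ypow N l j q f)))"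
    by simp
  also have "\<dots> = (\<Sum>j<N. \<Sum>s<N. pd (XVar s i) (Ypow N m s j (Ypow N l j q f)))"
    unfolding pd_sum by (rule sum.swap)
  finally show ?case by simp
qed simp

lemma X_op_Ypow: "X_op N (Ypow N m)"
  by (simp add: X_op_def linear_op_Ypow Ypow_vA pd_Ypow)

lemma T_Y_commutator:
  "T_Y N m a b (T_Y N l c d f) - T_Y N l c d (T_Y N m a b f)
    = Const (kdelta c b) * T_Y N (m + l) a d f - Const (kdelta a d) * T_Y N (m + l) c b f"
  unfolding T_Y_eq
proof (rule Tgen_commutator[OF X_op_Ypow X_op_Ypow])
  fix i q f assume "i < N"
  then show "Ypow N (m + l) i q f = (\<Sum>j<N. Ypow N m i j (Ypow N l j q f))"
    "Ypow N (m + l) i q f = (\<Sum>j<N. Ypow N l i j (Ypow N m j q f))"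
    by (rule Ypow_add, subst add.commute, rule Ypow_add)
qed (rule Ypow_commute)

lemma Xmat_carrier: "Xmat N ^\<^sub>m m \<in> carrier_mat N N"
  by (rule pow_carrier_mat) (simp add: Xmat_def)

lemma T_X_eq: "T_X N m a b f = Tgen N (\<lambda>i j f. (Xmat N ^\<^sub>m m) $$ (i, j) * f) a b f"
  by (simp add: T_X_def Tgen_def mult.assoc)

lemma pd_Xmat_pow:
  assumes "i < N" "j < N"
  shows "pd (AVar a p) ((Xmat N ^\<^sub>m m) $$ (i, j)) = 0"
  using assms(2)
proof (induction m arbitrary: j)
  case 0
  then show ?case using assms by (simp add: Xmat_def)
next
  case (Suc m)
  have "(Xmat N ^\<^sub>m Suc m) $$ (i, j) = (\<Sum>l<N. (Xmat N ^\<^sub>m m) $$ (i, l) * vX l j)"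
    using mat2_entry[OF Xmat_carrier[of N m] _ assms(1) Suc.prems, of "Xmat N"] Suc.prems
    by (simp add: Xmat_def del: index_mult_mat)
  then show ?case using Suc.IH by (simp add: pd_sum pd_mult pd_Var)
qed

lemma Xmat_pow_add: "Xmat N ^\<^sub>m (m + l) = Xmat N ^\<^sub>m m * Xmat N ^\<^sub>m l"
proof (induction l)
  case 0
  show ?case using right_mult_one_mat[OF Xmat_carrier[of N m]] by (simp add: Xmat_def)
next
  case (Suc l)
  have "Xmat N \<in> carrier_mat N N" by (simp add: Xmat_def)
  with Suc show ?case using Xmat_carrier by (simp add: assoc_mult_mat[where n\<^sub>1 = N and n\<^sub>2 = N and n\<^sub>3 = N and n\<^sub>4 = N])
qed

lemma X_op_Xmat_pow: "X_op N (\<lambda>i j f. (Xmat N ^\<^sub>m m) $$ (i, j) * f)"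
  by (simp add: X_op_def linear_op_def algebra_simps pd_mult pd_Xmat_pow)

lemma T_X_commutator:
  "T_X N m a b (T_X N l c d f) - T_X N l c d (T_X N m a b f)
    = Const (kdelta c b) * T_X N (m + l) a d f - Const (kdelta a d) * T_X N (m + l) c b f"
proof -
  have R: "(Xmat N ^\<^sub>m (m + l)) $$ (i, q) * f = (\<Sum>j<N. (Xmat N ^\<^sub>m m) $$ (i, j) * ((Xmat N ^\<^sub>m l) $$ (j, q) * f))"
    if "i < N" "q < N" for i q m l f
    unfolding Xmat_pow_add mat2_entry[OF Xmat_carrier Xmat_carrier that]
    by (simp add: sum_distrib_right mult.assoc)
  show ?thesis
    unfolding T_X_eq
  proof (rule Tgen_commutator[OF X_op_Xmat_pow X_op_Xmat_pow])
    fix i q f assume iq: "i < N" "q < N"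
    show "(Xmat N ^\<^sub>m (m + l)) $$ (i, q) * f = (\<Sum>j<N. (Xmat N ^\<^sub>m m) $$ (i, j) * ((Xmat N ^\<^sub>m l) $$ (j, q) * f))"
      by (rule R[OF iq])
    show "(Xmat N ^\<^sub>m (m + l)) $$ (i, q) * f = (\<Sum>j<N. (Xmat N ^\<^sub>m l) $$ (i, j) * ((Xmat N ^\<^sub>m m) $$ (j, q) * f))"
      unfolding add.commute[of m l] by (rule R[OF iq])
  qed (rule mult.left_commute)
qed

lemma T_Y_0: "T_Y N 0 a b f = W1 N a b f"
  by (simp add: T_Y_def W1_def sum_distrib_left[symmetric])

lemma T_X_0: "T_X N 0 a b f = W1 N a b f"
proof -
  have "T_X N 0 a b f = (\<Sum>i<N. \<Sum>j<N. if i = j then vA a i * dB j b f else 0)"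
    unfolding T_X_def by (intro sum.cong refl) (simp add: Xmat_def)
  then show ?thesis by (simp add: W1_def)
qed

lemma T_Y_1: "T_Y N 1 a b f = WY N a b f"
proof -
  have "Ypow N (Suc 0) i j f = dY i j f" if "j < N" for i j f
  proof -
    have "Ypow N (Suc 0) i j f = (\<Sum>l<N. if l = j then dY i l f else 0)"
      unfolding Ypow.simps by (intro sum.cong refl) simp
    then show ?thesis using that by simp
  qed
  then show ?thesis by (simp add: T_Y_def WY_def sum_distrib_left del: Ypow.simps)
qed

lemma T_X_1: "T_X N 1 a b f = WX N a b f"
proof -
  have "(Xmat N ^\<^sub>m Suc 0) $$ (i, j) = vX i j" if "i < N" "j < N" for i j
  proof -
    have "Xmat N ^\<^sub>m Suc 0 = Xmat N" by (simp add: Xmat_def)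
    then show ?thesis using that by (simp add: Xmat_def)
  qed
  then show ?thesis by (simp add: T_X_def WX_def sum_distrib_left mult.assoc)
qed

lemma linear_op_T: "linear_op (T_Y N m a b)" "linear_op (T_X N m a b)"
proof -
  show "linear_op (T_Y N m a b)"
    unfolding T_Y_def
    by (intro linear_op_intros linear_op_comp[OF linear_op_Ypow])
  show "linear_op (T_X N m a b)"
    unfolding T_X_def mult.assoc by (intro linear_op_intros)
qed

definition TT :: "nat \<Rightarrow> int \<Rightarrow> nat \<Rightarrow> nat \<Rightarrow> cpoly \<Rightarrow> cpoly" where
  "TT N m = (if m \<ge> 0 then T_Y N (nat m) else T_X N (nat (- m)))"

text \<open>Degree 0 belongs to both halves, because the words in X and in Y agree with
  \<open>W1\<close> there. This lets the relations for equal signs include 0 on either side.\<close>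

lemma TT_nonpos: "m \<le> 0 \<Longrightarrow> TT N m a b = T_X N (nat (- m)) a b"
  by (cases "m = 0") (auto simp: TT_def T_Y_0 T_X_0)

lemma linear_op_TT: "linear_op (TT N m a b)"
  by (simp add: TT_def linear_op_T)

lemma TT_commutator:
  assumes "0 \<le> m \<and> 0 \<le> l \<or> m \<le> 0 \<and> l \<le> 0"
  shows "TT N m a b (TT N l c d f) - TT N l c d (TT N m a b f)
    = Const (kdelta c b) * TT N (m + l) a d f - Const (kdelta a d) * TT N (m + l) c b f"
  using assms
proof
  assume "0 \<le> m \<and> 0 \<le> l"
  then show ?thesis by (simp add: TT_def T_Y_commutator nat_add_distrib)
next
  assume *: "m \<le> 0 \<and> l \<le> 0"
  then have "nat (- (m + l)) = nat (- m) + nat (- l)" by arith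
  with * show ?thesis by (simp add: TT_nonpos T_X_commutator)
qed

subsection \<open>The bracket of degrees 1 and -1\<close>

declare cpoly.scale_scale [simp del]

lemma sum_kdelta:
  fixes F :: "nat \<Rightarrow> cpoly"
  assumes "a < n"
  shows "(\<Sum>e<n. Const (kdelta a e) * F e) = F a" "(\<Sum>e<n. Const (kdelta e a) * F e) = F a"
proof -
  have "(\<Sum>e<n. Const (kdelta a e) * F e) = (\<Sum>e<n. if e = a then F e else 0)"
    by (intro sum.cong) (auto simp: kdelta_def)
  then show "(\<Sum>e<n. Const (kdelta a e) * F e) = F a" using assms by simp
  then show "(\<Sum>e<n. Const (kdelta e a) * F e) = F a" by (simp add: kdelta_commute[of _ a])
qed

context covariants
begin

text \<open>The gl_n bracket of two matrix units, with the resulting units replaced by members of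
  the family Q.\<close>

definition Theta :: "(nat \<Rightarrow> nat \<Rightarrow> cpoly) \<Rightarrow> nat \<Rightarrow> nat \<Rightarrow> nat \<Rightarrow> nat \<Rightarrow> cpoly" where
  "Theta Q a b c d = Const (kdelta c b) * Q a d - Const (kdelta a d) * Q c b"

text \<open>What is left of the bracket of degrees 1 and -1 once every term with a factor L has been
  split off. It is built from \<open>U\<close> and \<open>V\<close> with coefficients independent of
  L, hence bounded.\<close>

definition remainder :: "nat \<Rightarrow> nat \<Rightarrow> nat \<Rightarrow> nat \<Rightarrow> nat \<Rightarrow> cpoly \<Rightarrow> cpoly" where
  "remainder a b c d L v = U a d L (U c b L v) - Const (kdelta c d) * U a b L v
     + Const (kdelta c b) * (V a d L v - (\<Sum>e<n. U a e L (U e d L v)) + Const (of_nat (k + n)) * U a d L v)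
     - Const (kdelta a d) * V c b L v"

lemma W1_eq_U: "W1 (NL L) a b v = U a b L v + Const (of_nat (k * L)) * Const (kdelta a b) * v"
  by (simp add: U_def Const_mult)

lemma W1_W1_eq_U:
  "W1 (NL L) a d (W1 (NL L) c b v) = U a d L (U c b L v)
     + Const (of_nat (k * L)) * (Const (kdelta c b) * U a d L v + Const (kdelta a d) * U c b L v)
     + Const (of_nat (k * L)) * Const (of_nat (k * L)) * Const (kdelta a d) * Const (kdelta c b) * v"
proof -
  have "U a d L (Const x * Const y * v) = Const x * Const y * U a d L v" for x y
    by (simp only: mult.assoc linear_opD(2)[OF linear_op_UV(1)])
  then show ?thesis
    unfolding W1_eq_U linear_opD(1)[OF linear_op_UV(1)] by (simp add: algebra_simps)
qed

lemma sum_W1_W1: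
  assumes "a < n" "d < n"
  shows "(\<Sum>e<n. W1 (NL L) a e (W1 (NL L) e d v)) = (\<Sum>e<n. U a e L (U e d L v))
     + Const (of_nat (k * L)) * (U a d L v + U a d L v)
     + Const (of_nat (k * L)) * Const (of_nat (k * L)) * Const (kdelta a d) * v"
proof -
  let ?K = "Const (of_nat (k * L))"
  have "W1 (NL L) a e (W1 (NL L) e d v) = U a e L (U e d L v)
     + (?K * (Const (kdelta e d) * U a e L v) + ?K * (Const (kdelta a e) * U e d L v))
     + ?K * ?K * (Const (kdelta a e) * (Const (kdelta e d) * v))" for e
    unfolding W1_W1_eq_U[of L a e e d v]
    by (simp only: kdelta_commute[of d e] distrib_left mult.assoc)
  then show ?thesis
    using sum_kdelta[OF assms(1)] sum_kdelta[OF assms(2)]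
    by (simp add: sum.distrib sum_distrib_left[symmetric] distrib_left mult.assoc)
qed

text \<open>With \<open>W1\<close> and \<open>WXY\<close> expressed through \<open>U\<close> and
  \<open>V\<close>, the scalars quadratic in L cancel between the product of two \<open>W1\<close>
  and the two contractions, and the terms kL times \<open>U\<close> combine with (2k + n)L from
  \<open>V\<close> to (k + n)L. The central constant (k + n)kL comes from the summand (k + n)
  \<open>W1\<close> of \<open>WXY_minus_WYX\<close> and the leading term kL of
  \<open>W1\<close>.\<close>

lemma commutator_expansion:
  assumes v: "v \<in> Hspace n k (NL L)" and idx: "a < n" "b < n" "c < n" "d < n"
  shows "WY (NL L) a b (WX (NL L) c d v) - WX (NL L) c d (WY (NL L) a b v)
    = Const (of_nat ((k + n) * L)) * (Theta (\<lambda>x y. U x y L v) a b c d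
        + Const (of_nat k) * (Const (kdelta c b) * Const (kdelta a d) * v))
      - Const (of_nat (k * L)) * (Const (kdelta a b) * Const (kdelta c d) * v) + remainder a b c d L v"
proof -
  let ?N = "NL L" and ?q = "Const (of_nat ((2 * k + n) * k) * of_nat (L * Suc L) / 2)"
  have ifd: "(if x = y then z else 0) = Const (kdelta x y) * z" for x y and z :: cpoly
    by (simp add: kdelta_def)
  have wxy: "WXY ?N x y v = V x y L v + Const (of_nat ((2 * k + n) * L)) * W1 ?N x y v
      - ?q * Const (kdelta x y) * v" for x y
    unfolding V_def Const_mult by simp
  have wyx: "WYX ?N a d v = WXY ?N a d v - (\<Sum>e<n. W1 ?N a e (W1 ?N e d v)) + Const (of_nat (k + n)) * W1 ?N a d v"
    using WXY_minus_WYX[OF moment_Hspace[OF v] idx(4), of a] by (simp add: Const_of_nat algebra_simps)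
  have c: "Const (of_nat ((2 * k + n) * L)) = Const (of_nat ((k + n) * L)) + Const (of_nat (k * L))"
    "Const (of_nat ((k + n) * L)) * Const (of_nat k) = Const (of_nat (k + n)) * Const (of_nat (k * L))"
    unfolding Const_of_nat by (simp_all add: algebra_simps)
  \<comment> \<open>Here K = kL, KN = (k + n)L, kn = k + n, x = \<delta>^a_d, y = \<delta>^c_b, z =
    \<delta>^a_b, t = \<delta>^c_d; q is the quadratic constant of \<open>V\<close>, S the sum of
    products of two \<open>U\<close>, and the letters u and v followed by indices stand for
    \<open>U\<close> and \<open>V\<close>.\<close>
  have ring: "w1 - t * (uab + K * z * v) + y * (vad + (KN + K) * (uad + K * x * v) - q * x * v
        - (S + K * (uad + uad) + K * K * x * v) + kn * (uad + K * x * v))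
      - x * (vcb + (KN + K) * (ucb + K * y * v) - q * y * v)
      = KN * ((y * uad - x * ucb)) + kn * K * (y * x * v) - K * (z * t * v)
        + (uu - t * uab + y * (vad - S + kn * uad) - x * vcb)"
    if "w1 = uu + K * (y * uad + x * ucb) + K * K * x * y * v"
    for w1 t uab K z y vad KN uad x q S kn vcb ucb uu :: cpoly
    unfolding that by (simp add: algebra_simps)
  have wyx': "WYX ?N a d v = V a d L v
      + (Const (of_nat ((k + n) * L)) + Const (of_nat (k * L))) * (U a d L v + Const (of_nat (k * L)) * Const (kdelta a d) * v)
      - ?q * Const (kdelta a d) * v
      - ((\<Sum>e<n. U a e L (U e d L v)) + Const (of_nat (k * L)) * (U a d L v + U a d L v)
        + Const (of_nat (k * L)) * Const (of_nat (k * L)) * Const (kdelta a d) * v)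
      + Const (of_nat (k + n)) * (U a d L v + Const (of_nat (k * L)) * Const (kdelta a d) * v)"
    unfolding wyx wxy sum_W1_W1[OF idx(1,4)] W1_eq_U[of L a d v] c(1) ..
  have wcb: "WXY ?N c b v = V c b L v
      + (Const (of_nat ((k + n) * L)) + Const (of_nat (k * L))) * (U c b L v + Const (of_nat (k * L)) * Const (kdelta c b) * v)
      - ?q * Const (kdelta c b) * v"
    unfolding wxy W1_eq_U[of L c b v] c(1) ..
  show ?thesis
    unfolding WY_WX_commutator ifd wyx' wcb W1_eq_U[of L a b v] kdelta_commute[of b c]
    by (subst ring[OF W1_W1_eq_U[of L a d c b v]])
      (simp only: Theta_def remainder_def distrib_left[of "Const (of_nat ((k + n) * L))"] mult.assoc[symmetric] c(2))
qed

lemma bnd_comp_0: "bnd 0 0 S \<Longrightarrow> bnd 0 0 T \<Longrightarrow> bnd 0 0 (\<lambda>L v. S L (T L v))"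
  using bnd_comp[of 0 0 S 0 0 T] by simp

lemma bnd_remainder:
  assumes "a < n" "b < n" "c < n" "d < n"
  shows "bnd 0 0 (remainder a b c d)"
proof -
  have "bnd 0 0 (\<lambda>L v. \<Sum>e<n. U a e L (U e d L v))"
    using assms by (intro bnd_sum bnd_comp_0[OF bnd_U bnd_U]) auto
  then show ?thesis
    unfolding remainder_def[abs_def]
    by (intro bnd_add bnd_diff bnd_scale_const bnd_comp_0[OF bnd_U bnd_U] bnd_U bnd_V assms)
qed

lemma bnd_Theta:
  assumes "\<And>x y. x < n \<Longrightarrow> y < n \<Longrightarrow> bnd s h (Q x y)" "a < n" "b < n" "c < n" "d < n"
  shows "bnd s h (\<lambda>L v. Theta (\<lambda>x y. Q x y L v) a b c d)"
  unfolding Theta_def using assms by (intro bnd_diff bnd_scale_const) auto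

section \<open>Normalisation of the currents\<close>

definition eps :: "nat \<Rightarrow> real" where
  "eps L = real n / (real (n + k) * real (NL L))"

definition scal :: "nat \<Rightarrow> int \<Rightarrow> complex" where
  "scal L m = complex_of_real (eps L powr (real_of_int \<bar>m\<bar> / 2))"

text \<open>The key identity is \<open>eps\<close> times (k + n)L = nL/N = 1 - r/N. The
  normalisation divides by N and not by nL, and r/N \<le> 1/L is one source of the error of order
  1/L.\<close>

lemma eps_bounds:
  assumes L: "1 \<le> L"
  shows "0 < eps L" "eps L \<le> 1 / real L" "eps L * real ((k + n) * L) \<le> 1"
    "\<bar>eps L * real ((k + n) * L) - 1\<bar> \<le> 1 / real L"
proof -
  have "0 < n * L" using n_pos L by simp
  then have N: "0 < real (NL L)" unfolding of_nat_0_less_iff by simp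
  have kn: "0 < real (n + k)" using n_pos by simp
  show "0 < eps L" unfolding eps_def using N kn n_pos by simp
  have e: "eps L * real ((k + n) * L) = real (n * L) / real (NL L)"
  proof -
    have gen: "a / (x * y) * (x * z) = a * z / y" if "x \<noteq> 0" for a x y z :: real using that by simp
    have "real ((k + n) * L) = real (n + k) * real L" by (simp add: algebra_simps)
    then have "eps L * real ((k + n) * L)
        = real n / (real (n + k) * real (NL L)) * (real (n + k) * real L)"
      by (simp only: eps_def)
    also have "\<dots> = real n * real L / real (NL L)" by (rule gen) (use kn in simp)
    finally show ?thesis by simp
  qed
  show "eps L * real ((k + n) * L) \<le> 1" unfolding e using N by (simp add: divide_le_eq_1)
  have "real n * real L \<le> 1 * real (NL L)" by simp
  also have "\<dots> \<le> real (n + k) * real (NL L)" using N n_pos by (intro mult_right_mono) auto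
  finally have "real n * real L \<le> real (n + k) * real (NL L)" .
  moreover have "a / (x * y) \<le> 1 / z" if "a * z \<le> x * y" "0 < x" "0 < y" "0 < z" for a x y z :: real
    using that by (simp add: divide_simps)
  ultimately show "eps L \<le> 1 / real L"
    unfolding eps_def using L N kn by simp
  have "eps L * real ((k + n) * L) - 1 = - (real r / real (NL L))"
    unfolding e using N by (simp add: field_simps)
  then have "\<bar>eps L * real ((k + n) * L) - 1\<bar> = real r / real (NL L)" by simp
  also have "\<dots> \<le> 1 / real L"
  proof -
    have "r * L \<le> n * L" using r_less by (intro mult_right_mono) auto
    then have "real (r * L) \<le> real (NL L)" by (simp only: of_nat_le_iff)
    then show ?thesis using N L by (simp add: field_simps)
  qed
  finally show "\<bar>eps L * real ((k + n) * L) - 1\<bar> \<le> 1 / real L" .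
qed

lemma scal_0 [simp]: "1 \<le> L \<Longrightarrow> scal L 0 = 1"
  using eps_bounds(1)[of L] by (simp add: scal_def)

lemma scal_mult:
  assumes "1 \<le> L" "0 \<le> m \<and> 0 \<le> l \<or> m \<le> 0 \<and> l \<le> 0"
  shows "scal L m * scal L l = scal L (m + l)"
proof -
  have "real_of_int \<bar>m + l\<bar> / 2 = real_of_int \<bar>m\<bar> / 2 + real_of_int \<bar>l\<bar> / 2"
    using assms(2) by auto
  then show ?thesis
    unfolding scal_def by (simp only: powr_add of_real_mult)
qed

lemma scal_square: "1 \<le> L \<Longrightarrow> scal L 1 * scal L 1 = of_real (eps L)"
  using eps_bounds(1)[of L] unfolding scal_def of_real_mult[symmetric] powr_add[symmetric] by simp

lemma scal_minus: "scal L (- m) = scal L m"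
  by (simp add: scal_def)

section \<open>Boundedness of the currents of degree 1 and -1\<close>

definition YS where "YS a b L v = Const (scal L 1) * WY (NL L) a b v"
definition XS where "XS a b L v = Const (scal L 1) * WX (NL L) a b v"

lemma cnj_scal: "cnj (scal L m) = scal L m"
  by (simp add: scal_def)

lemma ip_YS: "ip (YS a b L f) g = ip f (XS b a L g)"
  by (simp add: YS_def XS_def fock_formula_scale ip_scale_right ip_WY cnj_scal)

lemma ip_XS: "ip (XS a b L f) g = ip f (YS b a L g)"
  unfolding fock_formula_herm[of "XS a b L f"] fock_formula_herm[of f] ip_YS ..

lemma HL_YS: "v \<in> HL L e \<Longrightarrow> a < n \<Longrightarrow> b < n \<Longrightarrow> YS a b L v \<in> HL L (e - 1)"
  and HL_XS: "v \<in> HL L e \<Longrightarrow> a < n \<Longrightarrow> b < n \<Longrightarrow> XS a b L v \<in> HL L (e + 1)"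
  unfolding YS_def XS_def by (simp_all add: HH_scale HH_W)

lemma scaled_commutator:
  assumes L: "1 \<le> L"
  shows "YS a b L (XS c d L v) - XS c d L (YS a b L v)
    = Const (of_real (eps L)) * (WY (NL L) a b (WX (NL L) c d v) - WX (NL L) c d (WY (NL L) a b v))"
proof -
  have "YS a b L (XS c d L v) - XS c d L (YS a b L v)
    = Const (scal L 1) * (Const (scal L 1)) * (WY (NL L) a b (WX (NL L) c d v) - WX (NL L) c d (WY (NL L) a b v))"
    by (simp add: YS_def XS_def linear_opD(2)[OF linear_op_W(2)] linear_opD(2)[OF linear_op_W(3)] algebra_simps)
  then show ?thesis by (simp only: Const_mult[symmetric] scal_square[OF L])
qed

text \<open>Without the traceless projection the bracket still contains \<open>eps\<close> times kL
  \<delta>^a_b \<delta>^c_d, which does not become small; the norm estimates only ask that it be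
  bounded.\<close>

lemma bnd_scaled_commutator:
  assumes idx: "a < n" "b < n" "c < n" "d < n"
  shows "bnd 0 0 (\<lambda>L v. YS a b L (XS c d L v) - XS c d L (YS a b L v))"
proof (rule bnd_cong)
  fix L v assume L: "1 \<le> L" and v: "v \<in> Hspace n k (NL L)"
  show "YS a b L (XS c d L v) - XS c d L (YS a b L v)
    = Const (of_real (eps L * real ((k + n) * L))) * (Theta (\<lambda>x y. U x y L v) a b c d
        + Const (of_nat k) * (Const (kdelta c b) * (Const (kdelta a d) * v)))
      - Const (of_real (eps L * real (k * L))) * (Const (kdelta a b) * (Const (kdelta c d) * v))
      + Const (of_real (eps L)) * remainder a b c d L v"
  proof -
    have "Const (of_real (eps L * real K)) = Const (of_real (eps L)) * Const (of_nat K)" for K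
      by (simp add: Const_mult[symmetric])
    then show ?thesis
      unfolding scaled_commutator[OF L] commutator_expansion[OF v idx]
      by (simp only: distrib_left right_diff_distrib mult.assoc)
  qed
next
  have b1: "cmod (of_real (eps L * real ((k + n) * L))) \<le> 1 / real L ^ 0" if "1 \<le> L" for L
    using eps_bounds(1,3)[OF that] by (simp del: of_real_mult of_nat_mult of_nat_add)
  have b2: "cmod (of_real (eps L * real (k * L))) \<le> 1 / real L ^ 0" if "1 \<le> L" for L
  proof -
    have "eps L * real (k * L) \<le> eps L * real ((k + n) * L)"
      using eps_bounds(1)[OF that] by (intro mult_left_mono of_nat_mono mult_right_mono) auto
    then have "eps L * real (k * L) \<le> 1" using eps_bounds(3)[OF that] by linarith
    then show ?thesis using eps_bounds(1)[OF that] by (simp del: of_real_mult of_nat_mult of_nat_add)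
  qed
  have b3: "cmod (of_real (eps L)) \<le> 1 / real L ^ 0" if "1 \<le> L" for L
  proof -
    have "1 / real L \<le> 1" using that by simp
    then show ?thesis using eps_bounds(1,2)[OF that] by simp
  qed
  have "bnd 0 (0 + 0) (\<lambda>L v. Const (of_real (eps L * real ((k + n) * L))) * (Theta (\<lambda>x y. U x y L v) a b c d
        + Const (of_nat k) * (Const (kdelta c b) * (Const (kdelta a d) * v))))"
    by (rule bnd_scale[OF _ b1]) (intro bnd_add bnd_Theta bnd_U bnd_scale_const bnd_id idx)
  moreover have "bnd 0 (0 + 0) (\<lambda>L v. Const (of_real (eps L * real (k * L))) * (Const (kdelta a b) * (Const (kdelta c d) * v)))"
    by (rule bnd_scale[OF _ b2]) (intro bnd_scale_const bnd_id)
  moreover have "bnd 0 (0 + 0) (\<lambda>L v. Const (of_real (eps L)) * remainder a b c d L v)"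
    by (rule bnd_scale[OF bnd_remainder[OF idx] b3])
  ultimately show "bnd 0 0 (\<lambda>L v. Const (of_real (eps L * real ((k + n) * L))) * (Theta (\<lambda>x y. U x y L v) a b c d
        + Const (of_nat k) * (Const (kdelta c b) * (Const (kdelta a d) * v)))
      - Const (of_real (eps L * real (k * L))) * (Const (kdelta a b) * (Const (kdelta c d) * v))
      + Const (of_real (eps L)) * remainder a b c d L v)"
    by (intro bnd_add bnd_diff) simp_all
qed

text \<open>Duality: |Yv|^2 = <v, XYv>, and Yv lies one degree lower, so a bound for X in degree e -
  1 bounds its adjoint in degree e.\<close>

lemma YS_norm:
  assumes cd: "c < n" "d < n" and v: "v \<in> HL L e" and C0: "0 \<le> C"
    and C: "\<And>w. w \<in> HL L (e - 1) \<Longrightarrow> fock_norm (XS c d L w) \<le> C * fock_norm w"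
  shows "fock_norm (YS d c L v) \<le> C * fock_norm v"
proof (cases "fock_norm (YS d c L v) = 0")
  case False
  let ?y = "YS d c L v"
  have "fock_norm ?y * fock_norm ?y = cmod (ip ?y ?y)"
    unfolding ip_self norm_of_real by (simp add: power2_eq_square)
  also have "\<dots> = cmod (ip v (XS c d L ?y))" unfolding ip_YS[of d c L v ?y] ..
  also have "\<dots> \<le> fock_norm v * fock_norm (XS c d L ?y)" by (rule ip_Cauchy_Schwarz)
  also have "\<dots> \<le> fock_norm v * (C * fock_norm ?y)"
    by (intro mult_left_mono C HL_YS v cd) simp
  finally have "fock_norm ?y * fock_norm ?y \<le> (C * fock_norm v) * fock_norm ?y" by (simp add: mult_ac)
  moreover have "0 < fock_norm ?y" using False fock_norm_nonneg[of ?y] by linarith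
  ultimately show ?thesis by (rule mult_right_le_imp_le)
qed (simp add: C0)

text \<open>$\|X v\|^2 = \|Y v\|^2 + \langle v,[Y,X]v\rangle$, and $Y$ lowers the degree; there is nothing in
  negative degrees.\<close>

lemma XS_bound:
  assumes cd: "c < n" "d < n"
  shows "\<exists>C\<ge>0. \<forall>L\<ge>1. \<forall>v\<in>HL L e. fock_norm (XS c d L v) \<le> C * fock_norm v"
proof -
  \<comment> \<open>Degrees are counted from -1, where the space is 0, so the base of the induction
    is trivial.\<close>
  have "\<exists>C\<ge>0. \<forall>L\<ge>1. \<forall>v\<in>HL L (int m - 1). fock_norm (XS c d L v) \<le> C * fock_norm v" for m
  proof (induction m)
    case 0
    have "XS c d L v = 0" if "1 \<le> L" "v \<in> HL L (int 0 - 1)" for L v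
    proof -
      have "v = 0" by (rule HH_eq_0[OF n_pos r_less that]) simp
      then show ?thesis by (simp add: XS_def linear_opD(3)[OF linear_op_W(3)])
    qed
    then show ?case by (intro exI[of _ 0]) simp
  next
    case (Suc m)
    then obtain C where C: "C \<ge> 0"
      "\<And>L v. 1 \<le> L \<Longrightarrow> v \<in> HL L (int m - 1) \<Longrightarrow> fock_norm (XS c d L v) \<le> C * fock_norm v" by blast
    obtain D where D: "D \<ge> 0" "\<And>L v. 1 \<le> L \<Longrightarrow> v \<in> HL L (int m) \<Longrightarrow>
        fock_norm (YS d c L (XS c d L v) - XS c d L (YS d c L v)) \<le> D / real L ^ 0 * fock_norm v"
      by (rule bndE[OF bnd_scaled_commutator[OF cd(2,1) cd], of "int m"]) blast
    have "fock_norm (XS c d L v) \<le> sqrt (C * C + D) * fock_norm v" if L: "1 \<le> L" and v: "v \<in> HL L (int m)" for L v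
    proof -
      let ?x = "XS c d L v" and ?y = "YS d c L v"
      let ?z = "YS d c L ?x - XS c d L ?y"
      have Y: "fock_norm ?y \<le> C * fock_norm v"
        by (rule YS_norm[OF cd v C(1)]) (rule C(2)[OF L])
      have "ip ?x ?x = ip v (YS d c L ?x)" by (rule ip_XS)
      also have "YS d c L ?x = XS c d L ?y + ?z" by simp
      also have "ip v (XS c d L ?y + ?z) = ip ?y ?y + ip v ?z"
        unfolding ip_add_right ip_YS[of d c L v ?y] ..
      finally have "(fock_norm ?x)\<^sup>2 = cmod (ip ?y ?y + ip v ?z)"
        unfolding ip_self[of ?x] by (metis norm_of_real abs_of_nonneg zero_le_power2)
      also have "\<dots> \<le> fock_norm ?y * fock_norm ?y + fock_norm v * fock_norm ?z"
        by (rule order_trans[OF norm_triangle_ineq add_mono[OF ip_Cauchy_Schwarz ip_Cauchy_Schwarz]])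
      also have "\<dots> \<le> (C * fock_norm v) * (C * fock_norm v) + fock_norm v * (D * fock_norm v)"
        using D(2)[OF L v] C(1) by (intro add_mono mult_mono Y mult_left_mono) auto
      also have "\<dots> = (C * C + D) * (fock_norm v)\<^sup>2" by (simp add: power2_eq_square algebra_simps)
      finally have "sqrt ((fock_norm ?x)\<^sup>2) \<le> sqrt ((C * C + D) * (fock_norm v)\<^sup>2)" by (rule real_sqrt_le_mono)
      then show ?thesis by (simp add: real_sqrt_mult)
    qed
    then show ?case using C(1) D(1) by (intro exI[of _ "sqrt (C * C + D)"]) simp
  qed
  from this[of "nat (e + 1)"] obtain C where C: "C \<ge> 0"
    "\<And>L v. 1 \<le> L \<Longrightarrow> v \<in> HL L (int (nat (e + 1)) - 1) \<Longrightarrow> fock_norm (XS c d L v) \<le> C * fock_norm v" by blast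
  have "e \<le> int (nat (e + 1)) - 1" by simp
  then have "fock_norm (XS c d L v) \<le> C * fock_norm v" if "1 \<le> L" "v \<in> HL L e" for L v
    using C(2)[OF that(1) HH_mono[OF that(2)]] by simp
  with C(1) show ?thesis by blast
qed

lemma bnd_XS: "c < n \<Longrightarrow> d < n \<Longrightarrow> bnd 1 0 (XS c d)"
  by (rule bndI, erule (2) HL_XS) (use XS_bound[of c d] in fastforce)

lemma bnd_YS:
  assumes cd: "c < n" "d < n"
  shows "bnd (- 1) 0 (YS d c)"
proof (rule bndI)
  fix e
  obtain C where "C \<ge> 0" "\<And>L v. 1 \<le> L \<Longrightarrow> v \<in> HL L (e - 1) \<Longrightarrow> fock_norm (XS c d L v) \<le> C * fock_norm v"
    using XS_bound[OF cd, of "e - 1"] by blast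
  then have "fock_norm (YS d c L v) \<le> C / real L ^ 0 * fock_norm v" if "1 \<le> L" "v \<in> HL L e" for L v
    using YS_norm[OF cd that(2)] that(1) by simp
  then show "\<exists>C. \<forall>L\<ge>1. \<forall>v\<in>HL L e. fock_norm (YS d c L v) \<le> C / real L ^ 0 * fock_norm v" by blast
next
  fix L v e assume "v \<in> HL L e"
  then show "YS d c L v \<in> HL L (e + - 1)" using HL_YS[of v L e d c] cd by simp
qed

end

subsection \<open>Traceless parts\<close>

text \<open>The traceless projection in (a, b) and in (c, d) together. Brackets of traceless parts
  are this projection of the full brackets, as \<open>traceless_commutator\<close> shows.\<close>

definition traceless_pair :: "nat \<Rightarrow> (nat \<Rightarrow> nat \<Rightarrow> nat \<Rightarrow> nat \<Rightarrow> cpoly) \<Rightarrow> nat \<Rightarrow> nat \<Rightarrow> nat \<Rightarrow> nat \<Rightarrow> cpoly" where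
  "traceless_pair n Z a b c d = Z a b c d - Const (kdelta a b / of_nat n) * (\<Sum>e<n. Z e e c d)
     - Const (kdelta c d / of_nat n) * (\<Sum>e<n. Z a b e e)
     + Const (kdelta a b / of_nat n) * (Const (kdelta c d / of_nat n) * (\<Sum>e<n. \<Sum>e'<n. Z e e e' e'))"

lemma traceless_commutator:
  assumes "\<And>x y. linear_op (S x y)" "\<And>x y. linear_op (T x y)"
  shows "traceless n S a b (traceless n T c d f) - traceless n T c d (traceless n S a b f)
    = traceless_pair n (\<lambda>a b c d. S a b (T c d f) - T c d (S a b f)) a b c d"
proof -
  let ?x = "Const (kdelta a b / of_nat n)" and ?y = "Const (kdelta c d / of_nat n)"
  have 1: "traceless n S a b (traceless n T c d f) = S a b (T c d f) - ?y * (\<Sum>e<n. S a b (T e e f))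
      - ?x * ((\<Sum>e<n. S e e (T c d f)) - ?y * (\<Sum>e<n. \<Sum>e'<n. S e e (T e' e' f)))"
    by (simp add: traceless_def linear_opD[OF assms(1)] sum_subtractf sum_distrib_left[symmetric])
  have 2: "traceless n T c d (traceless n S a b f) = T c d (S a b f) - ?x * (\<Sum>e<n. T c d (S e e f))
      - ?y * ((\<Sum>e<n. T e e (S a b f)) - ?x * (\<Sum>e<n. \<Sum>e'<n. T e' e' (S e e f)))"
    by (simp add: traceless_def linear_opD[OF assms(2)] sum_subtractf sum_distrib_left[symmetric])
      (rule disjI1, rule sum.swap)
  show ?thesis
    unfolding 1 2 traceless_pair_def sum_subtractf by (simp add: algebra_simps)
qed

lemma traceless_pair_cong:
  assumes "\<And>a b c d. a < n \<Longrightarrow> b < n \<Longrightarrow> c < n \<Longrightarrow> d < n \<Longrightarrow> Z a b c d = Z' a b c d"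
    and "a < n" "b < n" "c < n" "d < n"
  shows "traceless_pair n Z a b c d = traceless_pair n Z' a b c d"
  unfolding traceless_pair_def using assms by simp

lemma traceless_pair_add: "traceless_pair n (\<lambda>a b c d. Z a b c d + Z' a b c d) a b c d = traceless_pair n Z a b c d + traceless_pair n Z' a b c d"
  by (simp add: traceless_pair_def sum.distrib algebra_simps)

lemma traceless_pair_diff: "traceless_pair n (\<lambda>a b c d. Z a b c d - Z' a b c d) a b c d = traceless_pair n Z a b c d - traceless_pair n Z' a b c d"
  by (simp add: traceless_pair_def sum_subtractf algebra_simps)

lemma traceless_pair_scale: "traceless_pair n (\<lambda>a b c d. x * Z a b c d) a b c d = x * traceless_pair n Z a b c d"
  by (simp add: traceless_pair_def sum_distrib_left[symmetric] algebra_simps)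

lemma Const_div: "Const (x / y) = Const x * Const (1 / y)"
  by (simp add: Const_mult[symmetric])

lemma kdelta_self [simp]: "kdelta a a = 1"
  by (simp add: kdelta_def)

lemma of_nat_mult_Const_inverse:
  assumes "0 < n"
  shows "of_nat n * Const (1 / of_nat n) = 1"
  unfolding Const_of_nat[symmetric] Const_mult[symmetric] using assms by simp

text \<open>The first part is the origin of the -1/n in the central term. The second disposes of the
  term -kL \<delta>^a_b \<delta>^c_d of \<open>commutator_expansion\<close>, which has the same
  order in L as the main term.\<close>

lemma traceless_pair_kdelta:
  assumes n: "0 < n" and idx: "a < n" "b < n" "c < n" "d < n"
  shows "traceless_pair n (\<lambda>a b c d. Const (kdelta c b) * (Const (kdelta a d) * v)) a b c d
      = Const (kdelta c b) * (Const (kdelta a d) * v) - Const (1 / of_nat n) * (Const (kdelta a b) * (Const (kdelta c d) * v))"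
    and "traceless_pair n (\<lambda>a b c d. Const (kdelta a b) * (Const (kdelta c d) * v)) a b c d = 0"
proof -
  let ?i = "Const (1 / of_nat n)"
  note i = of_nat_mult_Const_inverse[OF n]
  have s1: "(\<Sum>e<n. Const (kdelta c e) * (Const (kdelta e d) * v)) = Const (kdelta c d) * v"
    "(\<Sum>e<n. Const (kdelta e b) * (Const (kdelta a e) * v)) = Const (kdelta a b) * v"
    "(\<Sum>e<n. \<Sum>e'<n. Const (kdelta e' e) * (Const (kdelta e e') * v)) = of_nat n * v"
    using sum_kdelta[OF idx(3)] sum_kdelta[OF idx(2)] by (simp_all add: sum_kdelta)
  show "traceless_pair n (\<lambda>a b c d. Const (kdelta c b) * (Const (kdelta a d) * v)) a b c d
      = Const (kdelta c b) * (Const (kdelta a d) * v) - ?i * (Const (kdelta a b) * (Const (kdelta c d) * v))"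
  proof -
    have r: "z - (x * i) * (y * v) - (y * i) * (x * v) + (x * i) * ((y * i) * (m * v)) = z - i * (x * (y * v))"
      if "m * i = 1" for z x i y m v :: cpoly
    proof -
      have "(x * i) * ((y * i) * (m * v)) = (m * i) * (i * (x * (y * v)))" by (simp add: algebra_simps)
      then have "(x * i) * ((y * i) * (m * v)) = i * (x * (y * v))" unfolding that by simp
      then show ?thesis by (simp only:) (simp add: algebra_simps)
    qed
    show ?thesis
      unfolding traceless_pair_def s1 Const_div[of "kdelta a b"] Const_div[of "kdelta c d"] by (rule r[OF i])
  qed
  have s2: "(\<Sum>e<n. Const (kdelta e e) * (Const (kdelta c d) * v)) = of_nat n * (Const (kdelta c d) * v)"
    "(\<Sum>e<n. Const (kdelta a b) * (Const (kdelta e e) * v)) = of_nat n * (Const (kdelta a b) * v)"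
    "(\<Sum>e<n. \<Sum>e'<n. Const (kdelta e e) * (Const (kdelta e' e') * v)) = of_nat n * (of_nat n * v)"
    by simp_all
  have r: "x * (y * v) - (x * i) * (m * (y * v)) - (y * i) * (m * (x * v)) + (x * i) * ((y * i) * (m * (m * v))) = 0"
    if "m * i = 1" for x i y m v :: cpoly
  proof -
    have "(x * i) * (m * (y * v)) = (m * i) * (x * (y * v))" "(y * i) * (m * (x * v)) = (m * i) * (x * (y * v))"
      "(x * i) * ((y * i) * (m * (m * v))) = (m * i) * ((m * i) * (x * (y * v)))" by (simp_all add: algebra_simps)
    then show ?thesis using that by simp
  qed
  show "traceless_pair n (\<lambda>a b c d. Const (kdelta a b) * (Const (kdelta c d) * v)) a b c d = 0"
    unfolding traceless_pair_def s2 Const_div[of "kdelta a b"] Const_div[of "kdelta c d"] by (rule r[OF i])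
qed

lemma linear_op_traceless: "(\<And>x y. linear_op (T x y)) \<Longrightarrow> linear_op (traceless n T a b)"
  unfolding traceless_def by (intro linear_op_intros) auto

lemma sum_traceless:
  assumes "0 < n"
  shows "(\<Sum>c<n. traceless n T c c f) = 0"
proof -
  have "(\<Sum>c<n. traceless n T c c f)
      = (\<Sum>c<n. T c c f) - of_nat n * (Const (1 / of_nat n) * (\<Sum>c<n. T c c f))"
    by (simp add: traceless_def sum_subtractf)
  then show ?thesis using of_nat_mult_Const_inverse[OF assms] by (simp add: mult.assoc[symmetric])
qed

context covariants
begin

text \<open>Both partial traces of the gl_n bracket vanish: contracting a with b, for instance,
  leaves Q^c_d - Q^c_d.\<close>

lemma traceless_pair_Theta:
  assumes idx: "a < n" "b < n" "c < n" "d < n"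
  shows "traceless_pair n (Theta Q) a b c d = Theta Q a b c d"
proof -
  have "(\<Sum>e<n. Theta Q e e x y) = 0" if "x < n" "y < n" for x y
    using that by (simp add: Theta_def sum_subtractf sum_kdelta)
  moreover have "(\<Sum>e<n. Theta Q x y e e) = 0" if "x < n" "y < n" for x y
    using that by (simp add: Theta_def sum_subtractf sum_kdelta)
  ultimately show ?thesis using idx by (simp add: traceless_pair_def)
qed

text \<open>Multiples of the identity drop out of the gl_n bracket, because \<delta>^c_b
  \<delta>^a_d then occurs with both signs. So full and traceless currents give the same right-hand
  side.\<close>

lemma Theta_traceless: "Theta (\<lambda>x y. traceless n T x y f) a b c d = Theta (\<lambda>x y. T x y f) a b c d"
  unfolding Theta_def traceless_def Const_div[of "kdelta a d"] Const_div[of "kdelta c b"]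
  by (simp add: algebra_simps)

lemma Theta_scale: "Theta (\<lambda>x y. g * Q x y) a b c d = g * Theta Q a b c d"
  unfolding Theta_def by (simp add: algebra_simps)

abbreviation J where "J L m a b \<equiv> Jop n k r L a b m"

lemma J_eq: "J L m a b f = Const (scal L m) * traceless n (TT (NL L) m) a b f"
  unfolding Jop_def scal_def eps_def TT_def by (auto simp: Let_def)

lemma linear_op_J: "linear_op (J L m a b)"
proof -
  have "J L m a b = (\<lambda>f. Const (scal L m) * traceless n (TT (NL L) m) a b f)"
    by (rule ext) (rule J_eq)
  then show ?thesis by (simp only:) (intro linear_op_intros linear_op_traceless linear_op_TT)
qed

lemma J_commutator:
  "J L m a b (J L l c d f) - J L l c d (J L m a b f) = Const (scal L m * scal L l) *
    traceless_pair n (\<lambda>a b c d. TT (NL L) m a b (TT (NL L) l c d f) - TT (NL L) l c d (TT (NL L) m a b f)) a b c d"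
  unfolding traceless_commutator[of "TT (NL L) m" "TT (NL L) l", OF linear_op_TT linear_op_TT, symmetric]
  unfolding J_eq linear_opD(2)[OF linear_op_traceless[OF linear_op_TT]]
  by (simp add: Const_mult algebra_simps)

lemma J_same_sign:
  assumes L: "1 \<le> L" and ml: "0 \<le> m \<and> 0 \<le> l \<or> m \<le> 0 \<and> l \<le> 0"
    and idx: "a < n" "b < n" "c < n" "d < n"
  shows "J L m a b (J L l c d f) - J L l c d (J L m a b f)
    = Const (kdelta c b) * J L (m + l) a d f - Const (kdelta a d) * J L (m + l) c b f"
proof -
  have "J L m a b (J L l c d f) - J L l c d (J L m a b f)
      = Const (scal L (m + l)) * traceless_pair n (Theta (\<lambda>x y. TT (NL L) (m + l) x y f)) a b c d"
    unfolding J_commutator TT_commutator[OF ml] scal_mult[OF L ml] Theta_def ..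
  also have "\<dots> = Theta (\<lambda>x y. J L (m + l) x y f) a b c d"
    unfolding traceless_pair_Theta[OF idx] J_eq Theta_scale Theta_traceless ..
  finally show ?thesis by (simp only: Theta_def)
qed

lemma sum_J: "(\<Sum>c<n. J L m c c f) = 0"
  unfolding J_eq sum_distrib_left[symmetric] sum_traceless[OF n_pos] by simp

section \<open>Bounds for all currents\<close>

lemma bnd_traceless:
  assumes "\<And>x y. x < n \<Longrightarrow> y < n \<Longrightarrow> bnd s h (\<lambda>L. T L x y)" "a < n" "b < n"
  shows "bnd s h (\<lambda>L. traceless n (T L) a b)"
  unfolding traceless_def using assms by (intro bnd_diff bnd_scale_const bnd_sum) auto

lemma J_1: "J L 1 a b v = traceless n (\<lambda>x y. YS x y L) a b v"
  and J_minus_1: "J L (- 1) a b v = traceless n (\<lambda>x y. XS x y L) a b v"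
proof -
  have "TT N 1 a b v = WY N a b v" "TT N (- 1) a b v = WX N a b v" for N a b v
    using T_Y_1[of N a b v] T_X_1[of N a b v] by (simp_all add: TT_def)
  then show "J L 1 a b v = traceless n (\<lambda>x y. YS x y L) a b v"
    "J L (- 1) a b v = traceless n (\<lambda>x y. XS x y L) a b v"
    unfolding J_eq traceless_def scal_minus YS_def XS_def sum_distrib_left[symmetric]
    by (simp_all add: algebra_simps)
qed

text \<open>The shift kL \<delta>^a_b separating \<open>W1\<close> from \<open>U\<close> is a
  multiple of the identity and has no traceless part, so the bound for \<open>U\<close> applies to
  the current of degree 0.\<close>

lemma J_0:
  assumes "1 \<le> L"
  shows "J L 0 a b v = traceless n (\<lambda>x y. U x y L) a b v"
proof -
  have t: "TT N 0 a b v = W1 N a b v" for N a b v by (simp add: TT_def T_Y_0)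
  have s: "(\<Sum>c<n. W1 (NL L) c c v) = (\<Sum>c<n. U c c L v) + of_nat n * (Const (of_nat (k * L)) * v)"
    by (simp add: W1_eq_U sum.distrib)
  have r: "u + K * x * v - x * i * (S + m * (K * v)) = u - x * i * S" if "m * i = 1" for u K x v i S m :: cpoly
  proof -
    have "x * i * (m * (K * v)) = (m * i) * (K * x * v)" by (simp add: algebra_simps)
    then have "x * i * (m * (K * v)) = K * x * v" unfolding that by simp
    then show ?thesis by (simp only: distrib_left) simp
  qed
  show ?thesis
    unfolding J_eq traceless_def t s scal_0[OF assms] Const_1 mult_1 Const_div[of "kdelta a b"] W1_eq_U[of L a b]
    by (rule r[OF of_nat_mult_Const_inverse[OF n_pos]])
qed

text \<open>Contracting the inner indices of the exact relation gives n times the wanted current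
  minus \<delta>^a_b times the trace of the currents, which is 0 by \<open>sum_J\<close>.\<close>

lemma J_step:
  assumes L: "1 \<le> L" and sp: "0 \<le> s \<and> 0 \<le> p \<or> s \<le> 0 \<and> p \<le> 0" and ab: "a < n" "b < n"
  shows "J L (p + s) a b f = Const (1 / of_nat n) * (\<Sum>e<n. J L s a e (J L p e b f) - J L p e b (J L s a e f))"
proof -
  have "(\<Sum>e<n. J L s a e (J L p e b f) - J L p e b (J L s a e f))
      = (\<Sum>e<n. J L (s + p) a b f - Const (kdelta a b) * J L (s + p) e e f)"
    using J_same_sign[OF L sp ab(1) _ _ ab(2)] by (intro sum.cong refl) simp
  also have "\<dots> = of_nat n * J L (p + s) a b f"
    by (simp add: sum_subtractf sum_distrib_left[symmetric] sum_J add.commute[of s])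
  finally show ?thesis
    using of_nat_mult_Const_inverse[OF n_pos] by (simp add: mult.assoc[symmetric] mult.commute)
qed

lemma bnd_comp': "bnd s h S \<Longrightarrow> bnd t g T \<Longrightarrow> t + s = u \<Longrightarrow> h + g = w \<Longrightarrow> bnd u w (\<lambda>L v. S L (T L v))"
  using bnd_comp by blast

lemma bnd_J_step:
  assumes J: "\<And>a b. a < n \<Longrightarrow> b < n \<Longrightarrow> bnd (- s) 0 (\<lambda>L. J L s a b)" "\<And>a b. a < n \<Longrightarrow> b < n \<Longrightarrow> bnd (- p) 0 (\<lambda>L. J L p a b)"
    and sp: "0 \<le> s \<and> 0 \<le> p \<or> s \<le> 0 \<and> p \<le> 0" and ab: "a < n" "b < n"
  shows "bnd (- (p + s)) 0 (\<lambda>L. J L (p + s) a b)"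
proof (rule bnd_cong)
  show "bnd (- (p + s)) 0 (\<lambda>L f. Const (1 / of_nat n) * (\<Sum>e<n. J L s a e (J L p e b f) - J L p e b (J L s a e f)))"
    using ab by (intro bnd_scale_const bnd_sum bnd_diff bnd_comp'[OF J(1) J(2)] bnd_comp'[OF J(2) J(1)]) auto
qed (rule J_step[OF _ sp ab])

lemma bnd_J: "a < n \<Longrightarrow> b < n \<Longrightarrow> bnd (- m) 0 (\<lambda>L. J L m a b)"
proof -
  have J0: "bnd 0 0 (\<lambda>L. J L 0 a b)" if "a < n" "b < n" for a b
    by (rule bnd_cong[OF bnd_traceless[OF bnd_U that] J_0])
  have J1: "bnd (- 1) 0 (\<lambda>L. J L 1 a b)" if "a < n" "b < n" for a b
    by (rule bnd_cong[OF bnd_traceless[OF bnd_YS that] J_1])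
  have J2: "bnd 1 0 (\<lambda>L. J L (- 1) a b)" if "a < n" "b < n" for a b
    by (rule bnd_cong[OF bnd_traceless[OF bnd_XS that] J_minus_1])
  have pos: "bnd (- int j) 0 (\<lambda>L. J L (int j) a b)" if "a < n" "b < n" for j a b
    using that
  proof (induction j arbitrary: a b)
    case (Suc j)
    show ?case using bnd_J_step[OF J1 Suc.IH _ Suc.prems] by (simp add: add.commute)
  qed (simp add: J0)
  have neg: "bnd (- (- int j)) 0 (\<lambda>L. J L (- int j) a b)" if "a < n" "b < n" for j a b
    using that
  proof (induction j arbitrary: a b)
    case (Suc j)
    have "bnd (- (- int j + - 1)) 0 (\<lambda>L. J L (- int j + - 1) a b)"
      by (rule bnd_J_step) (use J2 Suc in auto)
    moreover have "- int j + - 1 = - int (Suc j)" by simp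
    ultimately show ?case by (simp only:)
  qed (simp add: J0)
  show "a < n \<Longrightarrow> b < n \<Longrightarrow> bnd (- m) 0 (\<lambda>L. J L m a b)"
    using pos[of a b "nat m"] neg[of a b "nat (- m)"] by (cases "0 \<le> m") auto
qed

subsection \<open>The deviation from the affine relations\<close>

definition central_term :: "int \<Rightarrow> int \<Rightarrow> nat \<Rightarrow> nat \<Rightarrow> nat \<Rightarrow> nat \<Rightarrow> complex" where
  "central_term m l a b c d = of_nat k * of_int m * kdelta (m + l) 0 *
     (kdelta a d * kdelta c b - 1 / of_nat n * kdelta a b * kdelta c d)"

definition deviation :: "int \<Rightarrow> int \<Rightarrow> nat \<Rightarrow> nat \<Rightarrow> nat \<Rightarrow> nat \<Rightarrow> nat \<Rightarrow> cpoly \<Rightarrow> cpoly" where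
  "deviation m l a b c d L f = commutator (J L m a b) (J L l c d) f - Const (kdelta c b) * J L (m + l) a d f
     + Const (kdelta a d) * J L (m + l) c b f - Const (central_term m l a b c d) * f"

definition affine_upto :: "int \<Rightarrow> int \<Rightarrow> bool" where
  "affine_upto m l \<longleftrightarrow> (\<forall>a<n. \<forall>b<n. \<forall>c<n. \<forall>d<n. bnd (- (m + l)) 1 (deviation m l a b c d))"

lemma affine_same_sign:
  assumes ml: "0 \<le> m \<and> 0 \<le> l \<or> m \<le> 0 \<and> l \<le> 0"
  shows "affine_upto m l"
  unfolding affine_upto_def
proof (intro allI impI)
  fix a b c d assume idx: "a < n" "b < n" "c < n" "d < n"
  have "central_term m l a b c d = 0" using ml by (auto simp: central_term_def kdelta_def)
  then have "deviation m l a b c d L f = 0" if "1 \<le> L" for L f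
    using J_same_sign[OF that ml idx] by (simp add: deviation_def commutator_def)
  then show "bnd (- (m + l)) 1 (deviation m l a b c d)"
    by (intro bnd_cong[OF bnd_0]) auto
qed

text \<open>The central term is antisymmetric because l = -m wherever it is nonzero; the remaining
  terms are antisymmetric by inspection.\<close>

lemma affine_swap:
  assumes "affine_upto m l"
  shows "affine_upto l m"
  unfolding affine_upto_def
proof (intro allI impI)
  fix a b c d assume idx: "a < n" "b < n" "c < n" "d < n"
  have "central_term l m a b c d = - central_term m l c d a b"
  proof (cases "m + l = 0")
    case True
    then have "l = - m" by simp
    then show ?thesis by (simp add: central_term_def algebra_simps)
  next
    case False
    then show ?thesis by (simp add: central_term_def kdelta_def add.commute)
  qed
  then have "deviation l m a b c d L f = - deviation m l c d a b L f" for L f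
    by (simp add: deviation_def commutator_def add.commute Const_uminus)
  then show "bnd (- (l + m)) 1 (deviation l m a b c d)"
    using bnd_uminus[of "- (m + l)" 1 "deviation m l c d a b"] assms idx
    by (auto simp: affine_upto_def add.commute intro: bnd_cong)
qed

lemma affine_1: "affine_upto 1 (- 1)"
  unfolding affine_upto_def
proof (intro allI impI)
  fix a b c d assume idx: "a < n" "b < n" "c < n" "d < n"
  let ?i = "Const (1 / of_nat n)" and ?k = "Const (of_nat k)"
  \<comment> \<open>\<open>D\<close> is the expected central term divided by k, \<open>T\<close> the
    expected value of the bracket, and \<open>R\<close> the traceless projection of the
    remainder.\<close>
  define D where "D v = Const (kdelta c b) * (Const (kdelta a d) * v)
      - ?i * (Const (kdelta a b) * (Const (kdelta c d) * v))" for v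
  define T where "T L v = Theta (\<lambda>x y. U x y L v) a b c d + ?k * D v" for L v
  define R where "R L v = traceless_pair n (\<lambda>a b c d. remainder a b c d L v) a b c d" for L v
  \<comment> \<open>Two sources of order 1/L: the defect \<open>eps\<close> times (k + n)L minus 1
    of the normalisation, multiplied by a bounded operator, and the bounded remainder scaled by
    \<open>eps\<close>.\<close>
  have e: "deviation 1 (- 1) a b c d L v = Const (of_real (eps L * real ((k + n) * L) - 1)) * T L v
      + Const (of_real (eps L)) * R L v" if L: "1 \<le> L" and v: "v \<in> Hspace n k (NL L)" for L v
  proof -
    let ?E = "Const (of_real (eps L))" and ?K = "Const (of_nat ((k + n) * L))"
    have tt: "TT (NL L) 1 a b f = WY (NL L) a b f" "TT (NL L) (- 1) a b f = WX (NL L) a b f" for a b f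
      using T_Y_1[of "NL L" a b f] T_X_1[of "NL L" a b f] by (simp_all add: TT_def)
    have "commutator (J L 1 a b) (J L (- 1) c d) v = ?E *
        traceless_pair n (\<lambda>a b c d. WY (NL L) a b (WX (NL L) c d v) - WX (NL L) c d (WY (NL L) a b v)) a b c d"
      unfolding commutator_def J_commutator scal_minus scal_square[OF L] tt ..
    also have "traceless_pair n (\<lambda>a b c d. WY (NL L) a b (WX (NL L) c d v) - WX (NL L) c d (WY (NL L) a b v)) a b c d
      = traceless_pair n (\<lambda>a b c d. ?K * (Theta (\<lambda>x y. U x y L v) a b c d
          + ?k * (Const (kdelta c b) * (Const (kdelta a d) * v)))
        - Const (of_nat (k * L)) * (Const (kdelta a b) * (Const (kdelta c d) * v)) + remainder a b c d L v) a b c d"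
      by (rule traceless_pair_cong[OF _ idx]) (simp only: commutator_expansion[OF v] mult.assoc)
    also have "\<dots> = ?K * T L v + R L v"
      unfolding traceless_pair_add traceless_pair_diff traceless_pair_scale traceless_pair_Theta[OF idx] traceless_pair_kdelta[OF n_pos idx] T_def R_def D_def by simp
    finally have C: "commutator (J L 1 a b) (J L (- 1) c d) v = ?E * (?K * T L v + R L v)" .
    have z: "Const (central_term 1 (- 1) a b c d) * v = ?k * D v"
    proof -
      have "Const (central_term 1 (- 1) a b c d)
          = ?k * (Const (kdelta c b) * Const (kdelta a d) - ?i * (Const (kdelta a b) * Const (kdelta c d)))"
        by (simp add: central_term_def Const_mult[symmetric] Const_diff[symmetric] mult_ac)
      then show ?thesis by (simp only: D_def right_diff_distrib left_diff_distrib mult.assoc)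
    qed
    have "Const (kdelta c b) * J L (1 + - 1) a d v - Const (kdelta a d) * J L (1 + - 1) c b v
        = Theta (\<lambda>x y. traceless n (\<lambda>x y. U x y L) x y v) a b c d"
      by (simp add: Theta_def J_0[OF L])
    also have "\<dots> = T L v - ?k * D v"
      unfolding Theta_traceless T_def by simp
    finally have "deviation 1 (- 1) a b c d L v = ?E * (?K * T L v + R L v) - T L v"
      unfolding deviation_def C z by (simp add: algebra_simps)
    moreover have "Const (of_real (eps L * real ((k + n) * L) - 1)) = ?E * ?K - 1"
      by (simp add: Const_diff Const_mult[symmetric])
    ultimately show ?thesis by (simp only: distrib_left left_diff_distrib mult.assoc) simp
  qed
  have "bnd 0 1 (\<lambda>L v. Const (of_real (eps L * real ((k + n) * L) - 1)) * T L v
      + Const (of_real (eps L)) * R L v)"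
  proof (rule bnd_add)
    have "bnd 0 0 T"
      unfolding T_def D_def by (intro bnd_add bnd_diff bnd_Theta bnd_U bnd_scale_const bnd_id idx)
    moreover have "cmod (of_real (eps L * real ((k + n) * L) - 1)) \<le> 1 / real L ^ 1" if "1 \<le> L" for L
      using eps_bounds(4)[OF that] unfolding norm_of_real by simp
    ultimately show "bnd 0 1 (\<lambda>L v. Const (of_real (eps L * real ((k + n) * L) - 1)) * T L v)"
      using bnd_scale[of 0 0 T "\<lambda>L. of_real (eps L * real ((k + n) * L) - 1)" 1 1] by simp
    have "bnd 0 0 R"
      unfolding R_def traceless_pair_def using idx
      by (intro bnd_add bnd_diff bnd_scale_const bnd_sum bnd_remainder) auto
    moreover have "cmod (of_real (eps L)) \<le> 1 / real L ^ 1" if "1 \<le> L" for L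
      using eps_bounds(1,2)[OF that] by simp
    ultimately show "bnd 0 1 (\<lambda>L v. Const (of_real (eps L)) * R L v)"
      using bnd_scale[of 0 0 R "\<lambda>L. of_real (eps L)" 1 1] by simp
  qed
  from bnd_cong[OF this e] show "bnd (- (1 + - 1)) 1 (deviation 1 (- 1) a b c d)" by simp
qed

section \<open>The Jacobi identity for the deviations\<close>

definition affine_rhs :: "int \<Rightarrow> int \<Rightarrow> nat \<Rightarrow> nat \<Rightarrow> nat \<Rightarrow> nat \<Rightarrow> nat \<Rightarrow> cpoly \<Rightarrow> cpoly" where
  "affine_rhs m l a b c d L f = Const (kdelta c b) * J L (m + l) a d f - Const (kdelta a d) * J L (m + l) c b f
     + Const (central_term m l a b c d) * f"

lemma J_swap: "J L m a b (J L l c d f) = J L l c d (J L m a b f) + affine_rhs m l a b c d L f + deviation m l a b c d L f"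
  by (simp add: affine_rhs_def deviation_def commutator_def)

text \<open>[[S, P], Q] = [S, [P, Q]] - [P, [S, Q]], with each inner bracket written as expected
  value plus deviation. The scalars in the expected values commute and drop out; the currents in
  them, of degrees p + q and s + q, are bracketed once more with S and P.\<close>

lemma jacobi_term:
  "J L s a e (J L p e b (J L q c d f)) - J L p e b (J L s a e (J L q c d f))
      - (J L q c d (J L s a e (J L p e b f)) - J L q c d (J L p e b (J L s a e f)))
    = J L s a e (deviation p q e b c d L f) - deviation p q e b c d L (J L s a e f)
      - J L p e b (deviation s q a e c d L f) + deviation s q a e c d L (J L p e b f)
      + Const (kdelta c b) * (affine_rhs s (p + q) a e e d L f + deviation s (p + q) a e e d L f)
      - Const (kdelta e d) * (affine_rhs s (p + q) a e c b L f + deviation s (p + q) a e c b L f)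
      - Const (kdelta c e) * (affine_rhs p (s + q) e b a d L f + deviation p (s + q) e b a d L f)
      + Const (kdelta a d) * (affine_rhs p (s + q) e b c e L f + deviation p (s + q) e b c e L f)"
proof -
  note lin = linear_opD(1,2,5)[OF linear_op_J]
  let ?S = "J L s a e" and ?P = "J L p e b" and ?Q = "J L q c d"
  have 1: "?S (?P (?Q f)) = ?Q (?S (?P f)) + affine_rhs s q a e c d L (?P f) + deviation s q a e c d L (?P f)
      + ?S (affine_rhs p q e b c d L f) + ?S (deviation p q e b c d L f)"
    by (simp add: J_swap[of L e b p c d q] J_swap[of L a e s c d q] lin)
  have 2: "?P (?S (?Q f)) = ?Q (?P (?S f)) + affine_rhs p q e b c d L (?S f) + deviation p q e b c d L (?S f)
      + ?P (affine_rhs s q a e c d L f) + ?P (deviation s q a e c d L f)"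
    by (simp add: J_swap[of L e b p c d q] J_swap[of L a e s c d q] lin)
  have 3: "?S (affine_rhs p q e b c d L f) - affine_rhs p q e b c d L (?S f)
      = Const (kdelta c b) * (affine_rhs s (p + q) a e e d L f + deviation s (p + q) a e e d L f)
      - Const (kdelta e d) * (affine_rhs s (p + q) a e c b L f + deviation s (p + q) a e c b L f)"
    unfolding affine_rhs_def[of p q] lin J_swap[of L a e s _ _ "p + q"] by (simp add: algebra_simps)
  have 4: "?P (affine_rhs s q a e c d L f) - affine_rhs s q a e c d L (?P f)
      = Const (kdelta c e) * (affine_rhs p (s + q) e b a d L f + deviation p (s + q) e b a d L f)
      - Const (kdelta a d) * (affine_rhs p (s + q) e b c e L f + deviation p (s + q) e b c e L f)"
    unfolding affine_rhs_def[of s q] lin J_swap[of L e b p _ _ "s + q"] by (simp add: algebra_simps)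
  show ?thesis unfolding 1 2 3[unfolded diff_eq_eq] 4[unfolded diff_eq_eq] by (simp add: algebra_simps)
qed

text \<open>The cocycle identity of the affine algebra, contracted as in \<open>J_step\<close>. The
  parts proportional to s and to p both carry n times the traceless delta tensor, so they add up to
  p + s.\<close>

lemma central_term_sum:
  assumes idx: "a < n" "b < n" "c < n" "d < n"
  shows "kdelta c b * (\<Sum>e<n. central_term s (p + q) a e e d) - central_term s (p + q) a d c b - central_term p (s + q) c b a d
      + kdelta a d * (\<Sum>e<n. central_term p (s + q) e b c e) = of_nat n * central_term (p + s) q a b c d"
proof -
  have dd: "(\<Sum>e<n. kdelta x e * kdelta e y) = kdelta x y" if "x < n" for x y :: nat
  proof -
    have "(\<Sum>e<n. kdelta x e * kdelta e y) = (\<Sum>e<n. if e = x then kdelta x y else 0)"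
      by (intro sum.cong) (auto simp: kdelta_def)
    then show ?thesis using that by simp
  qed
  define D where "D = of_nat k * kdelta (p + s + q) 0"
  have ass: "s + (p + q) = p + s + q" "p + (s + q) = p + s + q" by simp_all
  have 1: "(\<Sum>e<n. central_term s (p + q) a e e d) = D * of_int s * (of_nat n * kdelta a d - kdelta a d / of_nat n)"
  proof -
    have "(\<Sum>e<n. central_term s (p + q) a e e d)
        = D * of_int s * (\<Sum>e<n. kdelta a d - 1 / of_nat n * (kdelta a e * kdelta e d))"
      unfolding central_term_def ass D_def sum_distrib_left by (simp add: algebra_simps)
    then show ?thesis
      unfolding sum_subtractf sum_distrib_left[symmetric] dd[OF idx(1)] by simp
  qed
  have 2: "(\<Sum>e<n. central_term p (s + q) e b c e) = D * of_int p * (of_nat n * kdelta c b - kdelta c b / of_nat n)"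
  proof -
    have "(\<Sum>e<n. central_term p (s + q) e b c e)
        = D * of_int p * (\<Sum>e<n. kdelta c b - 1 / of_nat n * (kdelta c e * kdelta e b))"
      unfolding central_term_def ass D_def sum_distrib_left by (simp add: algebra_simps)
    then show ?thesis
      unfolding sum_subtractf sum_distrib_left[symmetric] dd[OF idx(3)] by simp
  qed
  have "of_nat n \<noteq> (0::complex)" using n_pos by simp
  then show ?thesis
    unfolding 1 2 unfolding central_term_def ass by (simp add: D_def field_simps)
qed

lemma affine_rhs_sum:
  assumes idx: "a < n" "b < n" "c < n" "d < n"
  shows "(\<Sum>e<n. Const (kdelta c b) * affine_rhs s (p + q) a e e d L f
      - Const (kdelta e d) * affine_rhs s (p + q) a e c b L f
      - Const (kdelta c e) * affine_rhs p (s + q) e b a d L f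
      + Const (kdelta a d) * affine_rhs p (s + q) e b c e L f)
    = of_nat n * affine_rhs (p + s) q a b c d L f"
proof -
  define j where "j x y = J L (p + s + q) x y f" for x y
  have ass: "s + (p + q) = p + s + q" "p + (s + q) = p + s + q" by simp_all
  have j0: "(\<Sum>e<n. j e e) = 0" by (simp add: j_def sum_J)
  have zsum: "(\<Sum>e<n. Const (z e) * f) = Const (\<Sum>e<n. z e) * f" for z
    by (induction n) (simp_all add: Const_add distrib_right)
  have 1: "(\<Sum>e<n. affine_rhs s (p + q) a e e d L f)
      = of_nat n * j a d + Const (\<Sum>e<n. central_term s (p + q) a e e d) * f"
    unfolding affine_rhs_def ass j_def[symmetric] sum.distrib sum_subtractf sum_distrib_left[symmetric] j0 zsum
    by simp
  have 2: "(\<Sum>e<n. affine_rhs p (s + q) e b c e L f)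
      = - of_nat n * j c b + Const (\<Sum>e<n. central_term p (s + q) e b c e) * f"
    unfolding affine_rhs_def ass j_def[symmetric] sum.distrib sum_subtractf sum_distrib_left[symmetric] j0 zsum
    by simp
  have 3: "affine_rhs s (p + q) a d c b L f + affine_rhs p (s + q) c b a d L f
      = Const (central_term s (p + q) a d c b + central_term p (s + q) c b a d) * f"
    unfolding affine_rhs_def ass j_def[symmetric] by (simp add: kdelta_commute Const_add algebra_simps)
  have "(\<Sum>e<n. Const (kdelta c b) * affine_rhs s (p + q) a e e d L f
      - Const (kdelta e d) * affine_rhs s (p + q) a e c b L f
      - Const (kdelta c e) * affine_rhs p (s + q) e b a d L f
      + Const (kdelta a d) * affine_rhs p (s + q) e b c e L f)
    = Const (kdelta c b) * (of_nat n * j a d + Const (\<Sum>e<n. central_term s (p + q) a e e d) * f)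
      - (affine_rhs s (p + q) a d c b L f + affine_rhs p (s + q) c b a d L f)
      + Const (kdelta a d) * (- of_nat n * j c b + Const (\<Sum>e<n. central_term p (s + q) e b c e) * f)"
    unfolding sum.distrib sum_subtractf sum_kdelta[OF idx(3)] sum_kdelta[OF idx(4)]
      sum_distrib_left[symmetric] 1 2 by simp
  also have "\<dots> = of_nat n * (Const (kdelta c b) * j a d - Const (kdelta a d) * j c b)
      + Const (of_nat n * central_term (p + s) q a b c d) * f"
    unfolding 3 central_term_sum[OF idx, symmetric] by (simp add: Const_add Const_diff Const_mult algebra_simps)
  also have "\<dots> = of_nat n * affine_rhs (p + s) q a b c d L f"
    unfolding affine_rhs_def j_def by (simp add: Const_mult Const_of_nat algebra_simps)
  finally show ?thesis .
qed

text \<open>By \<open>affine_rhs_sum\<close> the expected values satisfy the averaged Jacobi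
  identity among themselves. They cancel, and a combination of deviations, some composed with
  currents, remains; since the currents are bounded, the order 1/L persists.\<close>

lemma deviation_step:
  assumes L: "1 \<le> L" and sp: "0 \<le> s \<and> 0 \<le> p \<or> s \<le> 0 \<and> p \<le> 0" and idx: "a < n" "b < n" "c < n" "d < n"
  shows "deviation (p + s) q a b c d L f = Const (1 / of_nat n) * (\<Sum>e<n.
      J L s a e (deviation p q e b c d L f) - deviation p q e b c d L (J L s a e f)
      - J L p e b (deviation s q a e c d L f) + deviation s q a e c d L (J L p e b f)
      + Const (kdelta c b) * deviation s (p + q) a e e d L f - Const (kdelta e d) * deviation s (p + q) a e c b L f
      - Const (kdelta c e) * deviation p (s + q) e b a d L f + Const (kdelta a d) * deviation p (s + q) e b c e L f)"
    (is "_ = ?i * (\<Sum>e<n. ?E e)")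
proof -
  note lin = linear_opD(2,5,6)[OF linear_op_J]
  let ?R = "\<lambda>e. Const (kdelta c b) * affine_rhs s (p + q) a e e d L f
      - Const (kdelta e d) * affine_rhs s (p + q) a e c b L f
      - Const (kdelta c e) * affine_rhs p (s + q) e b a d L f
      + Const (kdelta a d) * affine_rhs p (s + q) e b c e L f"
  have "J L (p + s) a b (J L q c d f) - J L q c d (J L (p + s) a b f)
      = ?i * (\<Sum>e<n. J L s a e (J L p e b (J L q c d f)) - J L p e b (J L s a e (J L q c d f))
        - (J L q c d (J L s a e (J L p e b f)) - J L q c d (J L p e b (J L s a e f))))"
    unfolding J_step[OF L sp idx(1,2)] lin by (simp only: sum_subtractf right_diff_distrib)
  also have "\<dots> = ?i * (\<Sum>e<n. ?E e + ?R e)"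
    unfolding jacobi_term by (intro arg_cong[of _ _ "(*) ?i"] sum.cong refl) (simp add: distrib_left)
  also have "\<dots> = ?i * (\<Sum>e<n. ?E e) + (of_nat n * ?i) * affine_rhs (p + s) q a b c d L f"
    unfolding sum.distrib[of ?E] affine_rhs_sum[OF idx] by (simp only: distrib_left mult_ac)
  finally show ?thesis
    unfolding of_nat_mult_Const_inverse[OF n_pos] J_swap[of L a b "p + s" c d q] by (simp add: algebra_simps)
qed

lemma affine_step:
  assumes sp: "0 \<le> s \<and> 0 \<le> p \<or> s \<le> 0 \<and> p \<le> 0"
    and aff: "affine_upto p q" "affine_upto s q" "affine_upto s (p + q)" "affine_upto p (s + q)"
  shows "affine_upto (p + s) q"
  unfolding affine_upto_def
proof (intro allI impI)
  fix a b c d assume idx: "a < n" "b < n" "c < n" "d < n"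
  have E: "bnd (- (p + q)) 1 (deviation p q x y z w)" "bnd (- (s + q)) 1 (deviation s q x y z w)"
    "bnd (- (p + s + q)) 1 (deviation s (p + q) x y z w)" "bnd (- (p + s + q)) 1 (deviation p (s + q) x y z w)"
    if "x < n" "y < n" "z < n" "w < n" for x y z w
    using aff that by (simp_all add: affine_upto_def add.assoc add.left_commute)
  show "bnd (- (p + s + q)) 1 (deviation (p + s) q a b c d)"
  proof (rule bnd_cong)
    show "bnd (- (p + s + q)) 1 (\<lambda>L f. Const (1 / of_nat n) * (\<Sum>e<n.
      J L s a e (deviation p q e b c d L f) - deviation p q e b c d L (J L s a e f)
      - J L p e b (deviation s q a e c d L f) + deviation s q a e c d L (J L p e b f)
      + Const (kdelta c b) * deviation s (p + q) a e e d L f - Const (kdelta e d) * deviation s (p + q) a e c b L f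
      - Const (kdelta c e) * deviation p (s + q) e b a d L f + Const (kdelta a d) * deviation p (s + q) e b c e L f))"
      using idx by (intro bnd_scale_const bnd_sum bnd_diff bnd_add E
        bnd_comp'[OF bnd_J E(1)] bnd_comp'[OF E(1) bnd_J] bnd_comp'[OF bnd_J E(2)] bnd_comp'[OF E(2) bnd_J]) auto
  qed (rule deviation_step[OF _ sp idx])
qed

text \<open>For opposite signs the new degrees p + q and s + q partly cancel, so |p| + |q| decreases
  in all four pairs of \<open>affine_step\<close>. A positive p > 1 is split as (p - 1) + 1; once p
  = 1, the negative q is split instead, down to the pair (1, -1).\<close>

lemma affine: "affine_upto p q"
proof (induction "nat \<bar>p\<bar> + nat \<bar>q\<bar>" arbitrary: p q rule: less_induct)
  case less
  have pos_neg: "affine_upto p q"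
    if pq: "0 < p" "q < 0" and IH: "\<And>p' q'. nat \<bar>p'\<bar> + nat \<bar>q'\<bar> < nat \<bar>p\<bar> + nat \<bar>q\<bar> \<Longrightarrow> affine_upto p' q'" for p q
  proof (cases "p = 1")
    case True
    show ?thesis
    proof (cases "q = - 1")
      case True
      with \<open>p = 1\<close> show ?thesis using affine_1 by simp
    next
      case False
      \<comment> \<open>The pairs needed are (q + 1, 1), (-1, 1), (-1, q + 2) and (q + 1, 0); since
        q \<le> -2, all have smaller total size than (1, q).\<close>
      have "affine_upto (q + 1 + - 1) p"
        by (rule affine_step) (use \<open>p = 1\<close> False pq in \<open>auto intro!: IH\<close>)
      then show ?thesis using affine_swap by simp
    qed
  next
    case False
    have "affine_upto (p - 1 + 1) q"
      by (rule affine_step) (use False pq in \<open>auto intro!: IH\<close>)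
    then show ?thesis by simp
  qed
  consider "0 \<le> p \<and> 0 \<le> q \<or> p \<le> 0 \<and> q \<le> 0" | "0 < p" "q < 0" | "0 < q" "p < 0" by linarith
  then show ?case
  proof cases
    case 1
    then show ?thesis by (rule affine_same_sign)
  next
    case 2
    then show ?thesis by (rule pos_neg) (rule less)
  next
    case 3
    then have "affine_upto q p" by (rule pos_neg) (rule less, simp)
    then show ?thesis by (rule affine_swap)
  qed
qed

section \<open>From \<open>bnd\<close> to \<open>has_order\<close>\<close>

lemma linear_op_deviation: "linear_op (deviation m l a b c d L)"
  unfolding deviation_def linear_op_def commutator_def linear_opD(1,2)[OF linear_op_J]
  by (simp add: algebra_simps)

text \<open>A polynomial has finitely many monomials. The lemma connects \<open>End_space\<close>,
  which concerns the whole space, with \<open>bnd\<close>, which speaks of parts of bounded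
  degree.\<close>

lemma Htilde_HH: "v \<in> Htilde n k r L \<Longrightarrow> \<exists>e. v \<in> HL L e"
proof -
  assume v: "v \<in> Htilde n k r L"
  define D where "D = (\<Sum>\<alpha>\<in>Poly_Mapping.keys v. xdeg \<alpha>)"
  have "xdeg \<alpha> \<le> D" if "\<alpha> \<in> Poly_Mapping.keys v" for \<alpha>
    unfolding D_def using that by (intro member_le_sum) auto
  then have "v \<in> HL L (int D)"
    using v by (force simp: HH_def deg_le_def)
  then show ?thesis ..
qed

lemma has_order_if_bnd:
  assumes T: "bnd s h T" and lin: "\<And>L. linear_op (T L)"
  shows "has_order n k r (int h) T"
  unfolding has_order_def
proof (intro conjI allI impI)
  fix L :: nat assume L: "1 \<le> L"
  have "T L v \<in> Htilde n k r L" if "v \<in> Htilde n k r L" for v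
    using Htilde_HH[OF that] bnd_mem[OF T L] by (auto simp: HH_def)
  then show "T L \<in> End_space (Htilde n k r L)"
    using linear_opD[OF lin] by (simp add: End_space_def)
next
  fix e :: nat
  obtain C where C: "C \<ge> 0" "\<And>L v. 1 \<le> L \<Longrightarrow> v \<in> HL L (int e) \<Longrightarrow> fock_norm (T L v) \<le> C / real L ^ h * fock_norm v"
    by (metis bndE T)
  \<comment> \<open>\<open>has_order\<close> asks for a positive constant, while \<open>bnd\<close>
    provides a non-negative one.\<close>
  have "fock_norm (T L v) \<le> (C + 1) * real L powi - int h * fock_norm v"
    if "1 \<le> L" "v \<in> Htilde_le n k r L e" for L v
  proof -
    have "fock_norm (T L v) \<le> C / real L ^ h * fock_norm v"
      using that Htilde_le_subset_HH[of n k r L e] by (intro C(2)) auto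
    also have "\<dots> \<le> (C + 1) / real L ^ h * fock_norm v"
      by (intro mult_right_mono divide_right_mono) (auto simp: fock_norm_nonneg)
    finally show ?thesis by (simp add: power_int_minus divide_inverse)
  qed
  then show "\<exists>C>0. \<forall>L\<ge>1. \<forall>v\<in>Htilde_le n k r L e.
      fock_norm (T L v) \<le> C * real L powi - int h * fock_norm v"
    using C(1) by (intro exI[of _ "C + 1"]) auto
qed

end

theorem theorem8p37:
  fixes n k r a b c d :: nat and m l :: int
  assumes "1 \<le> n" and "1 \<le> k" and "r < n"
    and "a < n" and "b < n" and "c < n" and "d < n"
  shows "has_order n k r 1 (\<lambda>L f.
     commutator (Jop n k r L a b m) (Jop n k r L c d l) f
     - Const (kdelta c b) * Jop n k r L a d (m + l) f
     + Const (kdelta a d) * Jop n k r L c b (m + l) f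
     - Const (of_nat k * of_int m * kdelta (m + l) 0 *
         (kdelta a d * kdelta c b - 1 / of_nat n * kdelta a b * kdelta c d)) * f)"
proof -
  interpret covariants n k r
    using assms by unfold_locales auto
  have "bnd (- (m + l)) 1 (deviation m l a b c d)"
    using affine[of m l] assms by (simp add: affine_upto_def)
  from has_order_if_bnd[OF this linear_op_deviation]
  have "has_order n k r 1 (deviation m l a b c d)" by simp
  then show ?thesis
    by (simp only: deviation_def[abs_def] central_term_def)
qed

end
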